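(* Given $n\in\mathbb{N}$ there exist $\tau(n),M(n)\in\mathbb{N}$ such that for any prime $p$ satisfying $p>M(n)$ and $p\equiv 1\mod n+1$ the group $\Gamma_{n,p}$ acts effectively on the trivial vector bundle $T^{2n}\times\mathbb{C}^{\tau(n)}$ by vector bundle automorphisms and leaving invariant a nowhere vanishing section of the determinant bundle $T^{2n}\times\Lambda^{\tau(n)}\mathbb{C}^{\tau(n)}$.
   Context: $\mathbb{N}$ is the set of strictly positive integers; $T^{k}=(S^1)^k$. All actions are smooth. For $n\in\mathbb{N}$ and a prime $p$, $\Gamma_{n,p}$ is the group generated by elements $a_1,\dots,a_n,b_1,\dots,b_n,f$ with the relations $a_i^p=b_i^p=f^p=[a_i,a_j]=[b_i,b_j]=[a_i,f]=[b_i,f]=1$ for every $i,j$, $[a_i,b_j]=1$ for every $i\neq j$, and $[a_i,b_i]=f$ for every $i$. Vector bundle automorphisms of a bundle $W\to T^{2n}$ are diffeomorphisms of the total space that cover a diffeomorphism of the base $T^{2n}$ (not necessarily the identity) and are complex linear isomorphisms on fibres. The action on $W$ is effective if only the identity element acts trivially on the total space. An action on $W$ by such automorphisms induces one on $\det W$; a section $s$ of $\det W$ is invariant if $\gamma\cdot s(\theta)=s(\gamma\cdot\theta)$ for every group element $\gamma$ and every $\theta\in T^{2n}$. *)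

theory Defs
  imports
    "HOL-Analysis.Abstract_Euclidean_Space"
    "HOL-Analysis.Derivative"
    "HOL-Algebra.Group_Action"
    "HOL-Number_Theory.Cong"
    "HOL-Computational_Algebra.Primes"
    Jordan_Normal_Form.Matrix
begin

unbundle no vec_syntax

section \<open>Groups given by generators and relations\<close>

text \<open>The letter \<open>(x, True)\<close> stands for the generator \<open>x\<close>, and \<open>(x, False)\<close> for its inverse.\<close>

type_synonym 'g word = "('g \<times> bool) list"

definition words :: "'g set \<Rightarrow> 'g word set" where
  "words S = lists (S \<times> UNIV)"

inductive word_eq :: "'g set \<Rightarrow> 'g word set \<Rightarrow> 'g word \<Rightarrow> 'g word \<Rightarrow> bool"
  for S :: "'g set" and R :: "'g word set" where
  refl: "w \<in> words S \<Longrightarrow> word_eq S R w w"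
| sym: "word_eq S R u v \<Longrightarrow> word_eq S R v u"
| trans: "word_eq S R u v \<Longrightarrow> word_eq S R v w \<Longrightarrow> word_eq S R u w"
| append: "word_eq S R u u' \<Longrightarrow> word_eq S R v v' \<Longrightarrow> word_eq S R (u @ v) (u' @ v')"
| cancel: "x \<in> S \<Longrightarrow> word_eq S R [(x, b), (x, \<not> b)] []"
| relator: "r \<in> R \<Longrightarrow> r \<in> words S \<Longrightarrow> word_eq S R r []"

definition word_rel :: "'g set \<Rightarrow> 'g word set \<Rightarrow> ('g word \<times> 'g word) set" where
  "word_rel S R = {(u, v). word_eq S R u v}"

definition presented_group :: "'g set \<Rightarrow> 'g word set \<Rightarrow> 'g word set monoid" where
  "presented_group S R =
    \<lparr>carrier = words S // word_rel S R,
     mult = (\<lambda>X Y. \<Union>u\<in>X. \<Union>v\<in>Y. word_rel S R `` {u @ v}),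
     one = word_rel S R `` {[]}\<rparr>"

lemma word_eq_words: "word_eq S R u v \<Longrightarrow> u \<in> words S \<and> v \<in> words S"
  by (induction rule: word_eq.induct) (auto simp: words_def)

lemma equiv_word_rel: "equiv (words S) (word_rel S R)"
proof (rule equivI)
  show "word_rel S R \<subseteq> words S \<times> words S"
    by (auto simp: word_rel_def dest: word_eq_words)
  show "refl_on (words S) (word_rel S R)"
    by (simp add: refl_on_def word_rel_def word_eq.refl)
  show "sym (word_rel S R)"
    unfolding sym_on_def word_rel_def by (blast intro: word_eq.sym)
  show "trans (word_rel S R)"
    unfolding trans_on_def word_rel_def by (blast intro: word_eq.trans)
qed

lemma presented_group_mult:
  assumes "u \<in> words S" "v \<in> words S"
  shows "(word_rel S R `` {u}) \<otimes>\<^bsub>presented_group S R\<^esub> (word_rel S R `` {v})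
    = word_rel S R `` {u @ v}"
proof -
  have eq: "word_rel S R `` {u' @ v'} = word_rel S R `` {u @ v}"
    if "word_eq S R u u'" "word_eq S R v v'" for u' v'
    using word_eq.append[OF that] equiv_class_eq[OF equiv_word_rel, of "u @ v" "u' @ v'"]
    by (simp add: word_rel_def)
  have "(\<Union>u'\<in>word_rel S R `` {u}. \<Union>v'\<in>word_rel S R `` {v}. word_rel S R `` {u' @ v'})
    = (\<Union>u'\<in>word_rel S R `` {u}. \<Union>v'\<in>word_rel S R `` {v}. word_rel S R `` {u @ v})"
    by (intro SUP_cong HOL.refl eq) (simp_all add: word_rel_def)
  moreover have "u \<in> word_rel S R `` {u}" "v \<in> word_rel S R `` {v}"
    using assms by (simp_all add: word_rel_def word_eq.refl)
  ultimately show ?thesis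
    by (simp add: presented_group_def) blast
qed

lemma words_append: "u \<in> words S \<Longrightarrow> v \<in> words S \<Longrightarrow> u @ v \<in> words S"
  by (auto simp: words_def)

lemma word_inverse:
  assumes "w \<in> words S"
  shows "\<exists>w'\<in>words S. word_eq S R (w' @ w) []"
  using assms
proof (induction w)
  case Nil
  then show ?case by (auto intro!: bexI[of _ "[]"] word_eq.refl simp: words_def)
next
  case (Cons a w)
  obtain x b where a: "a = (x, b)" by (cases a)
  have x: "x \<in> S" and w: "w \<in> words S" using Cons.prems by (auto simp: words_def a)
  obtain w' where w': "w' \<in> words S" "word_eq S R (w' @ w) []" using Cons.IH[OF w] by blast
  have "word_eq S R ([(x, \<not> b), (x, b)] @ w) ([] @ w)"
    by (rule word_eq.append[OF _ word_eq.refl[OF w]]) (use word_eq.cancel[OF x, of R "\<not> b"] in simp)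
  then have "word_eq S R (w' @ ([(x, \<not> b), (x, b)] @ w)) (w' @ w)"
    using word_eq.append[OF word_eq.refl[OF w'(1)]] by simp
  then have "word_eq S R ((w' @ [(x, \<not> b)]) @ a # w) []"
    using word_eq.trans[OF _ w'(2)] by (simp add: a)
  moreover have "w' @ [(x, \<not> b)] \<in> words S" using w'(1) x by (auto simp: words_def)
  ultimately show ?case by blast
qed

lemma group_presented_group: "group (presented_group S R)"
proof (rule groupI)
  let ?G = "presented_group S R"
  have nil: "[] \<in> words S" by (simp add: words_def)
  have cl: "word_rel S R `` {w} \<in> carrier ?G" if "w \<in> words S" for w
    using that by (simp add: presented_group_def quotientI)
  have ex: "\<exists>w\<in>words S. X = word_rel S R `` {w}" if "X \<in> carrier ?G" for X
    using that by (auto simp: presented_group_def elim: quotientE)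
  have one: "\<one>\<^bsub>?G\<^esub> = word_rel S R `` {[]}" by (simp add: presented_group_def)
  show "\<one>\<^bsub>?G\<^esub> \<in> carrier ?G" using cl[OF nil] one by simp
  show "x \<otimes>\<^bsub>?G\<^esub> y \<in> carrier ?G" if "x \<in> carrier ?G" "y \<in> carrier ?G" for x y
    using ex[OF that(1)] ex[OF that(2)] by (auto simp: presented_group_mult intro!: cl words_append)
  show "x \<otimes>\<^bsub>?G\<^esub> y \<otimes>\<^bsub>?G\<^esub> z = x \<otimes>\<^bsub>?G\<^esub> (y \<otimes>\<^bsub>?G\<^esub> z)"
    if "x \<in> carrier ?G" "y \<in> carrier ?G" "z \<in> carrier ?G" for x y z
    using ex[OF that(1)] ex[OF that(2)] ex[OF that(3)]
    by (auto simp: presented_group_mult words_append)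
  show "\<one>\<^bsub>?G\<^esub> \<otimes>\<^bsub>?G\<^esub> x = x" if "x \<in> carrier ?G" for x
    using ex[OF that] by (auto simp: presented_group_mult nil one)
  show "\<exists>y\<in>carrier ?G. y \<otimes>\<^bsub>?G\<^esub> x = \<one>\<^bsub>?G\<^esub>" if "x \<in> carrier ?G" for x
  proof -
    obtain w where w: "w \<in> words S" "x = word_rel S R `` {w}" using ex[OF \<open>x \<in> _\<close>] by blast
    obtain w' where w': "w' \<in> words S" "word_eq S R (w' @ w) []"
      using word_inverse[OF w(1)] by blast
    have "word_rel S R `` {w'} \<otimes>\<^bsub>?G\<^esub> x = \<one>\<^bsub>?G\<^esub>"
      using presented_group_mult[OF w'(1) w(1), of R]
        equiv_class_eq[OF equiv_word_rel, of "w' @ w" "[]" S R] w(2) w'(2)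
      by (simp add: one) (simp add: word_rel_def)
    then show ?thesis using cl[OF w'(1)] by blast
  qed
qed


section \<open>The groups \<open>\<Gamma>\<^bsub>n,p\<^esub>\<close>\<close>

datatype Gamma_gen = gen_a nat | gen_b nat | gen_f

definition Gamma_gens :: "nat \<Rightarrow> Gamma_gen set" where
  "Gamma_gens n = gen_a ` {1..n} \<union> gen_b ` {1..n} \<union> {gen_f}"

definition power_word :: "'g \<Rightarrow> nat \<Rightarrow> 'g word" where
  "power_word x k = replicate k (x, True)"

definition commutator_word :: "'g \<Rightarrow> 'g \<Rightarrow> 'g word" where
  "commutator_word x y = [(x, True), (y, True), (x, False), (y, False)]"

definition Gamma_relators :: "nat \<Rightarrow> nat \<Rightarrow> Gamma_gen word set" where
  "Gamma_relators n p =
     {power_word x p | x. x \<in> Gamma_gens n}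
   \<union> {commutator_word (gen_a i) (gen_a j) | i j. i \<in> {1..n} \<and> j \<in> {1..n}}
   \<union> {commutator_word (gen_b i) (gen_b j) | i j. i \<in> {1..n} \<and> j \<in> {1..n}}
   \<union> {commutator_word (gen_a i) gen_f | i. i \<in> {1..n}}
   \<union> {commutator_word (gen_b i) gen_f | i. i \<in> {1..n}}
   \<union> {commutator_word (gen_a i) (gen_b j) | i j. i \<in> {1..n} \<and> j \<in> {1..n} \<and> i \<noteq> j}
   \<union> {commutator_word (gen_a i) (gen_b i) @ [(gen_f, False)] | i. i \<in> {1..n}}"

definition Gamma :: "nat \<Rightarrow> nat \<Rightarrow> Gamma_gen word set monoid" where
  "Gamma n p = presented_group (Gamma_gens n) (Gamma_relators n p)"


section \<open>Smooth maps on tori and on trivial vector bundles over them\<close>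

text \<open>
  \<open>C_k k N f\<close>: the function \<open>f\<close> on \<open>\<real>\<^sup>N\<close> (the points of \<^const>\<open>Euclidean_space\<close> \<open>N\<close>) has
  continuous partial derivatives of all orders up to \<open>k\<close>; \<open>f' i\<close> is the partial derivative in
  the \<open>i\<close>-th coordinate.
\<close>

primrec C_k :: "nat \<Rightarrow> nat \<Rightarrow> ((nat \<Rightarrow> real) \<Rightarrow> complex) \<Rightarrow> bool" where
  "C_k 0 N f \<longleftrightarrow> continuous_map (Euclidean_space N) euclidean f"
| "C_k (Suc k) N f \<longleftrightarrow> continuous_map (Euclidean_space N) euclidean f \<and>
     (\<exists>f'. \<forall>i<N. C_k k N (f' i) \<and>
        (\<forall>x\<in>topspace (Euclidean_space N).
           ((\<lambda>t. f (x(i := t))) has_vector_derivative f' i x) (at (x i))))"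

definition C_infinity :: "nat \<Rightarrow> ((nat \<Rightarrow> real) \<Rightarrow> complex) \<Rightarrow> bool" where
  "C_infinity N f \<longleftrightarrow> (\<forall>k. C_k k N f)"

type_synonym torus_pt = "nat \<Rightarrow> complex"
type_synonym vb_pt = "torus_pt \<times> complex vec"

definition torus :: "nat \<Rightarrow> torus_pt set" where
  "torus m = {..<m} \<rightarrow>\<^sub>E sphere 0 1"

text \<open>The total space of the trivial bundle \<open>T\<^sup>m \<times> \<complex>\<^sup>r\<close>.\<close>

definition total_space :: "nat \<Rightarrow> nat \<Rightarrow> vb_pt set" where
  "total_space m r = torus m \<times> carrier_vec r"

text \<open>
  The universal coverings \<open>\<real>\<^sup>m \<rightarrow> T\<^sup>m\<close> and \<open>\<real>\<^bsup>m+2r\<^esup> \<rightarrow> T\<^sup>m \<times> \<complex>\<^sup>r\<close>. They are surjective local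
  diffeomorphisms, so a function on the torus or on the bundle is smooth if and only if its
  pullback to Euclidean space is. A map into the torus or into the bundle is smooth if and only
  if its coordinates, as a map into \<open>\<complex>\<^sup>m\<close> or \<open>\<complex>\<^sup>m \<times> \<complex>\<^sup>r\<close>, are, since \<open>T\<^sup>m\<close> is an embedded
  submanifold of \<open>\<complex>\<^sup>m\<close>.
\<close>

definition torus_cover :: "nat \<Rightarrow> (nat \<Rightarrow> real) \<Rightarrow> torus_pt" where
  "torus_cover m x = (\<lambda>j\<in>{..<m}. cis (x j))"

definition bundle_cover :: "nat \<Rightarrow> nat \<Rightarrow> (nat \<Rightarrow> real) \<Rightarrow> vb_pt" where
  "bundle_cover m r x =
    (torus_cover m x, Matrix.vec r (\<lambda>k. Complex (x (m + 2 * k)) (x (m + 2 * k + 1))))"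

definition smooth_fun_torus :: "nat \<Rightarrow> (torus_pt \<Rightarrow> complex) \<Rightarrow> bool" where
  "smooth_fun_torus m h \<longleftrightarrow> C_infinity m (\<lambda>x. h (torus_cover m x))"

definition smooth_fun_bundle :: "nat \<Rightarrow> nat \<Rightarrow> (vb_pt \<Rightarrow> complex) \<Rightarrow> bool" where
  "smooth_fun_bundle m r h \<longleftrightarrow> C_infinity (m + 2 * r) (\<lambda>x. h (bundle_cover m r x))"

definition smooth_torus_map :: "nat \<Rightarrow> (torus_pt \<Rightarrow> torus_pt) \<Rightarrow> bool" where
  "smooth_torus_map m \<psi> \<longleftrightarrow> (\<forall>j<m. smooth_fun_torus m (\<lambda>\<theta>. \<psi> \<theta> j))"

definition smooth_bundle_map ::
  "nat \<Rightarrow> nat \<Rightarrow> (vb_pt \<Rightarrow> vb_pt) \<Rightarrow> bool"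
  where
  "smooth_bundle_map m r \<Psi> \<longleftrightarrow>
     (\<forall>j<m. smooth_fun_bundle m r (\<lambda>e. fst (\<Psi> e) j)) \<and>
     (\<forall>k<r. smooth_fun_bundle m r (\<lambda>e. snd (\<Psi> e) $ k))"

definition torus_diffeo :: "nat \<Rightarrow> (torus_pt \<Rightarrow> torus_pt) \<Rightarrow> bool" where
  "torus_diffeo m \<psi> \<longleftrightarrow> bij_betw \<psi> (torus m) (torus m) \<and>
     smooth_torus_map m \<psi> \<and> smooth_torus_map m (inv_into (torus m) \<psi>)"

definition bundle_diffeo ::
  "nat \<Rightarrow> nat \<Rightarrow> (vb_pt \<Rightarrow> vb_pt) \<Rightarrow> bool"
  where
  "bundle_diffeo m r \<Psi> \<longleftrightarrow> bij_betw \<Psi> (total_space m r) (total_space m r) \<and>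
     smooth_bundle_map m r \<Psi> \<and> smooth_bundle_map m r (inv_into (total_space m r) \<Psi>)"


section \<open>Vector bundle automorphisms\<close>

definition linear_iso :: "nat \<Rightarrow> (complex vec \<Rightarrow> complex vec) \<Rightarrow> bool" where
  "linear_iso r L \<longleftrightarrow> bij_betw L (carrier_vec r) (carrier_vec r) \<and>
     (\<forall>v\<in>carrier_vec r. \<forall>w\<in>carrier_vec r. L (v + w) = L v + L w) \<and>
     (\<forall>c. \<forall>v\<in>carrier_vec r. L (c \<cdot>\<^sub>v v) = c \<cdot>\<^sub>v L v)"

text \<open>
  The map of the base covered by \<open>\<Psi>\<close> is read off on the zero section; that \<open>\<Psi>\<close> does cover it
  is part of \<open>bundle_automorphism\<close>.
\<close>

definition base_map :: "nat \<Rightarrow> (vb_pt \<Rightarrow> vb_pt) \<Rightarrow> torus_pt \<Rightarrow> torus_pt" where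
  "base_map r \<Psi> \<theta> = fst (\<Psi> (\<theta>, 0\<^sub>v r))"

definition fibre_map ::
  "(vb_pt \<Rightarrow> vb_pt)
     \<Rightarrow> torus_pt \<Rightarrow> complex vec \<Rightarrow> complex vec" where
  "fibre_map \<Psi> \<theta> v = snd (\<Psi> (\<theta>, v))"

definition bundle_automorphism :: "nat \<Rightarrow> nat \<Rightarrow> (vb_pt \<Rightarrow> vb_pt) \<Rightarrow> bool" where
  "bundle_automorphism m r \<Psi> \<longleftrightarrow>
     bundle_diffeo m r \<Psi> \<and>
     torus_diffeo m (base_map r \<Psi>) \<and>
     (\<forall>\<theta>\<in>torus m. \<forall>v\<in>carrier_vec r. fst (\<Psi> (\<theta>, v)) = base_map r \<Psi> \<theta>) \<and>
     (\<forall>\<theta>\<in>torus m. linear_iso r (fibre_map \<Psi> \<theta>))"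


section \<open>Exterior powers and the determinant bundle\<close>

type_synonym ext_elem = "((nat \<Rightarrow> complex vec) \<Rightarrow> complex) \<Rightarrow> complex"

definition tuples :: "nat \<Rightarrow> nat \<Rightarrow> (nat \<Rightarrow> complex vec) set" where
  "tuples k d = {..<k} \<rightarrow>\<^sub>E carrier_vec d"

definition alternating_forms :: "nat \<Rightarrow> nat \<Rightarrow> ((nat \<Rightarrow> complex vec) \<Rightarrow> complex) set" where
  "alternating_forms k d = {\<alpha> \<in> extensional (tuples k d).
     (\<forall>x\<in>tuples k d. \<forall>i<k. \<forall>v\<in>carrier_vec d. \<forall>w\<in>carrier_vec d.
        \<alpha> (x(i := v + w)) = \<alpha> (x(i := v)) + \<alpha> (x(i := w))) \<and>
     (\<forall>x\<in>tuples k d. \<forall>i<k. \<forall>c. \<forall>v\<in>carrier_vec d.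
        \<alpha> (x(i := c \<cdot>\<^sub>v v)) = c * \<alpha> (x(i := v))) \<and>
     (\<forall>x\<in>tuples k d. \<forall>i<k. \<forall>j<k. i \<noteq> j \<longrightarrow> x i = x j \<longrightarrow> \<alpha> x = 0)}"

text \<open>
  \<open>\<Lambda>\<^sup>k \<complex>\<^sup>d\<close> as the dual of the space of alternating \<open>k\<close>-forms on \<open>\<complex>\<^sup>d\<close>: by the universal property
  the dual of \<open>\<Lambda>\<^sup>k \<complex>\<^sup>d\<close> is the space of alternating \<open>k\<close>-forms, and \<open>\<Lambda>\<^sup>k \<complex>\<^sup>d\<close> is finite dimensional.
  The decomposable element \<open>v\<^sub>0 \<and> \<dots> \<and> v\<^bsub>k-1\<^esub>\<close> is evaluation at the tuple \<open>v\<close>, so that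
  \<open>ext_map k d L\<close>, the map \<open>\<Lambda>\<^sup>k L\<close>, sends it to \<open>L v\<^sub>0 \<and> \<dots> \<and> L v\<^bsub>k-1\<^esub>\<close>.
\<close>

definition ext_power :: "nat \<Rightarrow> nat \<Rightarrow> ext_elem set" where
  "ext_power k d = {\<omega> \<in> extensional (alternating_forms k d).
     \<forall>\<alpha>\<in>alternating_forms k d. \<forall>\<beta>\<in>alternating_forms k d. \<forall>a b.
       \<omega> (\<lambda>x\<in>tuples k d. a * \<alpha> x + b * \<beta> x) = a * \<omega> \<alpha> + b * \<omega> \<beta>}"

definition ext_zero :: "nat \<Rightarrow> nat \<Rightarrow> ext_elem" where
  "ext_zero k d = (\<lambda>\<alpha>\<in>alternating_forms k d. 0)"

definition ext_map ::
  "nat \<Rightarrow> nat \<Rightarrow> (complex vec \<Rightarrow> complex vec)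
     \<Rightarrow> ext_elem
     \<Rightarrow> ext_elem" where
  "ext_map k d L \<omega> =
    (\<lambda>\<alpha>\<in>alternating_forms k d. \<omega> (\<lambda>x\<in>tuples k d. \<alpha> (\<lambda>i\<in>{..<k}. L (x i))))"

text \<open>
  A section of \<open>T\<^sup>m \<times> \<Lambda>\<^sup>r \<complex>\<^sup>r\<close> is given by its second component; smoothness is tested on the
  linear functionals of \<open>\<Lambda>\<^sup>r \<complex>\<^sup>r\<close>, which are the evaluations at alternating forms.
\<close>

definition det_section :: "nat \<Rightarrow> nat \<Rightarrow> (torus_pt \<Rightarrow> ext_elem) \<Rightarrow> bool" where
  "det_section m r s \<longleftrightarrow> s \<in> torus m \<rightarrow> ext_power r r \<and>
     (\<forall>\<alpha>\<in>alternating_forms r r. smooth_fun_torus m (\<lambda>\<theta>. s \<theta> \<alpha>))"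

definition nowhere_vanishing ::
  "nat \<Rightarrow> nat \<Rightarrow> (torus_pt \<Rightarrow> ext_elem) \<Rightarrow> bool" where
  "nowhere_vanishing m r s \<longleftrightarrow> (\<forall>\<theta>\<in>torus m. s \<theta> \<noteq> ext_zero r r)"

text \<open>The automorphism of the determinant bundle induced by \<open>\<Psi>\<close>.\<close>

definition det_map ::
  "nat \<Rightarrow> (vb_pt \<Rightarrow> vb_pt)
     \<Rightarrow> torus_pt \<times> ext_elem
     \<Rightarrow> torus_pt \<times> ext_elem" where
  "det_map r \<Psi> = (\<lambda>(\<theta>, \<omega>). (base_map r \<Psi> \<theta>, ext_map r r (fibre_map \<Psi> \<theta>) \<omega>))"

definition invariant_section ::
  "('g, 'h) monoid_scheme \<Rightarrow> nat \<Rightarrow> nat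
     \<Rightarrow> ('g \<Rightarrow> vb_pt \<Rightarrow> vb_pt)
     \<Rightarrow> (torus_pt \<Rightarrow> ext_elem) \<Rightarrow> bool" where
  "invariant_section G m r \<phi> s \<longleftrightarrow>
     (\<forall>\<gamma>\<in>carrier G. \<forall>\<theta>\<in>torus m.
        det_map r (\<phi> \<gamma>) (\<theta>, s \<theta>) = (base_map r (\<phi> \<gamma>) \<theta>, s (base_map r (\<phi> \<gamma>) \<theta>)))"


section \<open>Actions by vector bundle automorphisms\<close>

definition acts_by_bundle_automorphisms ::
  "('g, 'h) monoid_scheme \<Rightarrow> nat \<Rightarrow> nat
     \<Rightarrow> ('g \<Rightarrow> vb_pt \<Rightarrow> vb_pt) \<Rightarrow> bool" where
  "acts_by_bundle_automorphisms G m r \<phi> \<longleftrightarrow>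
     group_action G (total_space m r) \<phi> \<and> (\<forall>\<gamma>\<in>carrier G. bundle_automorphism m r (\<phi> \<gamma>))"

definition effective ::
  "('g, 'h) monoid_scheme \<Rightarrow> 'e set \<Rightarrow> ('g \<Rightarrow> 'e \<Rightarrow> 'e) \<Rightarrow> bool" where
  "effective G E \<phi> \<longleftrightarrow> (\<forall>\<gamma>\<in>carrier G. (\<forall>e\<in>E. \<phi> \<gamma> e = e) \<longrightarrow> \<gamma> = \<one>\<^bsub>G\<^esub>)"

end

(*
  Fix p and view T^(2n) as the product of n two-dimensional tori. A translation by 1/p lifts to a
  line bundle of degree divisible by p on each factor, and the lifts of all translations
  generate a Heisenberg group, whose centre acts on the line bundle with degrees p k_1, ..., p k_n
  compatibly with the relations of Gamma_{n,p} as soon as all k_l agree modulo p. It therefore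
  suffices to find such line bundles, at least one of them with k_l = 1 modulo p, whose sum is trivial and whose
  number does not depend on p; the constant section of the determinant of the trivialized sum is
  invariant because the degrees add up to 0.

  In the group of stable classes, a sum of line bundles only depends on the symmetric
  multilinear data sum_v prod_{l in I} v_l for sets I of factors. This follows from two isomorphisms:
  [a] + [b] = [a + b] + [0] in the degree on one factor, and one that moves an exponent from one
  factor to another. Let h be an (n+1)-st root of unity modulo p^n, which exists since p = 1 modulo n+1.
  The bundles with all k_l = h^s, s = 0..n, have data divisible by the required powers of p,
  and so are cancelled by finitely many bundles with all k_l divisible by p. Treating the degrees as
  families indexed by p makes the number of stabilizing summands uniform in p.
*)
theory Submission
  imports Defs "Jordan_Normal_Form.Determinant" "HOL-Library.Function_Algebras"
    "HOL-Number_Theory.Residue_Primitive_Roots" "HOL-Library.Multiset"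
begin

subsection \<open>Smooth functions\<close>

text \<open>A line bundle enters through its factor of automorphy on R^(2n), so an isomorphism
  between sums of line bundles is an invertible matrix of quasi-periodic functions, and the topology
  is contained in two explicit matrices with orthogonal nonzero rows. The second of them reflects
  that on two factors the combination [c, b] - [c, 0] - [0, b] + [0, 0] is concentrated at the
  common zeros of two sections and depends on c b alone.

  The obstacle is the congruence between k and the central character of a summand of degrees p k,
  together with the demand that f act nontrivially somewhere. For a set of j factors the summands
  with k = h^s contribute p^j times the sum of the h^(s j), whereas summands with k = p z, on which
  f acts trivially, can only cancel multiples of p^(2 j). Hence the j-th power sum of the characters
  has to be divisible by p^j for j = 1, ..., n. The n + 1 solutions of x^(n+1) = 1 have power sums
  vanishing in this range, which is where n + 1 and its congruence come from, and a root modulo p^n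
  serves all j at once. The trivial summands needed for stabilization have k = 0 and fit into the
  same pattern.\<close>

lemma continuous_map_Euclidean_space_iff:
  fixes f :: "(nat \<Rightarrow> real) \<Rightarrow> 'a::topological_space"
  shows "continuous_map (Euclidean_space N) euclidean f \<longleftrightarrow> continuous_on (topspace (Euclidean_space N)) f"
  by (simp add: Euclidean_space_def topspace_Euclidean_space euclidean_product_topology)

lemma C_k_continuous: "C_k k N f \<Longrightarrow> continuous_map (Euclidean_space N) euclidean f"
  by (cases k) auto

lemma C_k_Suc_D: "C_k (Suc k) N f \<Longrightarrow> C_k k N f"
proof (induction k arbitrary: f)
  case 0
  then show ?case by simp
next
  case (Suc k)
  from Suc.prems obtain f' where c: "continuous_map (Euclidean_space N) euclidean f"
    and f': "\<And>i. i < N \<Longrightarrow> C_k (Suc k) N (f' i)"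
      "\<And>i x. i < N \<Longrightarrow> x \<in> topspace (Euclidean_space N) \<Longrightarrow>
         ((\<lambda>t. f (x(i := t))) has_vector_derivative f' i x) (at (x i))"
    by (subst (asm) C_k.simps(2)) blast
  show ?case using c f'(2) Suc.IH[OF f'(1)] by auto
qed

text \<open>Lets each partial derivative be supplied on its own; the family that \<open>C_k\<close>
  asks for is then chosen with \<open>SOME\<close>.\<close>

lemma C_k_SucI:
  assumes "continuous_map (Euclidean_space N) euclidean f"
    and "\<And>i. i < N \<Longrightarrow> \<exists>g. C_k k N g \<and> (\<forall>x\<in>topspace (Euclidean_space N).
           ((\<lambda>t. f (x(i := t))) has_vector_derivative g x) (at (x i)))"
  shows "C_k (Suc k) N f"
proof -
  define f' where "f' i = (SOME g. C_k k N g \<and> (\<forall>x\<in>topspace (Euclidean_space N).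
           ((\<lambda>t. f (x(i := t))) has_vector_derivative g x) (at (x i))))" for i
  have "C_k k N (f' i) \<and> (\<forall>x\<in>topspace (Euclidean_space N).
           ((\<lambda>t. f (x(i := t))) has_vector_derivative f' i x) (at (x i)))" if "i < N" for i
    unfolding f'_def by (rule someI_ex[OF assms(2)[OF that]])
  with assms(1) show ?thesis by auto
qed

lemma C_k_SucE:
  assumes "C_k (Suc k) N f" "i < N"
  obtains g where "C_k k N g"
    "\<And>x. x \<in> topspace (Euclidean_space N) \<Longrightarrow>
       ((\<lambda>t. f (x(i := t))) has_vector_derivative g x) (at (x i))"
  using assms by auto

lemma C_k_const: "C_k k N (\<lambda>x. c)"
proof (induction k arbitrary: c)
  case 0
  then show ?case by simp
next
  case (Suc k)
  show ?case
    by (rule C_k_SucI) (use Suc in \<open>auto intro!: exI[of _ "\<lambda>x. 0"] has_vector_derivative_const\<close>)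
qed

lemma topspace_upd:
  "x \<in> topspace (Euclidean_space N) \<Longrightarrow> i < N \<Longrightarrow> x(i := t) \<in> topspace (Euclidean_space N)"
  by (auto simp: topspace_Euclidean_space)

lemma C_k_add: "C_k k N f \<Longrightarrow> C_k k N g \<Longrightarrow> C_k k N (\<lambda>x. f x + g x)"
proof (induction k arbitrary: f g)
  case 0
  then show ?case by (auto simp: continuous_map_Euclidean_space_iff intro!: continuous_intros)
next
  case (Suc k)
  show ?case
  proof (rule C_k_SucI)
    show "continuous_map (Euclidean_space N) euclidean (\<lambda>x. f x + g x)"
      using Suc.prems by (auto simp: continuous_map_Euclidean_space_iff intro!: continuous_intros)
    fix i assume i: "i < N"
    obtain f' where f': "C_k k N f'" "\<And>x. x \<in> topspace (Euclidean_space N) \<Longrightarrow>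
       ((\<lambda>t. f (x(i := t))) has_vector_derivative f' x) (at (x i))"
      using C_k_SucE[OF Suc.prems(1) i] by blast
    obtain g' where g': "C_k k N g'" "\<And>x. x \<in> topspace (Euclidean_space N) \<Longrightarrow>
       ((\<lambda>t. g (x(i := t))) has_vector_derivative g' x) (at (x i))"
      using C_k_SucE[OF Suc.prems(2) i] by blast
    show "\<exists>h. C_k k N h \<and> (\<forall>x\<in>topspace (Euclidean_space N).
           ((\<lambda>t. f (x(i := t)) + g (x(i := t))) has_vector_derivative h x) (at (x i)))"
      using Suc.IH[OF f'(1) g'(1)] f'(2) g'(2)
      by (intro exI[of _ "\<lambda>x. f' x + g' x"]) (auto intro: has_vector_derivative_add)
  qed
qed

lemma C_k_mult: "C_k k N f \<Longrightarrow> C_k k N g \<Longrightarrow> C_k k N (\<lambda>x. f x * g x)"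
proof (induction k arbitrary: f g)
  case 0
  then show ?case by (auto simp: continuous_map_Euclidean_space_iff intro!: continuous_intros)
next
  case (Suc k)
  show ?case
  proof (rule C_k_SucI)
    show "continuous_map (Euclidean_space N) euclidean (\<lambda>x. f x * g x)"
      using Suc.prems by (auto simp: continuous_map_Euclidean_space_iff intro!: continuous_intros)
    fix i assume i: "i < N"
    obtain f' where f': "C_k k N f'" "\<And>x. x \<in> topspace (Euclidean_space N) \<Longrightarrow>
       ((\<lambda>t. f (x(i := t))) has_vector_derivative f' x) (at (x i))"
      using C_k_SucE[OF Suc.prems(1) i] by blast
    obtain g' where g': "C_k k N g'" "\<And>x. x \<in> topspace (Euclidean_space N) \<Longrightarrow>
       ((\<lambda>t. g (x(i := t))) has_vector_derivative g' x) (at (x i))"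
      using C_k_SucE[OF Suc.prems(2) i] by blast
    have c: "C_k k N (\<lambda>x. f x * g' x + f' x * g x)"
      by (rule C_k_add[OF Suc.IH[OF C_k_Suc_D[OF Suc.prems(1)] g'(1)] Suc.IH[OF f'(1) C_k_Suc_D[OF Suc.prems(2)]]])
    have d: "((\<lambda>t. f (x(i := t)) * g (x(i := t))) has_vector_derivative f x * g' x + f' x * g x) (at (x i))"
      if "x \<in> topspace (Euclidean_space N)" for x
      using has_vector_derivative_mult[OF f'(2)[OF that] g'(2)[OF that]] by simp
    show "\<exists>h. C_k k N h \<and> (\<forall>x\<in>topspace (Euclidean_space N).
           ((\<lambda>t. f (x(i := t)) * g (x(i := t))) has_vector_derivative h x) (at (x i)))"
      by (rule exI[of _ "\<lambda>x. f x * g' x + f' x * g x"], rule conjI, rule c, rule ballI, rule d)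
  qed
qed

lemma C_k_cnj: "C_k k N f \<Longrightarrow> C_k k N (\<lambda>x. cnj (f x))"
proof (induction k arbitrary: f)
  case 0
  then show ?case by (auto simp: continuous_map_Euclidean_space_iff intro!: continuous_intros)
next
  case (Suc k)
  show ?case
  proof (rule C_k_SucI)
    show "continuous_map (Euclidean_space N) euclidean (\<lambda>x. cnj (f x))"
      using Suc.prems by (auto simp: continuous_map_Euclidean_space_iff intro!: continuous_intros)
    fix i assume i: "i < N"
    obtain f' where f': "C_k k N f'" "\<And>x. x \<in> topspace (Euclidean_space N) \<Longrightarrow>
       ((\<lambda>t. f (x(i := t))) has_vector_derivative f' x) (at (x i))"
      using C_k_SucE[OF Suc.prems(1) i] by blast
    show "\<exists>h. C_k k N h \<and> (\<forall>x\<in>topspace (Euclidean_space N).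
           ((\<lambda>t. cnj (f (x(i := t)))) has_vector_derivative h x) (at (x i)))"
      using Suc.IH[OF f'(1)] f'(2)
      by (intro exI[of _ "\<lambda>x. cnj (f' x)"]) (auto intro: has_vector_derivative_cnj)
  qed
qed

lemma C_k_inverse:
  "C_k k N f \<Longrightarrow> (\<And>x. x \<in> topspace (Euclidean_space N) \<Longrightarrow> f x \<noteq> 0) \<Longrightarrow> C_k k N (\<lambda>x. inverse (f x))"
proof (induction k arbitrary: f)
  case 0
  then show ?case by (auto simp: continuous_map_Euclidean_space_iff intro!: continuous_intros)
next
  case (Suc k)
  show ?case
  proof (rule C_k_SucI)
    show "continuous_map (Euclidean_space N) euclidean (\<lambda>x. inverse (f x))"
      using Suc.prems by (auto simp: continuous_map_Euclidean_space_iff intro!: continuous_intros)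
    fix i assume i: "i < N"
    obtain f' where f': "C_k k N f'" "\<And>x. x \<in> topspace (Euclidean_space N) \<Longrightarrow>
       ((\<lambda>t. f (x(i := t))) has_vector_derivative f' x) (at (x i))"
      using C_k_SucE[OF Suc.prems(1) i] by blast
    have c: "C_k k N (\<lambda>x. (- 1) * (f' x * (inverse (f x) * inverse (f x))))"
      by (intro C_k_mult C_k_const f'(1) Suc.IH[OF C_k_Suc_D[OF Suc.prems(1)]] Suc.prems(2))
    have d: "((\<lambda>t. inverse (f (x(i := t)))) has_vector_derivative
        (- 1) * (f' x * (inverse (f x) * inverse (f x)))) (at (x i))"
      if x: "x \<in> topspace (Euclidean_space N)" for x
    proof -
      have "((\<lambda>t. inverse (f (x(i := t)))) has_vector_derivative
        (f' x * (- (inverse (f x) * inverse (f x))))) (at (x i))"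
        using field_vector_diff_chain_at[OF f'(2)[OF x], of inverse "- (inverse (f x) * inverse (f x))"]
          DERIV_inverse'[OF DERIV_ident, of "f x" UNIV] Suc.prems(2)[OF x]
        by (simp add: o_def)
      then show ?thesis by simp
    qed
    show "\<exists>h. C_k k N h \<and> (\<forall>x\<in>topspace (Euclidean_space N).
           ((\<lambda>t. inverse (f (x(i := t)))) has_vector_derivative h x) (at (x i)))"
      by (rule exI[of _ "\<lambda>x. (- 1) * (f' x * (inverse (f x) * inverse (f x)))"], rule conjI, rule c, rule ballI, rule d)
  qed
qed

lemma C_k_Re:
  assumes "C_k k N f"
  shows "C_k k N (\<lambda>x. of_real (Re (f x)))"
proof -
  have "(\<lambda>x. of_real (Re (f x))) = (\<lambda>x. (1 / 2) * (f x + cnj (f x)))"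
    by (auto simp: complex_eq_iff)
  then show ?thesis
    using C_k_mult[OF C_k_const C_k_add[OF assms C_k_cnj[OF assms]], of "1/2"] by simp
qed

text \<open>Carrying the whole sequence of derivatives makes the class closed under differentiation
  by an index shift, which is what the induction for the chain rule \<open>C_k_compose_real\<close>
  needs.\<close>

definition smooth_real :: "(real \<Rightarrow> real) \<Rightarrow> bool" where
  "smooth_real g \<longleftrightarrow> (\<exists>G :: nat \<Rightarrow> real \<Rightarrow> real. G 0 = g \<and>
     (\<forall>k t. (G k has_real_derivative G (Suc k) t) (at t)))"

lemma smooth_realD:
  assumes "smooth_real g"
  obtains g' where "smooth_real g'" "\<And>t. (g has_real_derivative g' t) (at t)"
proof -
  from assms obtain G :: "nat \<Rightarrow> real \<Rightarrow> real" where G: "G 0 = g"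
    "\<And>k t. (G k has_real_derivative G (Suc k) t) (at t)"
    unfolding smooth_real_def by blast
  have "smooth_real (G 1)"
    unfolding smooth_real_def by (rule exI[of _ "\<lambda>k. G (Suc k)"]) (use G in auto)
  moreover have "(g has_real_derivative G 1 t) (at t)" for t
    using G(2)[of 0 t] G(1) by simp
  ultimately show ?thesis using that by blast
qed

lemma continuous_compose_smooth_real:
  assumes "smooth_real g" "C_k k N (\<lambda>x. of_real (h x))"
  shows "continuous_map (Euclidean_space N) euclidean (\<lambda>x. complex_of_real (g (h x)))"
proof -
  obtain g' where g': "\<And>t. (g has_real_derivative g' t) (at t)"
    using smooth_realD[OF assms(1)] by blast
  have g: "continuous_on UNIV g"
    using g' by (meson DERIV_continuous_on has_field_derivative_at_within)
  have "continuous_on (topspace (Euclidean_space N)) (\<lambda>x. Re (of_real (h x)))"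
    using C_k_continuous[OF assms(2)] unfolding continuous_map_Euclidean_space_iff
    by (rule continuous_on_Re)
  then have "continuous_on (topspace (Euclidean_space N)) (\<lambda>x. g (h x))"
    by (intro continuous_on_compose2[OF g]) auto
  then show ?thesis
    unfolding continuous_map_Euclidean_space_iff by (rule continuous_on_of_real)
qed

lemma C_k_compose_real:
  assumes "smooth_real g" "C_k k N (\<lambda>x. of_real (h x))"
  shows "C_k k N (\<lambda>x. of_real (g (h x)))"
  using assms
proof (induction k arbitrary: g)
  case 0
  from continuous_compose_smooth_real[OF "0.prems"] show ?case by simp
next
  case (Suc k)
  obtain g' where g': "smooth_real g'" "\<And>t. (g has_real_derivative g' t) (at t)"
    using smooth_realD[OF Suc.prems(1)] by blast
  show ?case
  proof (rule C_k_SucI)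
    show "continuous_map (Euclidean_space N) euclidean (\<lambda>x. complex_of_real (g (h x)))"
      by (rule continuous_compose_smooth_real[OF Suc.prems])
    fix i assume i: "i < N"
    obtain h' where h': "C_k k N h'" "\<And>x. x \<in> topspace (Euclidean_space N) \<Longrightarrow>
       ((\<lambda>t. complex_of_real (h (x(i := t)))) has_vector_derivative h' x) (at (x i))"
      using C_k_SucE[OF Suc.prems(2) i] by blast
    \<comment> \<open>\<open>h\<close> is real valued, but \<open>C_k\<close> deals in complex
      functions and returns a complex partial derivative; \<open>Re\<close> makes it a real factor
      for the chain rule.\<close>
    have c: "C_k k N (\<lambda>x. of_real (g' (h x)) * of_real (Re (h' x)))"
      by (intro C_k_mult Suc.IH[OF g'(1) C_k_Suc_D[OF Suc.prems(2)]] C_k_Re h'(1))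
    have d: "((\<lambda>t. complex_of_real (g (h (x(i := t))))) has_vector_derivative
        of_real (g' (h x)) * of_real (Re (h' x))) (at (x i))"
      if x: "x \<in> topspace (Euclidean_space N)" for x
    proof -
      have "((\<lambda>t. h (x(i := t))) has_real_derivative Re (h' x)) (at (x i))"
        using bounded_linear.has_vector_derivative[OF bounded_linear_Re h'(2)[OF x]]
        by (simp add: has_real_derivative_iff_has_vector_derivative)
      then have "((\<lambda>t. g (h (x(i := t)))) has_real_derivative g' (h x) * Re (h' x)) (at (x i))"
        using DERIV_chain2[where f = g and g = "\<lambda>t. h (x(i := t))" and x = "x i", OF g'(2)] by simp
      then have "((\<lambda>t. g (h (x(i := t)))) has_vector_derivative g' (h x) * Re (h' x)) (at (x i))"
        by (simp add: has_real_derivative_iff_has_vector_derivative)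
      from bounded_linear.has_vector_derivative[OF bounded_linear_of_real this]
      show ?thesis by simp
    qed
    show "\<exists>f'. C_k k N f' \<and> (\<forall>x\<in>topspace (Euclidean_space N).
           ((\<lambda>t. complex_of_real (g (h (x(i := t))))) has_vector_derivative f' x) (at (x i)))"
      using c d by blast
  qed
qed

lemma C_k_coord: "C_k k N (\<lambda>x. of_real (x j))"
proof (cases k)
  case 0
  then show ?thesis
    by (auto simp: continuous_map_Euclidean_space_iff
        intro!: continuous_intros continuous_on_product_then_coordinatewise[OF continuous_on_id])
next
  case (Suc m)
  show ?thesis unfolding Suc
  proof (rule C_k_SucI)
    show "continuous_map (Euclidean_space N) euclidean (\<lambda>x. complex_of_real (x j))"
      by (auto simp: continuous_map_Euclidean_space_iff
        intro!: continuous_intros continuous_on_product_then_coordinatewise[OF continuous_on_id])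
    fix i
    have d: "((\<lambda>t. complex_of_real ((x(i := t)) j)) has_vector_derivative (if i = j then 1 else 0)) (at (x i))" for x
    proof (cases "i = j")
      case True
      have "((\<lambda>t. complex_of_real t) has_vector_derivative of_real 1) (at (x i))"
        by (rule bounded_linear.has_vector_derivative[OF bounded_linear_of_real has_vector_derivative_id])
      with True show ?thesis by simp
    next
      case False
      then show ?thesis by (simp add: has_vector_derivative_const)
    qed
    show "\<exists>g. C_k m N g \<and> (\<forall>x\<in>topspace (Euclidean_space N).
           ((\<lambda>t. complex_of_real ((x(i := t)) j)) has_vector_derivative g x) (at (x i)))"
      using C_k_const d by (intro exI[of _ "\<lambda>x. if i = j then 1 else 0"] conjI ballI)
  qed
qed

lemma smooth_real_cos_sin: "smooth_real (\<lambda>t. cos (c * t))" "smooth_real (\<lambda>t. sin (c * t))"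
proof -
  \<comment> \<open>The k-th derivative of sin (c t + a) is c^k sin (c t + a + k pi/2). One family
    covers both functions: a = 0 gives the sine and a = pi/2 the cosine.\<close>
  define G :: "nat \<Rightarrow> real \<Rightarrow> real \<Rightarrow> real" where "G = (\<lambda>k a t. c ^ k * sin (c * t + a + real k * pi / 2))"
  have G: "(G k a has_real_derivative G (Suc k) a t) (at t)" for k a t
  proof -
    have "sin (c * t + a + real (Suc k) * pi / 2) = cos (c * t + a + real k * pi / 2)"
    proof -
      have "c * t + a + real (Suc k) * pi / 2 = (c * t + a + real k * pi / 2) + pi / 2"
        by (simp add: distrib_right add_divide_distrib)
      then show ?thesis by (simp only: sin_add) simp
    qed
    moreover have "((\<lambda>t. c ^ k * sin (c * t + a + real k * pi / 2)) has_real_derivative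
        c ^ k * (cos (c * t + a + real k * pi / 2) * c)) (at t)"
      by (rule derivative_eq_intros refl | simp)+
    ultimately show ?thesis
      unfolding G_def by (simp only: power_Suc ac_simps)
  qed
  show "smooth_real (\<lambda>t. sin (c * t))"
    unfolding smooth_real_def by (rule exI[of _ "\<lambda>k. G k 0"], rule conjI) (use G[of _ 0] in \<open>auto simp: G_def\<close>)
  have "G 0 (pi/2) = (\<lambda>t. cos (c * t))"
    by (rule ext) (simp add: G_def sin_add)
  then show "smooth_real (\<lambda>t. cos (c * t))"
    unfolding smooth_real_def using G[of _ "pi/2"] by (intro exI[of _ "\<lambda>k. G k (pi/2)"]) simp
qed

lemma C_k_cis: "C_k k N (\<lambda>x. cis (c * x j))"
proof -
  have "C_k k N (\<lambda>x. of_real (cos (c * x j)) + \<i> * of_real (sin (c * x j)))"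
    by (intro C_k_add C_k_mult C_k_const
        C_k_compose_real[OF smooth_real_cos_sin(1), of k N "\<lambda>x. x j"]
        C_k_compose_real[OF smooth_real_cos_sin(2), of k N "\<lambda>x. x j"] C_k_coord)
  moreover have "(\<lambda>x. of_real (cos (c * x j)) + \<i> * of_real (sin (c * x j))) = (\<lambda>x. cis (c * x j))"
    by (auto simp: complex_eq_iff)
  ultimately show ?thesis by simp
qed

text \<open>Smoothness is local. Localizing in a single coordinate is enough for the later use,
  where the only possible jumps come from the floor of one coordinate.\<close>

lemma C_k_local:
  assumes "\<And>y :: real. \<exists>V g. open V \<and> y \<in> V \<and> C_k k N g \<and>
     (\<forall>x\<in>topspace (Euclidean_space N). x j \<in> V \<longrightarrow> f x = g x)"
  shows "C_k k N f"
  using assms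
proof (induction k arbitrary: f)
  case 0
  show ?case
    unfolding C_k.simps continuous_map_Euclidean_space_iff continuous_on_def
  proof
    fix x :: "nat \<Rightarrow> real" assume x: "x \<in> topspace (Euclidean_space N)"
    obtain V g where V: "open V" "x j \<in> V" "C_k 0 N g"
      "\<And>z. z \<in> topspace (Euclidean_space N) \<Longrightarrow> z j \<in> V \<Longrightarrow> f z = g z"
      using "0.prems"[of "x j"] by auto
    have g: "(g \<longlongrightarrow> g x) (at x within topspace (Euclidean_space N))"
      using V(3) x unfolding C_k.simps continuous_map_Euclidean_space_iff continuous_on_def by blast
    have "open ((\<lambda>z. z j) -` V :: (nat \<Rightarrow> real) set)"
      by (rule open_vimage[OF V(1)])
         (rule continuous_on_product_then_coordinatewise[OF continuous_on_id])
    then have "eventually (\<lambda>z. g z = f z) (at x within topspace (Euclidean_space N))"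
      unfolding eventually_at_topological using V(2,4) x
      by (intro exI[of _ "(\<lambda>z. z j) -` V"]) auto
    from Lim_transform_eventually[OF g this] V(2,4) x
    show "(f \<longlongrightarrow> f x) (at x within topspace (Euclidean_space N))" by simp
  qed
next
  case (Suc k)
  show ?case
  proof (rule C_k_SucI)
    have "C_k k N f"
      by (rule Suc.IH) (use Suc.prems C_k_Suc_D in meson)
    then show "continuous_map (Euclidean_space N) euclidean f"
      by (rule C_k_continuous)
    fix i assume i: "i < N"
    \<comment> \<open>The local derivatives have to be glued to one function;
      \<open>vector_derivative\<close> names their common value without reference to a
      neighbourhood.\<close>
    define f' where "f' x = vector_derivative (\<lambda>t. f (x(i := t))) (at (x i))" for x
    have loc: "\<exists>V g'. open V \<and> y \<in> V \<and> C_k k N g' \<and>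
      (\<forall>x\<in>topspace (Euclidean_space N). x j \<in> V \<longrightarrow>
         ((\<lambda>t. f (x(i := t))) has_vector_derivative g' x) (at (x i)))" for y
    proof -
      obtain V g where V: "open V" "y \<in> V" "C_k (Suc k) N g"
        "\<And>z. z \<in> topspace (Euclidean_space N) \<Longrightarrow> z j \<in> V \<Longrightarrow> f z = g z"
        using Suc.prems[of y] by auto
      obtain g' where g': "C_k k N g'" "\<And>x. x \<in> topspace (Euclidean_space N) \<Longrightarrow>
         ((\<lambda>t. g (x(i := t))) has_vector_derivative g' x) (at (x i))"
        using C_k_SucE[OF V(3) i] by blast
      have "((\<lambda>t. f (x(i := t))) has_vector_derivative g' x) (at (x i))"
        if x: "x \<in> topspace (Euclidean_space N)" "x j \<in> V" for x
      proof (cases "i = j")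
        \<comment> \<open>Varying the coordinate \<open>j\<close> stays in \<open>V\<close> only for
          nearby values, while varying any other coordinate leaves \<open>x j\<close> fixed, so that
          in the second case f and g agree on the whole line.\<close>
        case True
        show ?thesis
          by (rule has_vector_derivative_transform_within_open[OF g'(2)[OF x(1)] V(1)])
             (use x True V(4)[OF topspace_upd[OF x(1) i]] in auto)
      next
        case False
        show ?thesis
          by (rule has_vector_derivative_transform_within_open[OF g'(2)[OF x(1)] open_UNIV])
             (use x False V(4)[OF topspace_upd[OF x(1) i]] in auto)
      qed
      with V g'(1) show ?thesis by blast
    qed
    have d: "((\<lambda>t. f (x(i := t))) has_vector_derivative f' x) (at (x i))"
      if "x \<in> topspace (Euclidean_space N)" for x
    proof -
      obtain V g' where V: "x j \<in> V" "\<forall>x\<in>topspace (Euclidean_space N). x j \<in> V \<longrightarrow>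
         ((\<lambda>t. f (x(i := t))) has_vector_derivative g' x) (at (x i))"
        using loc[of "x j"] by (elim exE conjE) (rule that)
      have "((\<lambda>t. f (x(i := t))) has_vector_derivative g' x) (at (x i))"
        using V that by blast
      then show ?thesis unfolding f'_def by (simp add: vector_derivative_at)
    qed
    have c: "C_k k N f'"
    proof (rule Suc.IH)
      fix y :: real
      obtain V g' where V: "open V" "y \<in> V" "C_k k N g'" and
        g': "\<forall>x\<in>topspace (Euclidean_space N). x j \<in> V \<longrightarrow>
         ((\<lambda>t. f (x(i := t))) has_vector_derivative g' x) (at (x i))"
        using loc[of y] by (elim exE conjE) (rule that)
      have "f' x = g' x" if "x \<in> topspace (Euclidean_space N)" "x j \<in> V" for x
        unfolding f'_def using g'[rule_format, OF that] by (rule vector_derivative_at)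
      with V show "\<exists>V g. open V \<and> y \<in> V \<and> C_k k N g \<and>
        (\<forall>x\<in>topspace (Euclidean_space N). x j \<in> V \<longrightarrow> f' x = g x)" by blast
    qed
    show "\<exists>g. C_k k N g \<and> (\<forall>x\<in>topspace (Euclidean_space N).
           ((\<lambda>t. f (x(i := t))) has_vector_derivative g x) (at (x i)))"
      using c d by blast
  qed
qed

text \<open>Points of \<open>Euclidean_space N\<close> vanish from coordinate N on, whereas the
  sections below are functions of all coordinates. This projection mediates between the two.\<close>

definition trunc :: "nat \<Rightarrow> (nat \<Rightarrow> real) \<Rightarrow> nat \<Rightarrow> real" where
  "trunc m x = (\<lambda>j. if j < m then x j else 0)"

lemma trunc_topspace: "x \<in> topspace (Euclidean_space N) \<Longrightarrow> trunc m x \<in> topspace (Euclidean_space N)"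
  by (auto simp: topspace_Euclidean_space trunc_def)

lemma C_k_trunc: "C_k k N f \<Longrightarrow> C_k k N (\<lambda>x. f (trunc m x))"
proof (induction k arbitrary: f)
  case 0
  have c: "continuous_on (topspace (Euclidean_space N)) (trunc m)"
    unfolding trunc_def
  proof (rule continuous_on_coordinatewise_then_product)
    fix i show "continuous_on (topspace (Euclidean_space N)) (\<lambda>x. if i < m then x i else 0)"
      by (cases "i < m") (auto intro: continuous_on_product_then_coordinatewise[OF continuous_on_id])
  qed
  show ?case
    using "0.prems" unfolding C_k.simps continuous_map_Euclidean_space_iff
    by (rule continuous_on_compose2[OF _ c]) (auto intro: trunc_topspace)
next
  case (Suc k)
  show ?case
  proof (rule C_k_SucI)
    show "continuous_map (Euclidean_space N) euclidean (\<lambda>x. f (trunc m x))"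
      using Suc.IH[OF C_k_Suc_D[OF Suc.prems]] by (rule C_k_continuous)
    fix i assume i: "i < N"
    obtain f' where f': "C_k k N f'" "\<And>x. x \<in> topspace (Euclidean_space N) \<Longrightarrow>
       ((\<lambda>t. f (x(i := t))) has_vector_derivative f' x) (at (x i))"
      using C_k_SucE[OF Suc.prems i] by blast
    show "\<exists>g. C_k k N g \<and> (\<forall>x\<in>topspace (Euclidean_space N).
           ((\<lambda>t. f (trunc m (x(i := t)))) has_vector_derivative g x) (at (x i)))"
    proof (cases "i < m")
      case True
      then have "trunc m (x(i := t)) = (trunc m x)(i := t)" and "trunc m x i = x i" for x t
        by (auto simp: trunc_def)
      then have d: "((\<lambda>t. f (trunc m (x(i := t)))) has_vector_derivative f' (trunc m x)) (at (x i))"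
        if "x \<in> topspace (Euclidean_space N)" for x
        using f'(2)[OF trunc_topspace[OF that, of m]] by simp
      show ?thesis
        by (rule exI, rule conjI, rule Suc.IH[OF f'(1)], rule ballI, rule d)
    next
      case False
      then have "trunc m (x(i := t)) = trunc m x" for x t by (auto simp: trunc_def)
      then show ?thesis
        by (intro exI[of _ "\<lambda>x. 0"]) (simp add: C_k_const)
    qed
  qed
qed

text \<open>Smoothness in every finite number of coordinates at once, so that a section need not
  record on how many factors it is considered.\<close>

definition smooth :: "((nat \<Rightarrow> real) \<Rightarrow> complex) \<Rightarrow> bool" where
  "smooth f \<longleftrightarrow> (\<forall>N. C_infinity N f)"

lemma smooth_iff: "smooth f \<longleftrightarrow> (\<forall>N k. C_k k N f)"
  by (simp add: smooth_def C_infinity_def)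

lemma smooth_const [intro, simp]: "smooth (\<lambda>x. c)"
  and smooth_coord: "smooth (\<lambda>x. of_real (x j))"
  and smooth_cis: "smooth (\<lambda>x. cis (a * x j))"
  and smooth_add: "smooth f \<Longrightarrow> smooth g \<Longrightarrow> smooth (\<lambda>x. f x + g x)"
  and smooth_mult: "smooth f \<Longrightarrow> smooth g \<Longrightarrow> smooth (\<lambda>x. f x * g x)"
  and smooth_cnj: "smooth f \<Longrightarrow> smooth (\<lambda>x. cnj (f x))"
  and smooth_inverse: "smooth f \<Longrightarrow> (\<And>x. f x \<noteq> 0) \<Longrightarrow> smooth (\<lambda>x. inverse (f x))"
  and smooth_compose_real: "smooth_real h \<Longrightarrow> smooth (\<lambda>x. of_real (u x)) \<Longrightarrow> smooth (\<lambda>x. of_real (h (u x)))"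
  and smooth_trunc: "smooth f \<Longrightarrow> smooth (\<lambda>x. f (trunc m x))"
  by (auto simp: smooth_iff intro: C_k_const C_k_coord C_k_cis C_k_add C_k_mult C_k_cnj
      C_k_inverse C_k_compose_real C_k_trunc)

lemma smooth_local:
  assumes "\<And>y :: real. \<exists>V g. open V \<and> y \<in> V \<and> smooth g \<and> (\<forall>x. x j \<in> V \<longrightarrow> f x = g x)"
  shows "smooth f"
  unfolding smooth_iff
proof (intro allI)
  fix N k
  show "C_k k N f"
  proof (rule C_k_local)
    fix y :: real
    show "\<exists>V g. open V \<and> y \<in> V \<and> C_k k N g \<and> (\<forall>x\<in>topspace (Euclidean_space N). x j \<in> V \<longrightarrow> f x = g x)"
      using assms[of y] unfolding smooth_iff by blast
  qed
qed

lemma smooth_uminus: "smooth f \<Longrightarrow> smooth (\<lambda>x. - f x)"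
  using smooth_mult[OF smooth_const[of "- 1"]] by simp

lemma smooth_power: "smooth f \<Longrightarrow> smooth (\<lambda>x. f x ^ m)"
  by (induction m) (auto intro: smooth_mult)

subsection \<open>The flat function\<close>

definition flat :: "real \<Rightarrow> real" where
  "flat t = (if t > 0 then exp (- inverse t) else 0)"

lemma flat_pos_iff: "flat t > 0 \<longleftrightarrow> t > 0" and flat_nonneg: "flat t \<ge> 0"
  and flat_eq_0_iff: "flat t = 0 \<longleftrightarrow> t \<le> 0"
  by (auto simp: flat_def)

text \<open>The class to which all derivatives of \<open>flat\<close> belong: with s = 1/t,
  differentiation replaces P(s) by s^2 (P(s) - P'(s)).\<close>

definition flat_poly :: "real poly \<Rightarrow> real \<Rightarrow> real" where
  "flat_poly P t = (if t > 0 then poly P (inverse t) * exp (- inverse t) else 0)"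

lemma poly_times_exp_tendsto_0: "((\<lambda>s. poly P s * exp (- s)) \<longlongrightarrow> (0::real)) at_top"
proof -
  have *: "((\<lambda>s. Polynomial.coeff P i * (s ^ i / exp s)) \<longlongrightarrow> (0::real)) at_top" for i
    using tendsto_mult_right_zero[OF tendsto_power_div_exp_0] by blast
  have "((\<lambda>s. \<Sum>i\<le>Polynomial.degree P. Polynomial.coeff P i * (s ^ i / exp s)) \<longlongrightarrow> (0::real)) at_top"
    by (rule tendsto_null_sum) (rule *)
  moreover have "(\<lambda>s. \<Sum>i\<le>Polynomial.degree P. Polynomial.coeff P i * (s ^ i / exp s)) = (\<lambda>s. poly P s * exp (- s))"
    by (rule ext) (simp add: poly_altdef sum_distrib_right sum_divide_distrib exp_minus field_simps)
  ultimately show ?thesis by simp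
qed

lemma flat_poly_deriv:
  "(flat_poly P has_real_derivative flat_poly ([:0, 0, 1:] * (P - pderiv P)) t) (at t)"
proof -
  consider "t > 0" | "t < 0" | "t = 0" by linarith
  then show ?thesis
  proof cases
    case 1
    have "((\<lambda>t. poly P (inverse t) * exp (- inverse t)) has_real_derivative
       flat_poly ([:0, 0, 1:] * (P - pderiv P)) t) (at t)"
      using 1
      by (auto simp: flat_poly_def algebra_simps power2_eq_square divide_simps intro!: derivative_eq_intros
          DERIV_chain2[OF poly_DERIV])
    then show ?thesis
      by (rule has_field_derivative_transform_within_open[of _ _ _ "{0<..}"]) (use 1 in \<open>auto simp: flat_poly_def\<close>)
  next
    case 2
    have "((\<lambda>t. 0) has_real_derivative flat_poly ([:0, 0, 1:] * (P - pderiv P)) t) (at t)"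
      using 2 by (simp add: flat_poly_def)
    then show ?thesis
      by (rule has_field_derivative_transform_within_open[of _ _ _ "{..<0}"]) (use 2 in \<open>auto simp: flat_poly_def\<close>)
  next
    case 3
    \<comment> \<open>At 0 the difference quotient is needed; from the right, with s = 1/h, it
      equals s P(s) exp (-s) and tends to 0.\<close>
    have "((\<lambda>h. flat_poly P h / h) \<longlongrightarrow> 0) (at_right 0)"
    proof -
      have "((\<lambda>h. poly ([:0, 1:] * P) (inverse h) * exp (- inverse h)) \<longlongrightarrow> 0) (at_right 0)"
        using filterlim_compose[OF poly_times_exp_tendsto_0 filterlim_inverse_at_top_right] .
      moreover have "\<forall>\<^sub>F h in at_right 0. poly ([:0, 1:] * P) (inverse h) * exp (- inverse h) = flat_poly P h / h"
        unfolding eventually_at_right_field by (intro exI[of _ 1]) (auto simp: flat_poly_def field_simps)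
      ultimately show ?thesis by (rule Lim_transform_eventually)
    qed
    moreover have "((\<lambda>h. flat_poly P h / h) \<longlongrightarrow> 0) (at_left 0)"
    proof -
      have "\<forall>\<^sub>F h in at_left (0::real). 0 = flat_poly P h / h"
        unfolding eventually_at_left_field by (intro exI[of _ "-1"]) (auto simp: flat_poly_def)
      from Lim_transform_eventually[OF tendsto_const this] show ?thesis .
    qed
    ultimately have "((\<lambda>h. flat_poly P h / h) \<longlongrightarrow> 0) (at 0)"
      by (simp add: filterlim_at_split)
    then show ?thesis using 3 by (simp add: DERIV_def flat_poly_def)
  qed
qed

lemma smooth_real_flat: "smooth_real flat"
proof -
  define Ps where "Ps = (\<lambda>k. ((\<lambda>P. [:0, 0, 1:] * (P - pderiv P)) ^^ k) ([:1:] :: real poly))"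
  show ?thesis
    unfolding smooth_real_def
  proof (intro exI[of _ "\<lambda>k. flat_poly (Ps k)"] conjI allI)
    show "flat_poly (Ps 0) = flat" by (auto simp: Ps_def flat_poly_def flat_def)
    show "(flat_poly (Ps k) has_real_derivative flat_poly (Ps (Suc k)) t) (at t)" for k t
      using flat_poly_deriv[of "Ps k" t] by (simp add: Ps_def)
  qed
qed

subsection \<open>Quasi-periodic functions\<close>

text \<open>Sections of the line bundle over the torus whose degree on the \<open>i\<close>-th factor \<open>T\<^sup>2\<close> is \<open>w i\<close>.\<close>

definition qper :: "(nat \<Rightarrow> int) \<Rightarrow> ((nat \<Rightarrow> real) \<Rightarrow> complex) \<Rightarrow> bool" where
  "qper w f \<longleftrightarrow> smooth f \<and>
     (\<forall>x i. f (x(2 * i := x (2 * i) + 2 * pi)) = f x \<and>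
            f (x(2 * i + 1 := x (2 * i + 1) + 2 * pi)) = cis (of_int (w i) * x (2 * i)) * f x)"

lemma qper_smooth: "qper w f \<Longrightarrow> smooth f"
  by (simp add: qper_def)

lemma qper_shift:
  assumes "qper w f"
  shows "f (x(2 * i := x (2 * i) + 2 * pi)) = f x"
    and "f (x(2 * i + 1 := x (2 * i + 1) + 2 * pi)) = cis (of_int (w i) * x (2 * i)) * f x"
  using assms by (auto simp: qper_def)

lemma qper_const: "qper 0 (\<lambda>x. c)"
  by (simp add: qper_def)

lemma qper_0: "qper w (\<lambda>x. 0)"
  by (simp add: qper_def)

lemma qper_add: "qper w f \<Longrightarrow> qper w g \<Longrightarrow> qper w (\<lambda>x. f x + g x)"
  by (simp add: qper_def smooth_add distrib_left)

lemma qper_uminus: "qper w f \<Longrightarrow> qper w (\<lambda>x. - f x)"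
  by (simp add: qper_def smooth_uminus)

lemma qper_diff: "qper w f \<Longrightarrow> qper w g \<Longrightarrow> qper w (\<lambda>x. f x - g x)"
  using qper_add[OF _ qper_uminus] by simp

lemma qper_sum: "(\<And>i. i \<in> A \<Longrightarrow> qper w (f i)) \<Longrightarrow> qper w (\<lambda>x. \<Sum>i\<in>A. f i x)"
  by (induction A rule: infinite_finite_induct) (auto intro: qper_add qper_0)

lemma qper_mult:
  assumes "qper w f" "qper w' g"
  shows "qper (w + w') (\<lambda>x. f x * g x)"
proof -
  have "cis (of_int ((w + w') i) * t) = cis (of_int (w i) * t) * cis (of_int (w' i) * t)" for i t
    by (simp add: cis_mult distrib_right)
  then show ?thesis
    using assms by (simp only: qper_def smooth_mult) (simp add: mult_ac)
qed

lemma qper_cnj: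
  assumes "qper w f"
  shows "qper (- w) (\<lambda>x. cnj (f x))"
  using assms by (simp add: qper_def smooth_cnj cis_cnj)

lemma qper_inverse:
  assumes "qper w f" "\<And>x. f x \<noteq> 0"
  shows "qper (- w) (\<lambda>x. inverse (f x))"
  using assms by (simp add: qper_def smooth_inverse cis_inverse)

lemma qper_weight: "qper w f \<Longrightarrow> w = w' \<Longrightarrow> qper w' f"
  by simp

text \<open>A substitute for z^c that is smooth at 0 for negative c as well: it equals z^c on the
  unit circle and remains multiplicative in z.\<close>

definition pw :: "complex \<Rightarrow> int \<Rightarrow> complex" where
  "pw z c = (if c \<ge> 0 then z ^ nat c else cnj z ^ nat (- c))"

lemma pw_mult: "pw (z * w) c = pw z c * pw w c"
  by (simp add: pw_def power_mult_distrib)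

lemma pw_eq_0_iff: "pw z c = 0 \<longleftrightarrow> z = 0 \<and> c \<noteq> 0"
  by (auto simp: pw_def)

lemma pw_cis: "pw (cis t) c = cis (of_int c * t)"
  by (auto simp: pw_def Complex.DeMoivre cis_cnj)

lemma qper_pw:
  assumes "qper w f"
  shows "qper (\<lambda>i. c * w i) (\<lambda>x. pw (f x) c)"
proof -
  have "smooth (\<lambda>x. pw (f x) c)"
    unfolding pw_def using assms by (cases "c \<ge> 0") (simp_all add: smooth_power smooth_cnj qper_smooth)
  then show ?thesis
    using assms by (simp add: qper_def pw_mult pw_cis mult.assoc)
qed

definition wt :: "nat \<Rightarrow> int \<Rightarrow> nat \<Rightarrow> int" where
  "wt i c = (\<lambda>l. if l = i then c else 0)"

section \<open>Cut-off functions and sections of a line bundle on one factor\<close>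

definition smooth_step :: "real \<Rightarrow> real" where
  "smooth_step t = flat t / (flat t + flat (1 - t))"

lemma smooth_step_denom: "flat t + flat (1 - t) > 0"
  using flat_nonneg[of t] flat_nonneg[of "1 - t"] flat_pos_iff[of t] flat_pos_iff[of "1 - t"]
  by (cases "t > 0") linarith+

lemma smooth_step_eq_0: "t \<le> 0 \<Longrightarrow> smooth_step t = 0" and smooth_step_eq_1: "t \<ge> 1 \<Longrightarrow> smooth_step t = 1"
  using flat_eq_0_iff[of t] flat_eq_0_iff[of "1 - t"] smooth_step_denom[of t] by (auto simp: smooth_step_def)

lemma smooth_step_eq_0_iff: "smooth_step t = 0 \<longleftrightarrow> t \<le> 0"
  using smooth_step_denom[of t] by (auto simp: smooth_step_def flat_eq_0_iff)

lemma smooth_affine: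
  assumes "smooth (\<lambda>x. of_real (u x))"
  shows "smooth (\<lambda>x. of_real (a + b * u x))"
  using smooth_add[OF smooth_const[of "of_real a"] smooth_mult[OF smooth_const[of "of_real b"] assms]] by simp

lemma smooth_flat: "smooth (\<lambda>x. of_real (u x)) \<Longrightarrow> smooth (\<lambda>x. of_real (flat (u x)))"
  by (rule smooth_compose_real[OF smooth_real_flat])

lemma smooth_smooth_step:
  assumes "smooth (\<lambda>x. of_real (u x))"
  shows "smooth (\<lambda>x. of_real (smooth_step (u x)))"
proof -
  have u: "smooth (\<lambda>x. of_real (flat (1 - u x)))"
    using smooth_flat[OF smooth_affine[OF assms, of 1 "- 1"]] by simp
  have nz: "complex_of_real (flat (u x)) + of_real (flat (1 - u x)) \<noteq> 0" for x
    using smooth_step_denom[of "u x"] by (simp flip: of_real_add)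
  have "smooth (\<lambda>x. of_real (flat (u x)) * inverse (of_real (flat (u x)) + of_real (flat (1 - u x))))"
    by (intro smooth_mult smooth_inverse smooth_add smooth_flat u assms nz)
  then show ?thesis by (simp add: smooth_step_def divide_inverse)
qed

text \<open>A periodic height with value 0 at the multiples of 2 pi, where the phase of
  \<open>tsec\<close> jumps, and value 1 at the odd multiples of pi, where that of
  \<open>ssec\<close> jumps.\<close>

definition height :: "real \<Rightarrow> real" where
  "height y = (1 - cos y) / 2"

lemma height_periodic: "height (y + 2 * pi) = height y"
  by (simp add: height_def)

lemma continuous_on_height: "continuous_on UNIV height"
  unfolding height_def by (intro continuous_intros) auto

lemma smooth_height: "smooth (\<lambda>x. of_real (height (x j)))"
proof -
  have "smooth (\<lambda>x. of_real (1/2 + (- 1/2) * cos (1 * x j)))"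
    by (intro smooth_affine smooth_compose_real[OF smooth_real_cos_sin(1)] smooth_coord)
  then show ?thesis by (simp add: height_def field_simps)
qed

lemma qper_periodic_coord:
  assumes "smooth (\<lambda>x. of_real (h (x (2 * i + 1))))" "\<And>y. h (y + 2 * pi) = h y"
  shows "qper 0 (\<lambda>x. of_real (h (x (2 * i + 1))))"
proof -
  have "2 * i + 1 \<noteq> 2 * l" for l :: nat by presburger
  then show ?thesis using assms by (auto simp: qper_def)
qed

text \<open>A cut-off function vanishing at the jumps of the floor function turns the discontinuous
  phase of a line bundle into a smooth section.\<close>

lemma qper_cutoff:
  assumes sm: "smooth (\<lambda>x. of_real (h (x (2 * i + 1))))" and per: "\<And>y. h (y + 2 * pi) = h y"
    and van: "\<And>m :: int. \<exists>V. open V \<and> of_int m * (2 * pi) - a \<in> V \<and> (\<forall>y\<in>V. h y = 0)"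
  shows "qper (wt i e) (\<lambda>x. of_real (h (x (2 * i + 1))) *
           cis (of_int e * of_int \<lfloor>(x (2 * i + 1) + a) / (2 * pi)\<rfloor> * x (2 * i)))"
    (is "qper _ ?f")
proof -
  let ?j = "2 * i + 1"
  have "smooth ?f"
  proof (rule smooth_local[where j = ?j])
    fix y :: real
    define m where "m = \<lfloor>(y + a) / (2 * pi)\<rfloor>"
    show "\<exists>V g. open V \<and> y \<in> V \<and> smooth g \<and> (\<forall>x. x ?j \<in> V \<longrightarrow> ?f x = g x)"
    proof (cases "y = of_int m * (2 * pi) - a")
      case True
      obtain V where "open V" "of_int m * (2 * pi) - a \<in> V" "\<forall>y\<in>V. h y = 0"
        using van by blast
      with True show ?thesis
        by (intro exI[of _ V] exI[of _ "\<lambda>x. 0"]) auto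
    next
      case False
      define V where "V = {of_int m * (2 * pi) - a <..< of_int (m + 1) * (2 * pi) - a}"
      have "of_int m \<le> (y + a) / (2 * pi)" "(y + a) / (2 * pi) < of_int m + 1"
        unfolding m_def by linarith+
      then have "y \<in> V" using False by (simp add: V_def field_simps)
      have fl: "\<lfloor>(z + a) / (2 * pi)\<rfloor> = m" if "z \<in> V" for z
        by (rule floor_unique) (use that in \<open>simp_all add: V_def field_simps\<close>)
      have "smooth (\<lambda>x. of_real (h (x ?j)) * cis (of_int e * of_int m * x (2 * i)))"
        by (intro smooth_mult sm smooth_cis)
      with \<open>y \<in> V\<close> fl show ?thesis
        by (intro exI[of _ V] exI[of _ "\<lambda>x. of_real (h (x ?j)) * cis (of_int e * of_int m * x (2 * i))"])
           (auto simp: V_def)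
    qed
  qed
  moreover have "?f (x(2 * l := x (2 * l) + 2 * pi)) = ?f x" for x l
  proof -
    have ne: "2 * i + 1 \<noteq> 2 * l" by presburger
    show ?thesis
    proof (cases "l = i")
      case True
      have "cis (of_int e * of_int m * (t + 2 * pi)) = cis (of_int e * of_int m * t)" for m :: int and t
      proof -
        have "cis (of_int e * of_int m * (t + 2 * pi)) = cis (of_int e * of_int m * t) * cis (2 * pi * of_int (e * m))"
          by (simp add: cis_mult algebra_simps)
        then show ?thesis by (simp add: cis_multiple_2pi)
      qed
      with True ne show ?thesis by simp
    qed (use ne in auto)
  qed
  moreover have "?f (x(2 * l + 1 := x (2 * l + 1) + 2 * pi)) = cis (of_int (wt i e l) * x (2 * l)) * ?f x" for x l
  proof (cases "l = i")
    case True
    have "(x ?j + 2 * pi + a) / (2 * pi) = (x ?j + a) / (2 * pi) + 1"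
      by (simp add: field_simps)
    then have "\<lfloor>(x ?j + 2 * pi + a) / (2 * pi)\<rfloor> = \<lfloor>(x ?j + a) / (2 * pi)\<rfloor> + 1"
      by simp
    moreover have "cis (of_int e * (of_int k + 1) * t) = cis (of_int e * t) * cis (of_int e * of_int k * t)" for k :: int and t
      by (simp add: cis_mult algebra_simps)
    ultimately show ?thesis
      using True by (simp add: per wt_def)
  next
    case False
    have "2 * i \<noteq> 2 * l + 1" by presburger
    with False show ?thesis by (simp add: wt_def)
  qed
  ultimately show ?thesis unfolding qper_def by blast
qed

text \<open>All cut-offs depend on the height t. \<open>tsec\<close> vanishes up to t = 1/4 and has
  modulus 1 from t = 1/2 on, so it is a frame of the line bundle there. \<open>ssec\<close> vanishes
  exactly from t = 7/8 on. \<open>plateau\<close> is nonzero exactly for t > 1/2 and is 1 from t =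
  3/4 on; \<open>core\<close> is nonzero exactly for t > 3/4. The thresholds are nested: the zeros
  of \<open>ssec\<close> lie where \<open>core\<close> is nonzero, there \<open>plateau\<close> is
  1, and wherever \<open>plateau\<close> is nonzero \<open>tsec\<close> is a frame.\<close>

definition tsec :: "nat \<Rightarrow> int \<Rightarrow> (nat \<Rightarrow> real) \<Rightarrow> complex" where
  "tsec i e x = of_real (smooth_step (4 * height (x (2 * i + 1)) - 1)) *
     cis (of_int e * of_int \<lfloor>(x (2 * i + 1) + 0) / (2 * pi)\<rfloor> * x (2 * i))"

definition ssec :: "nat \<Rightarrow> int \<Rightarrow> (nat \<Rightarrow> real) \<Rightarrow> complex" where
  "ssec i e x = of_real (flat (7 / 8 - height (x (2 * i + 1)))) *
     cis (of_int e * of_int \<lfloor>(x (2 * i + 1) + pi) / (2 * pi)\<rfloor> * x (2 * i))"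

lemma qper_tsec: "qper (wt i e) (tsec i e)"
  unfolding tsec_def
proof (rule qper_cutoff[where h = "\<lambda>y. smooth_step (4 * height y - 1)"])
  show "smooth (\<lambda>x. of_real (smooth_step (4 * height (x (2 * i + 1)) - 1)))"
    using smooth_smooth_step[OF smooth_affine[OF smooth_height, of "- 1" 4]] by simp
  show "smooth_step (4 * height (y + 2 * pi) - 1) = smooth_step (4 * height y - 1)" for y
    by (simp only: height_periodic)
  fix m :: int
  have "open (height -` {..<1/4})"
    by (rule open_vimage[OF open_lessThan continuous_on_height])
  moreover have "height (of_int m * (2 * pi) - 0) = 0"
    using cos_int_2pin[of m] by (simp add: height_def mult_ac)
  ultimately show "\<exists>V. open V \<and> of_int m * (2 * pi) - 0 \<in> V \<and> (\<forall>y\<in>V. smooth_step (4 * height y - 1) = 0)"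
    by (intro exI[of _ "height -` {..<1/4}"]) (auto intro: smooth_step_eq_0)
qed

lemma qper_ssec: "qper (wt i e) (ssec i e)"
  unfolding ssec_def
proof (rule qper_cutoff[where h = "\<lambda>y. flat (7 / 8 - height y)"])
  show "smooth (\<lambda>x. of_real (flat (7 / 8 - height (x (2 * i + 1)))))"
    using smooth_flat[OF smooth_affine[OF smooth_height, of "7 / 8" "- 1"]] by simp
  show "flat (7 / 8 - height (y + 2 * pi)) = flat (7 / 8 - height y)" for y
    by (simp only: height_periodic)
  fix m :: int
  have "open (height -` {7/8<..})"
    by (rule open_vimage[OF open_greaterThan continuous_on_height])
  moreover have "height (of_int m * (2 * pi) - pi) = 1"
    using cos_int_2pin[of m] sin_int_2pin[of m] by (simp add: height_def cos_diff mult_ac)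
  ultimately show "\<exists>V. open V \<and> of_int m * (2 * pi) - pi \<in> V \<and> (\<forall>y\<in>V. flat (7 / 8 - height y) = 0)"
    by (intro exI[of _ "height -` {7/8<..}"]) (auto simp: flat_eq_0_iff)
qed

definition plateau :: "nat \<Rightarrow> (nat \<Rightarrow> real) \<Rightarrow> real" where
  "plateau i x = smooth_step (4 * height (x (2 * i + 1)) - 2)"

definition core :: "nat \<Rightarrow> (nat \<Rightarrow> real) \<Rightarrow> real" where
  "core i x = flat (4 * height (x (2 * i + 1)) - 3)"

lemma qper_plateau: "qper 0 (\<lambda>x. of_real (plateau i x))"
  unfolding plateau_def
  by (rule qper_periodic_coord[where h = "\<lambda>y. smooth_step (4 * height y - 2)"])
     (use smooth_smooth_step[OF smooth_affine[OF smooth_height, of "- 2" 4]] in \<open>simp_all add: height_def\<close>)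

lemma qper_core: "qper 0 (\<lambda>x. of_real (core i x))"
  unfolding core_def
  by (rule qper_periodic_coord[where h = "\<lambda>y. flat (4 * height y - 3)"])
     (use smooth_flat[OF smooth_affine[OF smooth_height, of "- 3" 4]] in \<open>simp_all add: height_def\<close>)

lemma ssec_0_core: "ssec i e x = 0 \<Longrightarrow> core i x \<noteq> 0"
  by (auto simp: ssec_def core_def flat_eq_0_iff)

lemma core_plateau: "core i x \<noteq> 0 \<Longrightarrow> plateau i x = 1"
  by (auto simp: core_def plateau_def flat_eq_0_iff intro!: smooth_step_eq_1)

lemma plateau_tsec:
  assumes "plateau i x \<noteq> 0"
  shows "tsec i e x = cis (of_int e * (of_int \<lfloor>x (2 * i + 1) / (2 * pi)\<rfloor> * x (2 * i)))"
  using assms by (auto simp: plateau_def tsec_def smooth_step_eq_0_iff smooth_step_eq_1 mult.assoc)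

lemma ssec_tsec_0: "ssec i e x = 0 \<Longrightarrow> tsec i e' x \<noteq> 0"
  by (auto simp: ssec_def tsec_def flat_eq_0_iff smooth_step_eq_0_iff)

subsection \<open>Isomorphisms between sums of line bundles\<close>

text \<open>The entry (s, t) is a homomorphism from the line bundle of degree \<open>ls ! t\<close>
  to the one of degree \<open>ks ! s\<close>, hence a section of the bundle whose degree is the
  difference.\<close>

definition qper_mat :: "(nat \<Rightarrow> int) list \<Rightarrow> (nat \<Rightarrow> int) list \<Rightarrow> ((nat \<Rightarrow> real) \<Rightarrow> complex mat) \<Rightarrow> bool" where
  "qper_mat ks ls F \<longleftrightarrow> (\<forall>x. F x \<in> carrier_mat (length ks) (length ls)) \<and>
     (\<forall>s<length ks. \<forall>t<length ls. qper (ks ! s - ls ! t) (\<lambda>x. F x $$ (s, t)))"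

text \<open>The sums of the line bundles with degrees \<open>ks ! s\<close> and with degrees \<open>ls ! t\<close> are isomorphic.\<close>

definition gauge :: "(nat \<Rightarrow> int) list \<Rightarrow> (nat \<Rightarrow> int) list \<Rightarrow> bool" where
  "gauge ks ls \<longleftrightarrow> (\<exists>F G. qper_mat ks ls F \<and> qper_mat ls ks G \<and>
     (\<forall>x. F x * G x = 1\<^sub>m (length ks) \<and> G x * F x = 1\<^sub>m (length ls)))"

lemma qper_matD:
  assumes "qper_mat ks ls F"
  shows "F x \<in> carrier_mat (length ks) (length ls)" "dim_row (F x) = length ks" "dim_col (F x) = length ls"
    "s < length ks \<Longrightarrow> t < length ls \<Longrightarrow> qper (ks ! s - ls ! t) (\<lambda>x. F x $$ (s, t))"
  using assms by (auto simp: qper_mat_def dest: spec[of _ x])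

lemma gauge_refl: "gauge ks ks"
  unfolding gauge_def
  by (intro exI[of _ "\<lambda>x. 1\<^sub>m (length ks)"])
     (auto simp: qper_mat_def qper_const qper_0)

lemma gauge_sym: "gauge ks ls \<Longrightarrow> gauge ls ks"
  unfolding gauge_def by blast

lemma qper_mat_mult:
  assumes "qper_mat ks ms F" "qper_mat ms ls G"
  shows "qper_mat ks ls (\<lambda>x. F x * G x)"
  unfolding qper_mat_def
proof (intro conjI allI impI)
  fix s t assume st: "s < length ks" "t < length ls"
  have "qper (ks ! s - ls ! t) (\<lambda>x. \<Sum>u\<in>{0..<length ms}. F x $$ (s, u) * G x $$ (u, t))"
  proof (rule qper_sum)
    fix u assume "u \<in> {0..<length ms}"
    then have u: "u < length ms" by simp
    show "qper (ks ! s - ls ! t) (\<lambda>x. F x $$ (s, u) * G x $$ (u, t))"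
      by (rule qper_weight[OF qper_mult[OF qper_matD(4)[OF assms(1) st(1) u] qper_matD(4)[OF assms(2) u st(2)]]])
         simp
  qed
  then show "qper (ks ! s - ls ! t) (\<lambda>x. (F x * G x) $$ (s, t))"
    using st by (simp add: qper_matD(2,3)[OF assms(1)] qper_matD(2,3)[OF assms(2)] scalar_prod_def)
qed (rule mult_carrier_mat[OF qper_matD(1)[OF assms(1)] qper_matD(1)[OF assms(2)]])

lemma gauge_trans:
  assumes "gauge ks ms" "gauge ms ls"
  shows "gauge ks ls"
proof -
  obtain F G where FG: "qper_mat ks ms F" "qper_mat ms ks G"
    "\<And>x. F x * G x = 1\<^sub>m (length ks)" "\<And>x. G x * F x = 1\<^sub>m (length ms)"
    using assms(1) unfolding gauge_def by blast
  obtain F' G' where FG': "qper_mat ms ls F'" "qper_mat ls ms G'"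
    "\<And>x. F' x * G' x = 1\<^sub>m (length ms)" "\<And>x. G' x * F' x = 1\<^sub>m (length ls)"
    using assms(2) unfolding gauge_def by blast
  note c = qper_matD(1)[OF FG(1)] qper_matD(1)[OF FG(2)] qper_matD(1)[OF FG'(1)] qper_matD(1)[OF FG'(2)]
  have "F x * F' x * (G' x * G x) = 1\<^sub>m (length ks)" for x
  proof -
    have "F x * F' x * (G' x * G x) = F x * (F' x * (G' x * G x))"
      by (rule assoc_mult_mat[OF c(1) c(3) mult_carrier_mat[OF c(4) c(2)]])
    also have "F' x * (G' x * G x) = F' x * G' x * G x"
      by (rule assoc_mult_mat[OF c(3) c(4) c(2), symmetric])
    also have "\<dots> = G x" using c(2)[of x] by (simp add: FG'(3))
    finally show ?thesis by (simp add: FG(3))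
  qed
  moreover have "G' x * G x * (F x * F' x) = 1\<^sub>m (length ls)" for x
  proof -
    have "G' x * G x * (F x * F' x) = G' x * (G x * (F x * F' x))"
      by (rule assoc_mult_mat[OF c(4) c(2) mult_carrier_mat[OF c(1) c(3)]])
    also have "G x * (F x * F' x) = G x * F x * F' x"
      by (rule assoc_mult_mat[OF c(2) c(1) c(3), symmetric])
    also have "\<dots> = F' x" using c(3)[of x] by (simp add: FG(4))
    finally show ?thesis by (simp add: FG'(4))
  qed
  ultimately show ?thesis
    unfolding gauge_def
    using qper_mat_mult[OF FG(1) FG'(1)] qper_mat_mult[OF FG'(2) FG(2)] by blast
qed

lemma qper_mat_block:
  assumes "qper_mat ks ls F" "qper_mat ks' ls' F'"
  shows "qper_mat (ks @ ks') (ls @ ls')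
    (\<lambda>x. four_block_mat (F x) (0\<^sub>m (length ks) (length ls')) (0\<^sub>m (length ks') (length ls)) (F' x))"
  unfolding qper_mat_def
proof (intro conjI allI impI)
  fix s t assume st: "s < length (ks @ ks')" "t < length (ls @ ls')"
  show "qper ((ks @ ks') ! s - (ls @ ls') ! t) (\<lambda>x. four_block_mat (F x) (0\<^sub>m (length ks) (length ls'))
      (0\<^sub>m (length ks') (length ls)) (F' x) $$ (s, t))"
    using st qper_matD(4)[OF assms(1), of s t] qper_matD(4)[OF assms(2), of "s - length ks" "t - length ls"]
    by (cases "s < length ks"; cases "t < length ls")
       (simp_all add: qper_matD(2,3)[OF assms(1)] qper_matD(2,3)[OF assms(2)] nth_append qper_0 less_diff_conv2)
next
  fix x
  have "four_block_mat (F x) (0\<^sub>m (length ks) (length ls')) (0\<^sub>m (length ks') (length ls)) (F' x)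
    \<in> carrier_mat (length ks + length ks') (length ls + length ls')"
    by (rule four_block_carrier_mat[OF qper_matD(1)[OF assms(1)] qper_matD(1)[OF assms(2)]])
  then show "four_block_mat (F x) (0\<^sub>m (length ks) (length ls')) (0\<^sub>m (length ks') (length ls)) (F' x)
    \<in> carrier_mat (length (ks @ ks')) (length (ls @ ls'))" by simp
qed

lemma block_mult_one:
  assumes "F \<in> carrier_mat a b" "G \<in> carrier_mat b a" "F * G = 1\<^sub>m a"
    "F' \<in> carrier_mat a' b'" "G' \<in> carrier_mat b' a'" "F' * G' = 1\<^sub>m a'"
  shows "four_block_mat F (0\<^sub>m a b') (0\<^sub>m a' b) F' * four_block_mat G (0\<^sub>m b a') (0\<^sub>m b' a) G'
    = (1\<^sub>m (a + a') :: complex mat)"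
proof -
  have "four_block_mat F (0\<^sub>m a b') (0\<^sub>m a' b) F' * four_block_mat G (0\<^sub>m b a') (0\<^sub>m b' a) G' =
    four_block_mat (F * G + 0\<^sub>m a b' * 0\<^sub>m b' a) (F * 0\<^sub>m b a' + 0\<^sub>m a b' * G')
      (0\<^sub>m a' b * G + F' * 0\<^sub>m b' a) (0\<^sub>m a' b * 0\<^sub>m b a' + F' * G')"
    by (rule mult_four_block_mat) (use assms in auto)
  also have "\<dots> = four_block_mat (1\<^sub>m a) (0\<^sub>m a a') (0\<^sub>m a' a) (1\<^sub>m a')"
    using assms by simp
  also have "\<dots> = 1\<^sub>m (a + a')" by (rule four_block_one_mat)
  finally show ?thesis .
qed

lemma gauge_append:
  assumes "gauge ks ls" "gauge ks' ls'"
  shows "gauge (ks @ ks') (ls @ ls')"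
proof -
  obtain F G where FG: "qper_mat ks ls F" "qper_mat ls ks G"
    "\<And>x. F x * G x = 1\<^sub>m (length ks)" "\<And>x. G x * F x = 1\<^sub>m (length ls)"
    using assms(1) unfolding gauge_def by blast
  obtain F' G' where FG': "qper_mat ks' ls' F'" "qper_mat ls' ks' G'"
    "\<And>x. F' x * G' x = 1\<^sub>m (length ks')" "\<And>x. G' x * F' x = 1\<^sub>m (length ls')"
    using assms(2) unfolding gauge_def by blast
  show ?thesis
    unfolding gauge_def
    by (rule exI, rule exI, rule conjI[OF qper_mat_block[OF FG(1) FG'(1)]],
        rule conjI[OF qper_mat_block[OF FG(2) FG'(2)]])
       (simp add: block_mult_one[OF qper_matD(1)[OF FG(1)] qper_matD(1)[OF FG(2)] FG(3)
            qper_matD(1)[OF FG'(1)] qper_matD(1)[OF FG'(2)] FG'(3)]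
          block_mult_one[OF qper_matD(1)[OF FG(2)] qper_matD(1)[OF FG(1)] FG(4)
            qper_matD(1)[OF FG'(2)] qper_matD(1)[OF FG'(1)] FG'(4)])
qed

lemma gauge_perm:
  assumes "mset ks = mset ls"
  shows "gauge ks ls"
proof -
  obtain f where f: "f permutes {..<length ls}" "permute_list f ls = ks"
    using mset_eq_permutation[OF assms] by blast
  let ?r = "length ls"
  have len: "length ks = ?r" using f(2) by auto
  have nth: "ks ! i = ls ! f i" if "i < ?r" for i
    using f that by (auto simp: permute_list_nth)
  have fr: "f i < ?r" if "i < ?r" for i
    using permutes_in_image[OF f(1), of i] that by simp
  have inj: "f i = f j \<longleftrightarrow> i = j" for i j
    using permutes_inj[OF f(1)] by (auto simp: inj_def)
  define F where "F = mat ?r ?r (\<lambda>(i, j). if j = f i then 1 else (0::complex))"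
  define G where "G = mat ?r ?r (\<lambda>(i, j). if i = f j then 1 else (0::complex))"
  have FG: "F * G = 1\<^sub>m ?r"
  proof (rule eq_matI)
    fix i j assume "i < dim_row (1\<^sub>m ?r)" "j < dim_col (1\<^sub>m ?r)"
    then have ij: "i < ?r" "j < ?r" by auto
    then have "(F * G) $$ (i, j) = (\<Sum>k\<in>{0..<?r}. (if k = f i then 1 else 0) * (if k = f j then 1 else 0))"
      by (simp add: F_def G_def scalar_prod_def)
    also have "\<dots> = (\<Sum>k\<in>{0..<?r}. if k = f i then (if i = j then 1 else 0) else 0)"
      by (rule sum.cong) (auto simp: inj)
    also have "\<dots> = (if i = j then 1 else 0)"
      using fr[OF ij(1)] by (simp add: sum.delta)
    finally show "(F * G) $$ (i, j) = 1\<^sub>m ?r $$ (i, j)" using ij by simp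
  qed (auto simp: F_def G_def)
  have GF: "G * F = 1\<^sub>m ?r"
    by (rule mat_mult_left_right_inverse[OF _ _ FG]) (auto simp: F_def G_def)
  have "qper_mat ks ls (\<lambda>x. F)" "qper_mat ls ks (\<lambda>x. G)"
    by (auto simp: qper_mat_def F_def G_def len nth intro: qper_const qper_0)
  with FG GF len show ?thesis unfolding gauge_def by auto
qed

text \<open>A matrix with pairwise orthogonal nonzero rows is invertible: the inverse is the adjoint
  with its columns divided by the squared row norms. These norms have weight 0, so the inverse has
  quasi-periodic entries of the right weights. To find an isomorphism it therefore suffices to write
  down suitable rows.\<close>

lemma gauge_orthogonal:
  assumes len: "length ks = r" "length ls = r"
    and q: "\<And>s t. s < r \<Longrightarrow> t < r \<Longrightarrow> qper (ks ! s - ls ! t) (F s t)"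
    and orth: "\<And>x s u. s < u \<Longrightarrow> u < r \<Longrightarrow> (\<Sum>t<r. F s t x * cnj (F u t x)) = 0"
    and nz: "\<And>x s. s < r \<Longrightarrow> \<exists>t<r. F s t x \<noteq> 0"
  shows "gauge ks ls"
proof -
  define N where "N s x = (\<Sum>t<r. F s t x * cnj (F s t x))" for s x
  have N: "qper 0 (N s)" if "s < r" for s
    unfolding N_def
    by (intro qper_sum qper_weight[OF qper_mult[OF q qper_cnj[OF q]]]) (use that in auto)
  have N0: "N s x \<noteq> 0" if s: "s < r" for s x
  proof -
    obtain t where t: "t < r" "F s t x \<noteq> 0" using nz[OF s] by blast
    have "0 < (\<Sum>t<r. (cmod (F s t x))\<^sup>2)"
      by (rule sum_pos2[of _ t]) (use t in auto)
    moreover have "N s x = of_real (\<Sum>t<r. (cmod (F s t x))\<^sup>2)"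
      by (simp only: N_def of_real_sum complex_norm_square)
    ultimately show ?thesis by (simp only: of_real_eq_0_iff)
  qed
  have orth': "(\<Sum>t<r. F s t x * cnj (F u t x)) = 0" if "s \<noteq> u" "s < r" "u < r" for s u x
  proof (cases "s < u")
    case False
    with that have "cnj (\<Sum>t<r. F u t x * cnj (F s t x)) = 0" by (simp add: orth)
    then show ?thesis by (simp add: mult.commute)
  qed (use that orth in auto)
  define A where "A x = mat r r (\<lambda>(s, t). F s t x)" for x
  define B where "B x = mat r r (\<lambda>(t, s). cnj (F s t x) * inverse (N s x))" for x
  have AB: "A x * B x = 1\<^sub>m r" for x
  proof (rule eq_matI)
    fix s u assume "s < dim_row (1\<^sub>m r)" "u < dim_col (1\<^sub>m r)"
    then have su: "s < r" "u < r" by auto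
    then have "(A x * B x) $$ (s, u) = (\<Sum>t<r. F s t x * cnj (F u t x)) * inverse (N u x)"
      by (simp add: A_def B_def scalar_prod_def sum_distrib_right mult.assoc atLeast0LessThan)
    then show "(A x * B x) $$ (s, u) = 1\<^sub>m r $$ (s, u)"
      using su N0[of u x] orth'[of s u x] by (cases "s = u") (simp_all add: N_def)
  qed (auto simp: A_def B_def)
  have BA: "B x * A x = 1\<^sub>m r" for x
    by (rule mat_mult_left_right_inverse[OF _ _ AB]) (auto simp: A_def B_def)
  have "qper_mat ks ls A"
    unfolding qper_mat_def A_def using q by (simp add: len)
  moreover have "qper_mat ls ks B"
    unfolding qper_mat_def B_def
  proof (intro conjI allI impI)
    fix t s assume "t < length ls" "s < length ks"
    with len have st: "s < r" "t < r" by auto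
    have "qper (ls ! t - ks ! s) (\<lambda>x. cnj (F s t x) * inverse (N s x))"
      by (rule qper_weight[OF qper_mult[OF qper_cnj[OF q[OF st]] qper_inverse[OF N[OF st(1)] N0[OF st(1)]]]]) simp
    with st show "qper (ls ! t - ks ! s) (\<lambda>x. mat r r (\<lambda>(t, s). cnj (F s t x) * inverse (N s x)) $$ (t, s))"
      by simp
  qed (auto simp: len)
  ultimately show ?thesis
    unfolding gauge_def using AB BA len by auto
qed

lemma cnj_tsec: "cnj (tsec i e x) = tsec i (- e) x" and cnj_ssec: "cnj (ssec i e x) = ssec i (- e) x"
  by (simp_all add: tsec_def ssec_def cis_cnj)

lemma less_2_cases': "(n::nat) < 2 \<Longrightarrow> n = 0 \<or> n = 1" by auto

lemma sum_less_2: "(\<Sum>t<2. f t) = f 0 + f (1::nat)"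
  by (simp add: numeral_2_eq_2)

text \<open>The matrix has the shape of a quaternion. Its rows are orthogonal because conjugation
  negates the degree of \<open>ssec\<close> and \<open>tsec\<close>, and they are nonzero because
  \<open>ssec\<close> and \<open>tsec\<close> have no common zero.\<close>

lemma gauge_add:
  "gauge [k(i := a), k(i := b)] [k(i := a + b), k(i := 0)]"
proof (rule gauge_orthogonal[where r = 2])
  let ?F = "\<lambda>(s::nat) (t::nat) x. if s = 0 then if t = 0 then ssec i (- b) x else - tsec i a x
               else if t = 0 then tsec i (- a) x else ssec i b x"
  have w: "k(i := c) - k(i := d) = wt i (c - d)" for c d
    by (auto simp: wt_def)
  show "qper ([k(i := a), k(i := b)] ! s - [k(i := a + b), k(i := 0)] ! t) (?F s t)" if "s < 2" "t < (2::nat)" for s t :: nat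
    using less_2_cases'[OF that(1)] less_2_cases'[OF that(2)]
    by (auto simp: w qper_tsec qper_ssec qper_uminus[OF qper_tsec])
  show "(\<Sum>t<2. ?F s t x * cnj (?F u t x)) = 0" if "s < u" "u < (2::nat)" for s u :: nat and x
    using less_2_cases'[OF that(2)] that(1) by (auto simp: sum_less_2 cnj_tsec cnj_ssec)
  show "\<exists>t<2. ?F s t x \<noteq> 0" if "s < (2::nat)" for s :: nat and x
  proof -
    have "\<exists>t\<in>{0, 1}. ?F s t x \<noteq> 0"
      using less_2_cases'[OF that] ssec_tsec_0[of i "- b" x a] ssec_tsec_0[of i b x "- a"] by auto
    then obtain t where "t \<in> {0, 1}" "?F s t x \<noteq> 0" by (rule bexE)
    then show ?thesis by (intro exI[of _ t] conjI) auto
  qed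
qed auto


section \<open>Moving an exponent from one factor to another\<close>

lemma sum_less_4: "(\<Sum>t<4. f t) = f 0 + f (1::nat) + f 2 + f 3"
  by (simp add: eval_nat_numeral)

lemma less_4_cases: "(n::nat) < 4 \<Longrightarrow> n = 0 \<or> n = 1 \<or> n = 2 \<or> n = 3" by auto

text \<open>The map \<open>(z, w) \<mapsto> (z\<^sup>c, w)\<close> of the complement of the origin is deformed to
  \<open>(z, w) \<mapsto> (z, w\<^sup>c)\<close> by conjugating it with the scaled rotations \<open>(1 - K) + K J\<close>,
  \<open>0 \<le> K \<le> 1\<close>. This is how an exponent moves from one coordinate to the other.\<close>

definition mixing :: "nat \<Rightarrow> nat \<Rightarrow> (nat \<Rightarrow> real) \<Rightarrow> complex" where
  "mixing i j x = of_real (plateau i x) * of_real (plateau j x)"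

definition mcore :: "nat \<Rightarrow> nat \<Rightarrow> (nat \<Rightarrow> real) \<Rightarrow> complex" where
  "mcore i j x = of_real (core i x) * of_real (core j x)"

text \<open>Where \<open>tsec\<close> has modulus 1, this is the coordinate of the section
  \<open>ssec\<close> with respect to the frame \<open>tsec\<close>.\<close>

definition local_z :: "nat \<Rightarrow> int \<Rightarrow> (nat \<Rightarrow> real) \<Rightarrow> complex" where
  "local_z i e x = ssec i e x * tsec i (- e) x"

text \<open>Let K be \<open>mixing\<close>, let Z and W be the local coordinates
  \<open>local_z\<close>, and put U = (1 - K) Z + K W and V = (1 - K) W - K Z. Where the frames
  \<open>tsec\<close> exist, \<open>rot1\<close> and \<open>rot2\<close> are (1 - K) U^c - K V and K
  U^c + (1 - K) V times a frame each, with U^c read as \<open>pw\<close>. The terms surviving at K =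
  0 are written with \<open>ssec\<close> instead of a frame times a coordinate, so the formulas make
  sense everywhere.\<close>

definition rot1 :: "nat \<Rightarrow> nat \<Rightarrow> int \<Rightarrow> int \<Rightarrow> (nat \<Rightarrow> real) \<Rightarrow> complex" where
  "rot1 i j b c x = (1 - mixing i j x) *
       pw ((1 - mixing i j x) * ssec i 1 x + mixing i j x * (tsec i 1 x * local_z j b x)) c
     - mixing i j x * (tsec i c x * ((1 - mixing i j x) * local_z j b x - mixing i j x * local_z i 1 x))"

definition rot2 :: "nat \<Rightarrow> nat \<Rightarrow> int \<Rightarrow> int \<Rightarrow> (nat \<Rightarrow> real) \<Rightarrow> complex" where
  "rot2 i j b c x =
     mixing i j x * (tsec j b x * pw ((1 - mixing i j x) * local_z i 1 x + mixing i j x * local_z j b x) c)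
     + (1 - mixing i j x) * ((1 - mixing i j x) * ssec j b x - mixing i j x * (tsec j b x * local_z i 1 x))"

lemma qper_mixing: "qper 0 (mixing i j)" and qper_mcore: "qper 0 (mcore i j)"
  unfolding mixing_def mcore_def
  by (rule qper_weight[OF qper_mult[OF qper_plateau qper_plateau]], simp)
     (rule qper_weight[OF qper_mult[OF qper_core qper_core]], simp)

lemma qper_mult_0: "qper 0 f \<Longrightarrow> qper w g \<Longrightarrow> qper w (\<lambda>x. f x * g x)"
  and qper_mult_0': "qper w f \<Longrightarrow> qper 0 g \<Longrightarrow> qper w (\<lambda>x. f x * g x)"
  using qper_mult[of 0 f w g] qper_mult[of w f 0 g] by simp_all

lemma qper_local_z: "qper 0 (local_z i e)"
  unfolding local_z_def
  by (rule qper_weight[OF qper_mult[OF qper_ssec qper_tsec]]) (auto simp: wt_def)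

lemma qper_pw_wt:
  assumes "qper (wt i e) f"
  shows "qper (wt i (c * e)) (\<lambda>x. pw (f x) c)"
  by (rule qper_weight[OF qper_pw[OF assms]]) (auto simp: wt_def)

lemma qper_rot1: "qper (wt i c) (rot1 i j b c)"
proof -
  have "qper (wt i 1) (\<lambda>x. (1 - mixing i j x) * ssec i 1 x + mixing i j x * (tsec i 1 x * local_z j b x))"
    by (intro qper_add qper_mult_0[OF qper_diff[OF qper_const qper_mixing]] qper_mult_0[OF qper_mixing]
        qper_mult_0'[OF _ qper_local_z] qper_ssec qper_tsec)
  from qper_pw_wt[OF this, of c]
  have "qper (wt i c) (\<lambda>x. pw ((1 - mixing i j x) * ssec i 1 x + mixing i j x * (tsec i 1 x * local_z j b x)) c)"
    by simp
  then show ?thesis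
    unfolding rot1_def
    by (intro qper_diff qper_mult_0[OF qper_diff[OF qper_const qper_mixing]] qper_mult_0[OF qper_mixing]
        qper_mult_0'[OF qper_tsec] qper_local_z)
qed

lemma qper_rot2: "qper (wt j b) (rot2 i j b c)"
proof -
  have "qper 0 (\<lambda>x. (1 - mixing i j x) * local_z i 1 x + mixing i j x * local_z j b x)"
    by (intro qper_add qper_mult_0[OF qper_diff[OF qper_const qper_mixing]] qper_mult_0[OF qper_mixing]
        qper_local_z)
  from qper_weight[OF qper_pw[OF this, of c], of 0]
  have "qper 0 (\<lambda>x. pw ((1 - mixing i j x) * local_z i 1 x + mixing i j x * local_z j b x) c)"
    by (simp add: zero_fun_def)
  then show ?thesis
    unfolding rot2_def
    by (intro qper_add qper_diff qper_mult_0[OF qper_diff[OF qper_const qper_mixing]] qper_mult_0[OF qper_mixing]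
        qper_mult_0'[OF qper_tsec] qper_local_z qper_ssec)
qed

lemma mcore_ne_0:
  assumes "ssec i 1 x = 0" "ssec j b x = 0"
  shows "mcore i j x \<noteq> 0"
  using ssec_0_core[OF assms(1)] ssec_0_core[OF assms(2)] by (simp add: mcore_def)

lemma tsec_mult:
  assumes "plateau i x \<noteq> 0"
  shows "tsec i e x * tsec i e' x = tsec i (e + e') x"
  by (simp add: plateau_tsec[OF assms] cis_mult algebra_simps)

lemma tsec_0:
  assumes "plateau i x \<noteq> 0"
  shows "tsec i 0 x = 1"
  by (simp add: plateau_tsec[OF assms])

lemma pw_tsec:
  assumes "plateau i x \<noteq> 0"
  shows "pw (tsec i e x) c = tsec i (c * e) x"
  by (simp add: plateau_tsec[OF assms] pw_cis mult.assoc)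

lemma tsec_ne_0:
  assumes "plateau i x \<noteq> 0"
  shows "tsec i e x \<noteq> 0"
  by (simp add: plateau_tsec[OF assms])

lemma ssec_local_z:
  assumes "plateau i x \<noteq> 0"
  shows "ssec i e x = tsec i e x * local_z i e x"
  using tsec_mult[OF assms, of e "- e"] tsec_0[OF assms]
  by (simp add: local_z_def mult.left_commute)

text \<open>On the core K = 1, so that U = W and V = - Z: up to frames the pair has become Z and
  W^c, with the exponent on the second coordinate.\<close>

lemma rot_core:
  assumes "mcore i j x \<noteq> 0"
  shows "rot1 i j b c x = tsec i (c - 1) x * ssec i 1 x"
    and "rot2 i j b c x = tsec j (b - c * b) x * pw (ssec j b x) c"
proof -
  have p: "plateau i x = 1" "plateau j x = 1"
    using assms core_plateau[of i x] core_plateau[of j x] by (auto simp: mcore_def)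
  then have pn: "plateau i x \<noteq> 0" "plateau j x \<noteq> 0" by auto
  show "rot1 i j b c x = tsec i (c - 1) x * ssec i 1 x"
    using tsec_mult[OF pn(1), of c "- 1"] by (simp add: rot1_def mixing_def p local_z_def mult_ac)
  show "rot2 i j b c x = tsec j (b - c * b) x * pw (ssec j b x) c"
    using tsec_mult[OF pn(2), of b "- (c * b)"]
    by (simp add: rot2_def mixing_def p local_z_def pw_mult pw_tsec[OF pn(2)] mult_ac)
qed

text \<open>The coefficients form a scaled rotation of determinant (1 - K)^2 + K^2, which is
  positive because K is real.\<close>

lemma linear_system_trivial:
  fixes P V :: complex and K :: real
  assumes "(1 - of_real K) * P = of_real K * V" "of_real K * P = - ((1 - of_real K) * V)"
  shows "P = 0" "V = 0"
proof -
  have "(1 - K)\<^sup>2 + K\<^sup>2 \<noteq> 0"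
    by (auto simp: sum_power2_eq_zero_iff)
  moreover have "(1 - complex_of_real K)\<^sup>2 + (of_real K)\<^sup>2 = of_real ((1 - K)\<^sup>2 + K\<^sup>2)"
    by simp
  ultimately have nz: "(1 - complex_of_real K)\<^sup>2 + (of_real K)\<^sup>2 \<noteq> 0"
    by (metis of_real_eq_0_iff)
  have "(a\<^sup>2 + k\<^sup>2) * P = 0 \<and> (a\<^sup>2 + k\<^sup>2) * V = 0"
    if "a * P = k * V" "k * P = - (a * V)" for a k :: complex
  proof -
    have "(a\<^sup>2 + k\<^sup>2) * P = a * (a * P) + k * (k * P)" by (simp add: power2_eq_square algebra_simps)
    also have "\<dots> = 0" unfolding that by (simp add: algebra_simps)
    finally have P: "(a\<^sup>2 + k\<^sup>2) * P = 0" .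
    have "(a\<^sup>2 + k\<^sup>2) * V = k * (k * V) - a * (- (a * V))" by (simp add: power2_eq_square algebra_simps)
    also have "\<dots> = 0" unfolding that[symmetric] by (simp add: algebra_simps)
    finally show ?thesis using P by blast
  qed
  from this[OF assms] have "((1 - of_real K)\<^sup>2 + (of_real K)\<^sup>2) * P = 0" "((1 - of_real K)\<^sup>2 + (of_real K)\<^sup>2) * V = 0"
    by auto
  then show "P = 0" "V = 0" using nz by (blast dest: mult_eq_0_iff[THEN iffD1])+
qed

text \<open>If K is not 0, invertibility of the outer scaled rotation yields U^c = V = 0, hence U =
  0, and invertibility of the inner one yields Z = W = 0. If K = 0 the pair already consists of a
  power of the first \<open>ssec\<close> and of the second. Either way both \<open>ssec\<close>
  vanish, which happens only inside the core.\<close>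

lemma rot_nonzero:
  assumes "rot1 i j b c x = 0" "rot2 i j b c x = 0"
  shows "mcore i j x \<noteq> 0"
proof (cases "mixing i j x = 0")
  case True
  then have "pw (ssec i 1 x) c = 0" "ssec j b x = 0"
    using assms by (simp_all add: rot1_def rot2_def)
  then show ?thesis by (intro mcore_ne_0) (simp_all add: pw_eq_0_iff)
next
  case False
  then have p: "plateau i x \<noteq> 0" "plateau j x \<noteq> 0" by (auto simp: mixing_def)
  define K where "K = plateau i x * plateau j x"
  have K: "mixing i j x = of_real K" by (simp add: mixing_def K_def)
  define Z W where "Z = local_z i 1 x" and "W = local_z j b x"
  define U V where "U = (1 - of_real K) * Z + of_real K * W" and "V = (1 - of_real K) * W - of_real K * Z"
  have "(1 - of_real K) * ssec i 1 x + of_real K * (tsec i 1 x * W) = tsec i 1 x * U"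
    by (simp add: U_def ssec_local_z[OF p(1)] Z_def algebra_simps)
  then have "rot1 i j b c x = tsec i c x * ((1 - of_real K) * pw U c - of_real K * V)"
    by (simp add: rot1_def K V_def Z_def W_def pw_mult pw_tsec[OF p(1)] algebra_simps)
  then have e1: "(1 - of_real K) * pw U c - of_real K * V = 0"
    using assms(1) tsec_ne_0[OF p(1), of c] by simp
  have "rot2 i j b c x = tsec j b x * (of_real K * pw U c + (1 - of_real K) * V)"
    by (simp add: rot2_def K V_def U_def Z_def W_def ssec_local_z[OF p(2)] algebra_simps)
  then have e2: "of_real K * pw U c + (1 - of_real K) * V = 0"
    using assms(2) tsec_ne_0[OF p(2), of b] by simp
  note PV = linear_system_trivial[OF eq_iff_diff_eq_0[THEN iffD2, OF e1] eq_neg_iff_add_eq_0[THEN iffD2, OF e2]]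
  have "U = 0" using PV(1) by (simp add: pw_eq_0_iff)
  then have f1: "(1 - of_real K) * Z = of_real K * (- W)"
    unfolding U_def by (simp add: add_eq_0_iff2)
  have f2: "of_real K * Z = - ((1 - of_real K) * (- W))"
    using PV(2) unfolding V_def by simp
  from linear_system_trivial[OF f1 f2] have "Z = 0" "W = 0" by auto
  then show ?thesis
    by (intro mcore_ne_0[of i x j b]) (simp_all add: Z_def W_def ssec_local_z[OF p(1)] ssec_local_z[OF p(2)])
qed

text \<open>Each of the pairs (\<open>rot1\<close>, \<open>rot2\<close>) and (\<open>ssec\<close>,
  power of \<open>ssec\<close>) gives a quaternionic 2 by 2 block that degenerates only at the
  common zeros of the pair, thus only where \<open>mcore\<close> is nonzero. There the two pairs
  agree up to frames, so off-diagonal entries made of \<open>mcore\<close> and these frames restore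
  invertibility while the rows stay orthogonal. The exponent c sits on the factor i in the first
  pair and on the factor j in the second.\<close>

lemma gauge_mult:
  assumes ij: "i \<noteq> j"
  shows "gauge [k(i := c, j := 0), k(i := 0, j := b), k(i := 0, j := 0), k(i := 1, j := c * b)]
               [k(i := 0, j := 0), k(i := c, j := b), k(i := 1, j := 0), k(i := 0, j := c * b)]"
    (is "gauge ?ks ?ls")
proof (rule gauge_orthogonal[where r = 4])
  let ?h1 = "rot1 i j b c" and ?h2 = "rot2 i j b c" and ?g1 = "ssec i 1" and ?g2 = "\<lambda>x. pw (ssec j b x) c"
  let ?S = "mcore i j"
  let ?F = "\<lambda>s t x. [[?h1 x, - cnj (?h2 x), - (?S x * tsec i (c - 1) x), 0],
     [?h2 x, cnj (?h1 x), 0, - (?S x * tsec j (b - c * b) x)],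
     [?S x, 0, cnj (?g1 x), cnj (?g2 x)],
     [0, ?S x * (tsec i (1 - c) x * tsec j (c * b - b) x), - ?g2 x, ?g1 x]] ! s ! t"
  have w: "k(i := a, j := a') - k(i := d, j := d') = wt i (a - d) + wt j (a' - d')" for a a' d d'
    using ij by (auto simp: wt_def)
  have w0: "wt l 0 = 0" for l by (auto simp: wt_def)
  have wm: "- wt l a = wt l (- a)" for l a by (auto simp: wt_def)
  note q = qper_0 qper_rot1 qper_rot2 qper_ssec qper_pw_wt[OF qper_ssec] qper_mcore
    qper_uminus[OF qper_cnj[OF qper_rot2, unfolded wm]] qper_cnj[OF qper_rot1, unfolded wm]
    qper_cnj[OF qper_ssec, unfolded wm] qper_cnj[OF qper_pw_wt[OF qper_ssec], unfolded wm]
    qper_uminus[OF qper_mult_0[OF qper_mcore qper_tsec]] qper_uminus[OF qper_pw_wt[OF qper_ssec]]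
    qper_mult_0[OF qper_mcore qper_mult[OF qper_tsec qper_tsec]]
  show "qper (?ks ! s - ?ls ! t) (?F s t)" if "s < 4" "t < 4" for s t
    using less_4_cases[OF that(1)] less_4_cases[OF that(2)]
    by (elim disjE) (simp_all add: w w0 q)
  show "(\<Sum>t<4. ?F s t x * cnj (?F u t x)) = 0" if "s < u" "u < 4" for s u x
  proof -
    have S: "cnj (?S x) = ?S x" by (simp add: mcore_def)
    have "(s, u) \<in> {(0,1),(0,2),(0,3),(1,2),(1,3),(2,3)}" using that by auto
    moreover have "(\<Sum>t<4. ?F s t x * cnj (?F u t x)) = 0" if "(s, u) \<in> {(0,1),(0,2),(0,3),(1,2),(1,3),(2,3)}"
    proof (cases "?S x = 0")
      \<comment> \<open>Off the core the matrix is block diagonal; on the core,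
        \<open>rot_core\<close> makes the products of rows from different blocks cancel.\<close>
      case True
      with that show ?thesis by (auto simp: sum_less_4)
    next
      case False
      then have "plateau i x = 1" "plateau j x = 1"
        using core_plateau[of i x] core_plateau[of j x] by (auto simp: mcore_def)
      then have p: "plateau i x \<noteq> 0" "plateau j x \<noteq> 0" by auto
      have t: "tsec i (1 - c) x * tsec i (c - 1) x = 1" "tsec j (b - c * b) x * tsec j (c * b - b) x = 1"
        using tsec_mult[OF p(1)] tsec_mult[OF p(2)] tsec_0[OF p(1)] tsec_0[OF p(2)] by simp_all
      show ?thesis
        using that t
        by (auto simp: sum_less_4 rot_core[OF False] S cnj_tsec algebra_simps)
    qed
    ultimately show ?thesis by blast
  qed
  show "\<exists>t<4. ?F s t x \<noteq> 0" if "s < 4" for s x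
  proof -
    have nz: "?h1 x \<noteq> 0 \<or> ?h2 x \<noteq> 0 \<or> ?S x \<noteq> 0" "?g1 x \<noteq> 0 \<or> ?g2 x \<noteq> 0 \<or> ?S x \<noteq> 0"
      using rot_nonzero[of i j b c x] mcore_ne_0[of i x j b] by (auto simp: pw_eq_0_iff)
    have t: "tsec i e x \<noteq> 0" "tsec j e x \<noteq> 0" if "?S x \<noteq> 0" for e
      using that core_plateau[of i x] core_plateau[of j x] tsec_ne_0[of i x e] tsec_ne_0[of j x e]
      by (auto simp: mcore_def)
    have "(\<exists>t\<in>{0,1,2,3}. ?F s t x \<noteq> 0)"
      using less_4_cases[OF that] nz t(1)[of "c - 1"] t(1)[of "1 - c"] t(2)[of "b - c * b"] t(2)[of "c * b - b"]
      by (elim disjE) simp_all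
    then obtain t where "t \<in> {0,1,2,3}" "?F s t x \<noteq> 0" by (rule bexE)
    then show ?thesis by (intro exI[of _ t] conjI) auto
  qed
qed auto

subsection \<open>Stable classes\<close>

type_synonym fam = "nat \<Rightarrow> nat \<Rightarrow> int"

text \<open>Degrees are families indexed by the prime \<open>p\<close>, so that all ranks below are bounded
  uniformly in \<open>p\<close>.\<close>

definition gaugem :: "fam multiset \<Rightarrow> fam multiset \<Rightarrow> bool" where
  "gaugem X Y \<longleftrightarrow> (\<forall>p. \<exists>ks ls. mset ks = image_mset (\<lambda>v i. v i p) X \<and>
     mset ls = image_mset (\<lambda>v i. v i p) Y \<and> gauge ks ls)"

text \<open>By \<open>gauge_perm\<close> the chosen enumerations of the multisets do not
  matter.\<close>

lemma gaugem_iff: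
  "gaugem X Y \<longleftrightarrow> (\<forall>p ks ls. mset ks = image_mset (\<lambda>v i. v i p) X \<longrightarrow>
     mset ls = image_mset (\<lambda>v i. v i p) Y \<longrightarrow> gauge ks ls)"
proof
  assume *: "gaugem X Y"
  show "\<forall>p ks ls. mset ks = image_mset (\<lambda>v i. v i p) X \<longrightarrow>
     mset ls = image_mset (\<lambda>v i. v i p) Y \<longrightarrow> gauge ks ls"
  proof (intro allI impI)
    fix p ks ls assume kl: "mset ks = image_mset (\<lambda>v i. v i p) X" "mset ls = image_mset (\<lambda>v i. v i p) Y"
    obtain ks' ls' where "mset ks' = image_mset (\<lambda>v i. v i p) X" "mset ls' = image_mset (\<lambda>v i. v i p) Y"
      "gauge ks' ls'"
      using * unfolding gaugem_def by blast
    then show "gauge ks ls"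
      using kl gauge_perm[of ks ks'] gauge_perm[of ls' ls] gauge_trans by (metis (no_types, lifting))
  qed
next
  assume "\<forall>p ks ls. mset ks = image_mset (\<lambda>v i. v i p) X \<longrightarrow>
     mset ls = image_mset (\<lambda>v i. v i p) Y \<longrightarrow> gauge ks ls"
  then show "gaugem X Y" unfolding gaugem_def by (metis ex_mset)
qed

lemma gaugem_refl: "gaugem X X"
  unfolding gaugem_def by (metis ex_mset gauge_refl)

lemma gaugem_sym: "gaugem X Y \<Longrightarrow> gaugem Y X"
  unfolding gaugem_def by (meson gauge_sym)

lemma gaugem_trans:
  assumes "gaugem X Y" "gaugem Y Z"
  shows "gaugem X Z"
  unfolding gaugem_iff
proof (intro allI impI)
  fix p ks ls assume kl: "mset ks = image_mset (\<lambda>v i. v i p) X" "mset ls = image_mset (\<lambda>v i. v i p) Z"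
  obtain ms where ms: "mset ms = image_mset (\<lambda>v i. v i p) Y" by (metis ex_mset)
  show "gauge ks ls"
    using assms kl ms unfolding gaugem_iff by (blast intro: gauge_trans)
qed

lemma gaugem_plus:
  assumes "gaugem X Y" "gaugem X' Y'"
  shows "gaugem (X + X') (Y + Y')"
  unfolding gaugem_def
proof
  fix p
  obtain ks ls where 1: "mset ks = image_mset (\<lambda>v i. v i p) X" "mset ls = image_mset (\<lambda>v i. v i p) Y" "gauge ks ls"
    using assms(1) unfolding gaugem_def by blast
  obtain ks' ls' where 2: "mset ks' = image_mset (\<lambda>v i. v i p) X'" "mset ls' = image_mset (\<lambda>v i. v i p) Y'" "gauge ks' ls'"
    using assms(2) unfolding gaugem_def by blast
  show "\<exists>ks ls. mset ks = image_mset (\<lambda>v i. v i p) (X + X') \<and>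
     mset ls = image_mset (\<lambda>v i. v i p) (Y + Y') \<and> gauge ks ls"
    using 1 2 by (intro exI[of _ "ks @ ks'"] exI[of _ "ls @ ls'"]) (simp add: gauge_append)
qed

lemma fun_upd_at: "(\<lambda>l. (v(i := a)) l p) = (\<lambda>l. v l p)(i := a p)" for v :: fam
  by auto

lemma gaugem_add: "gaugem {#v(i := a), v(i := b)#} {#v(i := a + b), v(i := 0)#}"
  unfolding gaugem_def
proof
  fix p
  let ?k = "\<lambda>l. v l p"
  show "\<exists>ks ls. mset ks = image_mset (\<lambda>v i. v i p) {#v(i := a), v(i := b)#} \<and>
     mset ls = image_mset (\<lambda>v i. v i p) {#v(i := a + b), v(i := 0)#} \<and> gauge ks ls"
    by (rule exI[of _ "[?k(i := a p), ?k(i := b p)]"], rule exI[of _ "[?k(i := a p + b p), ?k(i := 0)]"])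
       (simp add: fun_upd_at gauge_add del: fun_upd_apply)
qed

lemma gaugem_mult:
  assumes "i \<noteq> j"
  shows "gaugem {#v(i := c, j := 0), v(i := 0, j := b), v(i := 0, j := 0), v(i := 1, j := c * b)#}
                {#v(i := 0, j := 0), v(i := c, j := b), v(i := 1, j := 0), v(i := 0, j := c * b)#}"
  unfolding gaugem_def
proof
  fix p
  let ?k = "\<lambda>l. v l p"
  let ?u = "\<lambda>a b. ?k(i := a, j := b)"
  show "\<exists>ks ls. mset ks = image_mset (\<lambda>v i. v i p) {#v(i := c, j := 0), v(i := 0, j := b), v(i := 0, j := 0), v(i := 1, j := c * b)#} \<and>
     mset ls = image_mset (\<lambda>v i. v i p) {#v(i := 0, j := 0), v(i := c, j := b), v(i := 1, j := 0), v(i := 0, j := c * b)#} \<and> gauge ks ls"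
    by (rule exI[of _ "[?u (c p) 0, ?u 0 (b p), ?u 0 0, ?u 1 (c p * b p)]"],
        rule exI[of _ "[?u 0 0, ?u (c p) (b p), ?u 1 0, ?u 0 (c p * b p)]"])
       (simp add: fun_upd_at gauge_mult[OF assms] del: fun_upd_apply)
qed

text \<open>The Grothendieck relation on formal differences. The stabilizing multiset
  \<open>Z\<close> consists of families and is thus chosen before p, which keeps its size
  independent of p.\<close>

definition stable_eq :: "fam multiset \<times> fam multiset \<Rightarrow> fam multiset \<times> fam multiset \<Rightarrow> bool" where
  "stable_eq A B \<longleftrightarrow> (\<exists>Z. gaugem (fst A + snd B + Z) (fst B + snd A + Z))"

lemma equivp_stable_eq: "equivp stable_eq"
proof (rule equivpI)
  show "reflp stable_eq"
    by (auto simp: reflp_def stable_eq_def intro: gaugem_refl)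
  show "symp stable_eq"
    by (auto simp: symp_def stable_eq_def intro: gaugem_sym)
  show "transp stable_eq"
    unfolding transp_def stable_eq_def
  proof (intro allI impI, elim exE)
    fix A B C :: "fam multiset \<times> fam multiset" and Z Z'
    assume "gaugem (fst A + snd B + Z) (fst B + snd A + Z)" "gaugem (fst B + snd C + Z') (fst C + snd B + Z')"
    from gaugem_plus[OF this]
    show "\<exists>Z. gaugem (fst A + snd C + Z) (fst C + snd A + Z)"
      by (intro exI[of _ "fst B + snd B + Z + Z'"]) (simp add: ac_simps)
  qed
qed

quotient_type kclass = "fam multiset \<times> fam multiset" / stable_eq
  by (rule equivp_stable_eq)

instantiation kclass :: ab_group_add
begin

lift_definition zero_kclass :: kclass is "({#}, {#})" .

lift_definition uminus_kclass :: "kclass \<Rightarrow> kclass" is "\<lambda>A. (snd A, fst A)"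
  by (auto simp: stable_eq_def ac_simps intro: gaugem_sym)

lift_definition plus_kclass :: "kclass \<Rightarrow> kclass \<Rightarrow> kclass" is "\<lambda>A B. (fst A + fst B, snd A + snd B)"
proof -
  fix A A' B B' :: "fam multiset \<times> fam multiset"
  assume "stable_eq A A'" "stable_eq B B'"
  then obtain Z Z' where "gaugem (fst A + snd A' + Z) (fst A' + snd A + Z)"
    "gaugem (fst B + snd B' + Z') (fst B' + snd B + Z')"
    unfolding stable_eq_def by blast
  from gaugem_plus[OF this]
  show "stable_eq (fst A + fst B, snd A + snd B) (fst A' + fst B', snd A' + snd B')"
    unfolding stable_eq_def by (intro exI[of _ "Z + Z'"]) (simp add: ac_simps)
qed

definition minus_kclass :: "kclass \<Rightarrow> kclass \<Rightarrow> kclass" where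
  "minus_kclass a b = a + - b"

instance
proof
  fix a b c :: kclass
  show "a + b + c = a + (b + c)"
    by transfer (auto simp: stable_eq_def ac_simps intro: gaugem_refl)
  show "a + b = b + a"
    by transfer (auto simp: stable_eq_def ac_simps intro: gaugem_refl)
  show "0 + a = a"
    by transfer (auto simp: stable_eq_def ac_simps intro: gaugem_refl)
  show "- a + a = 0"
    by transfer (auto simp: stable_eq_def ac_simps intro: gaugem_refl)
  show "a - b = a + - b"
    by (rule minus_kclass_def)
qed

end

lift_definition kcls :: "fam multiset \<Rightarrow> kclass" is "\<lambda>X. (X, {#})" .

lemma kcls_plus: "kcls (X + Y) = kcls X + kcls Y"
  by transfer (auto simp: stable_eq_def intro: gaugem_refl)

lemma kcls_empty: "kcls {#} = 0"
  by transfer (auto simp: stable_eq_def intro: gaugem_refl)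

lemma kcls_eqI: "gaugem X Y \<Longrightarrow> kcls X = kcls Y"
  by transfer (auto simp: stable_eq_def intro!: exI[of _ "{#}"])

lemma kcls_eqD: "kcls X = kcls Y \<Longrightarrow> \<exists>Z. gaugem (X + Z) (Y + Z)"
  by transfer (auto simp: stable_eq_def)

lemma kcls_sum: "kcls X = (\<Sum>v\<in>#X. kcls {#v#})"
proof (induction X)
  case (add v X)
  then show ?case using kcls_plus[of "{#v#}" X] by simp
qed (simp add: kcls_empty)

subsection \<open>Multi-affine functions\<close>

text \<open>The isomorphisms \<open>gauge_add\<close> and \<open>gauge_mult\<close> turned into
  identities for a function of the degrees: it is affine in each degree, and its second difference
  in two degrees depends on their product alone. The ring is arbitrary because families of integers
  indexed by p form a ring as well.\<close>

definition multi_affine :: "nat set \<Rightarrow> ((nat \<Rightarrow> 'r::comm_ring_1) \<Rightarrow> 'g::ab_group_add) \<Rightarrow> bool" where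
  "multi_affine S f \<longleftrightarrow>
     (\<forall>i\<in>S. \<forall>k a b. f (k(i := a)) + f (k(i := b)) = f (k(i := a + b)) + f (k(i := 0))) \<and>
     (\<forall>i\<in>S. \<forall>j\<in>S. i \<noteq> j \<longrightarrow> (\<forall>k b c.
        f (k(i := c, j := 0)) + f (k(i := 0, j := b)) + f (k(i := 0, j := 0)) + f (k(i := 1, j := c * b)) =
        f (k(i := 0, j := 0)) + f (k(i := c, j := b)) + f (k(i := 1, j := 0)) + f (k(i := 0, j := c * b))))"

text \<open>For line bundles these sums of products are the components of the Chern character, which
  for degrees v is the product of the 1 + v l \<omega> l, with \<omega> l the generating class of
  degree 2 of the l-th factor.\<close>

definition same_products :: "nat set \<Rightarrow> (nat \<Rightarrow> 'r::comm_ring_1) multiset \<Rightarrow> (nat \<Rightarrow> 'r) multiset \<Rightarrow> bool" where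
  "same_products S X Y \<longleftrightarrow> size X = size Y \<and> (\<forall>v\<in>#X + Y. \<forall>l. l \<notin> S \<longrightarrow> v l = 0) \<and>
     (\<forall>I\<subseteq>S. (\<Sum>v\<in>#X. \<Prod>l\<in>I. v l) = (\<Sum>v\<in>#Y. \<Prod>l\<in>I. v l))"

lemma multi_affine_subset: "multi_affine S f \<Longrightarrow> T \<subseteq> S \<Longrightarrow> multi_affine T f"
  unfolding multi_affine_def by (meson subsetD)

text \<open>The difference between the values 1 and 0 at i is what is left on the remaining
  coordinates once the exponent has been moved away from i.\<close>

lemma multi_affine_diff:
  assumes f: "multi_affine S f" and i: "i \<notin> T" "T \<subseteq> S"
  shows "multi_affine T (\<lambda>v. f (v(i := 1)) - f (v(i := 0)))"
  unfolding multi_affine_def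
proof (intro conjI ballI allI impI)
  fix l k a b assume l: "l \<in> T"
  then have li: "l \<noteq> i" "l \<in> S" using i by auto
  define u where "u e x = f (k(i := e, l := x))" for e x
  have tw: "f (k(l := x, i := e)) = u e x" for e x
    unfolding u_def by (simp only: fun_upd_twist[OF li(1)])
  have *: "u e a + u e b = u e (a + b) + u e 0" for e
    using f li(2) unfolding multi_affine_def u_def by blast
  have "(u 1 a + u 1 b) - (u 0 a + u 0 b) = (u 1 (a + b) + u 1 0) - (u 0 (a + b) + u 0 0)"
    by (simp only: *)
  then show "(f (k(l := a, i := 1)) - f (k(l := a, i := 0))) + (f (k(l := b, i := 1)) - f (k(l := b, i := 0)))
    = (f (k(l := a + b, i := 1)) - f (k(l := a + b, i := 0))) + (f (k(l := 0, i := 1)) - f (k(l := 0, i := 0)))"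
    unfolding tw by (simp only: add_diff_add)
next
  fix l m k b c assume lm: "l \<in> T" "m \<in> T" "l \<noteq> m"
  then have li: "l \<noteq> i" "m \<noteq> i" "l \<in> S" "m \<in> S" using i by auto
  define u where "u e x y = f (k(i := e, l := x, m := y))" for e x y
  have tw: "f (k(l := x, m := y, i := e)) = u e x y" for e x y
    unfolding u_def by (rule arg_cong[of _ _ f]) (use li lm in \<open>auto simp: fun_eq_iff\<close>)
  have *: "u e c 0 + u e 0 b + u e 0 0 + u e 1 (c * b) = u e 0 0 + u e c b + u e 1 0 + u e 0 (c * b)" for e
    using f li(3,4) lm(3) unfolding multi_affine_def u_def by blast
  have "(u 1 c 0 + u 1 0 b + u 1 0 0 + u 1 1 (c * b)) - (u 0 c 0 + u 0 0 b + u 0 0 0 + u 0 1 (c * b))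
     = (u 1 0 0 + u 1 c b + u 1 1 0 + u 1 0 (c * b)) - (u 0 0 0 + u 0 c b + u 0 1 0 + u 0 0 (c * b))"
    by (simp only: *)
  then show "(f (k(l := c, m := 0, i := 1)) - f (k(l := c, m := 0, i := 0))) +
      (f (k(l := 0, m := b, i := 1)) - f (k(l := 0, m := b, i := 0))) +
      (f (k(l := 0, m := 0, i := 1)) - f (k(l := 0, m := 0, i := 0))) +
      (f (k(l := 1, m := c * b, i := 1)) - f (k(l := 1, m := c * b, i := 0))) =
      (f (k(l := 0, m := 0, i := 1)) - f (k(l := 0, m := 0, i := 0))) +
      (f (k(l := c, m := b, i := 1)) - f (k(l := c, m := b, i := 0))) +
      (f (k(l := 1, m := 0, i := 1)) - f (k(l := 1, m := 0, i := 0))) +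
      (f (k(l := 0, m := c * b, i := 1)) - f (k(l := 0, m := c * b, i := 0)))"
    unfolding tw by (simp only: add_diff_add)
qed

lemma same_products_image:
  assumes "same_products S X Y" "T \<subseteq> S"
    and "\<And>v l. v \<in># X + Y \<Longrightarrow> l \<notin> T \<Longrightarrow> h v l = 0"
    and "\<And>I. I \<subseteq> T \<Longrightarrow> \<exists>J\<subseteq>S. \<forall>v. (\<Prod>l\<in>I. h v l) = (\<Prod>l\<in>J. v l)"
  shows "same_products T (image_mset h X) (image_mset h Y)"
  unfolding same_products_def
proof (intro conjI allI impI)
  show "size (image_mset h X) = size (image_mset h Y)"
    using assms(1) by (simp add: same_products_def)
  show "\<forall>v\<in>#image_mset h X + image_mset h Y. \<forall>l. l \<notin> T \<longrightarrow> v l = 0"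
    using assms(3) by auto
  fix I assume "I \<subseteq> T"
  from assms(4)[OF this] obtain J where "J \<subseteq> S" "\<And>v. (\<Prod>l\<in>I. h v l) = (\<Prod>l\<in>J. v l)" by blast
  with assms(1) show "(\<Sum>v\<in>#image_mset h X. \<Prod>l\<in>I. v l) = (\<Sum>v\<in>#image_mset h Y. \<Prod>l\<in>I. v l)"
    by (simp add: same_products_def image_mset.compositionality o_def)
qed

lemma same_products_zero:
  fixes X Y :: "(nat \<Rightarrow> 'r::comm_ring_1) multiset"
  assumes "same_products S X Y"
  shows "same_products (S - {m}) (image_mset (\<lambda>v. v(m := 0)) X) (image_mset (\<lambda>v. v(m := 0)) Y)"
proof (rule same_products_image[OF assms])
  show "(v(m := 0)) l = 0" if "v \<in># X + Y" "l \<notin> S - {m}" for v l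
    using assms that unfolding same_products_def by auto
  fix I assume "I \<subseteq> S - {m}"
  then have eq: "(\<Prod>l\<in>I. (v(m := 0)) l) = (\<Prod>l\<in>I. v l)" and "I \<subseteq> S" for v :: "nat \<Rightarrow> 'r"
    by (auto intro!: prod.cong)
  show "\<exists>J\<subseteq>S. \<forall>v :: nat \<Rightarrow> 'r. (\<Prod>l\<in>I. (v(m := 0)) l) = (\<Prod>l\<in>J. v l)"
  proof (intro exI[of _ I] conjI allI)
    show "I \<subseteq> S" by fact
    show "(\<Prod>l\<in>I. (v(m := 0)) l) = (\<Prod>l\<in>I. v l)" for v :: "nat \<Rightarrow> 'r"
      by (rule eq)
  qed
qed auto

lemma solve_second_difference:
  fixes a :: "'a::ab_group_add"
  assumes "p + q + z + r = z + a + s + t"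
  shows "a = p + q - z + (r - t) - (s - z)"
proof -
  have "a = (z + a + s + t) - z - s - t" by simp
  also have "\<dots> = (p + q + z + r) - z - s - t" by (simp only: assms)
  also have "\<dots> = p + q - z + (r - t) - (s - z)" by (simp add: algebra_simps)
  finally show ?thesis .
qed

lemma sum_mset_const_cong: "size X = size Y \<Longrightarrow> (\<Sum>x\<in>#X. c) = (\<Sum>y\<in>#Y. c :: 'a::comm_monoid_add)"
  by (simp add: image_mset_const_eq)

text \<open>Induction on the set of active coordinates. If there are two, i and j, the product rule
  expresses f v by terms in which i or j is set to 0 and by the difference f' with v i * v j placed
  at j. All these terms live on fewer coordinates, and the data they require are again sums of
  products of the entries of v.\<close>

lemma multi_affine_sum_eq:
  fixes f :: "(nat \<Rightarrow> 'r::comm_ring_1) \<Rightarrow> 'g::ab_group_add"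
  assumes "finite S" "multi_affine S f" "same_products S X Y"
  shows "(\<Sum>v\<in>#X. f v) = (\<Sum>v\<in>#Y. f v)"
  using assms
proof (induction S arbitrary: f X Y rule: finite_psubset_induct)
  case (psubset S)
  have sz: "size X = size Y" and supp: "\<And>v l. v \<in># X + Y \<Longrightarrow> l \<notin> S \<Longrightarrow> v l = 0"
    and prods: "\<And>I. I \<subseteq> S \<Longrightarrow> (\<Sum>v\<in>#X. \<Prod>l\<in>I. v l) = (\<Sum>v\<in>#Y. \<Prod>l\<in>I. v l)"
    using psubset.prems(2) unfolding same_products_def by blast+
  consider "S = {}" | i where "S = {i}" | i j where "i \<in> S" "j \<in> S" "i \<noteq> j" by blast
  then show ?case
  proof cases
    case 1
    have "v = (\<lambda>l. 0)" if "v \<in># X + Y" for v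
      using supp[OF that] 1 by auto
    then have "(\<Sum>v\<in>#X. f v) = (\<Sum>v\<in>#X. f (\<lambda>l. 0))" "(\<Sum>v\<in>#Y. f v) = (\<Sum>v\<in>#Y. f (\<lambda>l. 0))"
      by (auto intro!: arg_cong[of _ _ sum_mset] image_mset_cong)
    with sum_mset_const_cong[OF sz] show ?thesis by metis
  next
    case 2
    let ?z = "\<lambda>l. 0 :: 'r"
    have aff: "f (?z(i := a)) + f (?z(i := b)) = f (?z(i := a + b)) + f (?z(i := 0))" for a b
      using psubset.prems(1) 2 unfolding multi_affine_def by blast
    \<comment> \<open>An affine function of one coordinate has sums determined by the number of
      terms and the sum of the arguments; one extra copy of the value at 0 on the left makes the
      empty case fit.\<close>
    have *: "(\<Sum>v\<in>#W. f v) + f (?z(i := 0)) = f (?z(i := \<Sum>v\<in>#W. v i)) + (\<Sum>v\<in>#W. f (?z(i := 0)))"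
      if "\<And>v. v \<in># W \<Longrightarrow> v = ?z(i := v i)" for W
      using that
    proof (induction W)
      case (add v W)
      have v: "f v = f (?z(i := v i))"
        by (rule arg_cong[of _ _ f], rule add.prems) simp
      have IH: "(\<Sum>v\<in>#W. f v) + f (?z(i := 0)) = f (?z(i := \<Sum>v\<in>#W. v i)) + (\<Sum>v\<in>#W. f (?z(i := 0)))"
        by (rule add.IH, rule add.prems) simp
      have "(\<Sum>v\<in>#add_mset v W. f v) + f (?z(i := 0)) = f v + ((\<Sum>v\<in>#W. f v) + f (?z(i := 0)))"
        by (simp add: add.assoc)
      also have "\<dots> = (f (?z(i := v i)) + f (?z(i := \<Sum>v\<in>#W. v i))) + (\<Sum>v\<in>#W. f (?z(i := 0)))"
        unfolding IH v[symmetric] by (simp only: add.assoc)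
      also have "\<dots> = f (?z(i := v i + (\<Sum>v\<in>#W. v i))) + f (?z(i := 0)) + (\<Sum>v\<in>#W. f (?z(i := 0)))"
        by (simp only: aff[of "v i" "\<Sum>v\<in>#W. v i"])
      finally show ?case by (simp only: add.assoc image_mset_add_mset sum_mset.add_mset)
    qed simp
    have z: "v = ?z(i := v i)" if "v \<in># X + Y" for v
      using supp[OF that] 2 by (auto simp: fun_eq_iff)
    have "(\<Sum>v\<in>#X. v i) = (\<Sum>v\<in>#Y. v i)"
      using prods[of "{i}"] 2 by simp
    moreover have "(\<Sum>v\<in>#X. f v) + f (?z(i := 0)) = f (?z(i := \<Sum>v\<in>#X. v i)) + (\<Sum>v\<in>#X. f (?z(i := 0)))"
      by (rule *, rule z) simp
    moreover have "(\<Sum>v\<in>#Y. f v) + f (?z(i := 0)) = f (?z(i := \<Sum>v\<in>#Y. v i)) + (\<Sum>v\<in>#Y. f (?z(i := 0)))"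
      by (rule *, rule z) simp
    ultimately have "(\<Sum>v\<in>#X. f v) + f (?z(i := 0)) = (\<Sum>v\<in>#Y. f v) + f (?z(i := 0))"
      by (simp only: sum_mset_const_cong[OF sz])
    then show ?thesis by (rule add_right_imp_eq)
  next
    case 3
    define f' where "f' v = f (v(i := 1)) - f (v(i := 0))" for v
    have f': "multi_affine T f'" if "i \<notin> T" "T \<subseteq> S" for T
      unfolding f'_def by (rule multi_affine_diff[OF psubset.prems(1) that])
    have split: "f v = f (v(j := 0)) + f (v(i := 0)) - f (v(i := 0, j := 0))
        + f' (v(i := 0, j := v i * v j)) - f' (v(i := 0, j := 0))" for v
    proof -
      define u where "u x y = f (v(i := x, j := y))" for x y
      have mlt: "u (v i) 0 + u 0 (v j) + u 0 0 + u 1 (v i * v j) = u 0 0 + u (v i) (v j) + u 1 0 + u 0 (v i * v j)"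
        using psubset.prems(1) 3 unfolding multi_affine_def u_def by blast
      have upd: "v(i := v i, j := v j) = v" "v(i := v i, j := y) = v(j := y)" "v(i := 0, j := v j) = v(i := 0)"
        "v(i := 0, j := y, i := z) = v(i := z, j := y)" for y z
        using 3(3) by (auto simp: fun_eq_iff)
      from solve_second_difference[OF mlt]
      have "u (v i) (v j) = u (v i) 0 + u 0 (v j) - u 0 0 + (u 1 (v i * v j) - u 0 (v i * v j)) - (u 1 0 - u 0 0)" .
      moreover have "f v = u (v i) (v j)" "f (v(j := 0)) = u (v i) 0" "f (v(i := 0)) = u 0 (v j)"
        "f (v(i := 0, j := 0)) = u 0 0" "f' (v(i := 0, j := v i * v j)) = u 1 (v i * v j) - u 0 (v i * v j)"
        "f' (v(i := 0, j := 0)) = u 1 0 - u 0 0"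
        unfolding u_def f'_def by (simp_all only: upd fun_upd_triv)
      ultimately show ?thesis by (simp only:)
    qed
    have sub: "S - {j} \<subset> S" "S - {i} \<subset> S" "S - {i, j} \<subset> S" using 3 by auto
    have e1: "(\<Sum>v\<in>#X. f (v(j := 0))) = (\<Sum>v\<in>#Y. f (v(j := 0)))"
      using psubset.IH[OF sub(1) multi_affine_subset[OF psubset.prems(1)] same_products_zero[OF psubset.prems(2)]]
      by (simp add: image_mset.compositionality o_def)
    have e2: "(\<Sum>v\<in>#X. f (v(i := 0))) = (\<Sum>v\<in>#Y. f (v(i := 0)))"
      using psubset.IH[OF sub(2) multi_affine_subset[OF psubset.prems(1)] same_products_zero[OF psubset.prems(2)]]
      by (simp add: image_mset.compositionality o_def)
    have s3: "same_products (S - {i, j}) (image_mset (\<lambda>v. v(i := 0, j := 0)) X) (image_mset (\<lambda>v. v(i := 0, j := 0)) Y)"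
    proof -
      have "S - {i} - {j} = S - {i, j}" by auto
      with same_products_zero[OF same_products_zero[OF psubset.prems(2), of i], of j] show ?thesis
        by (simp add: image_mset.compositionality o_def)
    qed
    have e3: "(\<Sum>v\<in>#X. f (v(i := 0, j := 0))) = (\<Sum>v\<in>#Y. f (v(i := 0, j := 0)))"
      using psubset.IH[OF sub(3) multi_affine_subset[OF psubset.prems(1)] s3]
      by (simp add: image_mset.compositionality o_def)
    have e5: "(\<Sum>v\<in>#X. f' (v(i := 0, j := 0))) = (\<Sum>v\<in>#Y. f' (v(i := 0, j := 0)))"
      using psubset.IH[OF sub(3) f' s3] by (simp add: image_mset.compositionality o_def)
    have e4: "(\<Sum>v\<in>#X. f' (v(i := 0, j := v i * v j))) = (\<Sum>v\<in>#Y. f' (v(i := 0, j := v i * v j)))"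
    proof -
      let ?h = "\<lambda>v. v(i := 0, j := v i * v j)"
      have "same_products (S - {i}) (image_mset ?h X) (image_mset ?h Y)"
      proof (rule same_products_image[OF psubset.prems(2)])
        fix I assume I: "I \<subseteq> S - {i}"
        have fin: "finite I" using finite_subset[OF I] psubset.hyps by auto
        \<comment> \<open>A product that contains the place j picks up v i along with v j, so it is
          the product of v over I enlarged by i.\<close>
        have eq: "(\<Prod>l\<in>I. ?h v l) = (\<Prod>l\<in>(if j \<in> I then insert i I else I). v l)" for v :: "nat \<Rightarrow> 'r"
        proof (cases "j \<in> I")
          case True
          have "(\<Prod>l\<in>I. ?h v l) = v i * v j * (\<Prod>l\<in>I - {j}. ?h v l)"
            using prod.remove[OF fin True, of "?h v"] by simp
          also have "(\<Prod>l\<in>I - {j}. ?h v l) = (\<Prod>l\<in>I - {j}. v l)"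
            by (rule prod.cong) (use I in auto)
          also have "v i * v j * (\<Prod>l\<in>I - {j}. v l) = v i * (\<Prod>l\<in>I. v l)"
            using prod.remove[OF fin True, of v] by (simp add: mult.assoc)
          also have "\<dots> = (\<Prod>l\<in>insert i I. v l)"
            using I fin by (subst prod.insert) auto
          finally show ?thesis by (simp only: True if_True)
        next
          case False
          then have "(\<Prod>l\<in>I. ?h v l) = (\<Prod>l\<in>I. v l)"
            by (intro prod.cong) (use I in auto)
          then show ?thesis by (simp only: False if_False)
        qed
        show "\<exists>J\<subseteq>S. \<forall>v :: nat \<Rightarrow> 'r. (\<Prod>l\<in>I. ?h v l) = (\<Prod>l\<in>J. v l)"
        proof (intro exI[of _ "if j \<in> I then insert i I else I"] conjI allI)
          show "(if j \<in> I then insert i I else I) \<subseteq> S" using I 3 by auto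
          show "(\<Prod>l\<in>I. ?h v l) = (\<Prod>l\<in>(if j \<in> I then insert i I else I). v l)" for v :: "nat \<Rightarrow> 'r"
            by (rule eq)
        qed
      next
        fix v l assume v: "v \<in># X + Y" and "l \<notin> S - {i}"
        then have "l \<noteq> j" "l = i \<or> l \<notin> S" using 3 by auto
        then show "?h v l = 0" using supp[OF v, of l] 3 by auto
      qed auto
      from psubset.IH[OF sub(2) f' this] show ?thesis
        by (simp add: image_mset.compositionality o_def)
    qed
    have sp: "(\<Sum>v\<in>#W. f v) = (\<Sum>v\<in>#W. f (v(j := 0))) + (\<Sum>v\<in>#W. f (v(i := 0))) - (\<Sum>v\<in>#W. f (v(i := 0, j := 0)))
        + (\<Sum>v\<in>#W. f' (v(i := 0, j := v i * v j))) - (\<Sum>v\<in>#W. f' (v(i := 0, j := 0)))" for W :: "(nat \<Rightarrow> 'r) multiset"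
    proof (induction W)
      case (add v W)
      show ?case unfolding image_mset_add_mset sum_mset.add_mset add.IH
        by (subst split[of v]) (simp add: algebra_simps)
    qed simp
    show ?thesis unfolding sp[of X] sp[of Y] e1 e2 e3 e4 e5 ..
  qed
qed

lemma multi_affine_kcls: "multi_affine UNIV (\<lambda>v. kcls {#v#})"
  unfolding multi_affine_def
proof (intro conjI ballI allI impI)
  fix i and k :: fam and a b
  show "kcls {#k(i := a)#} + kcls {#k(i := b)#} = kcls {#k(i := a + b)#} + kcls {#k(i := 0)#}"
    using kcls_eqI[OF gaugem_add[of k i a b]] by (simp flip: kcls_plus add: add_mset_commute)
next
  fix i j and k :: fam and b c assume "i \<noteq> (j::nat)"
  have sum4: "kcls {#x, y, z, w#} = kcls {#x#} + kcls {#y#} + kcls {#z#} + kcls {#w#}" for x y z w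
    using kcls_sum[of "{#x, y, z, w#}"] by (simp add: add.assoc)
  show "kcls {#k(i := c, j := 0)#} + kcls {#k(i := 0, j := b)#} + kcls {#k(i := 0, j := 0)#} + kcls {#k(i := 1, j := c * b)#}
    = kcls {#k(i := 0, j := 0)#} + kcls {#k(i := c, j := b)#} + kcls {#k(i := 1, j := 0)#} + kcls {#k(i := 0, j := c * b)#}"
    using kcls_eqI[OF gaugem_mult[OF \<open>i \<noteq> j\<close>, of k c b]] unfolding sum4 .
qed

section \<open>From equal products to stable triviality\<close>

lemma same_products_stable:
  fixes X Y :: "fam multiset"
  assumes "finite S" "same_products S X Y"
  shows "\<exists>Z. gaugem (X + Z) (Y + Z)"
proof -
  have "kcls X = kcls Y"
    using multi_affine_sum_eq[OF assms(1) multi_affine_subset[OF multi_affine_kcls subset_UNIV] assms(2)]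
    by (simp flip: kcls_sum)
  then show ?thesis by (rule kcls_eqD)
qed

text \<open>The stabilizing summand may involve further factors. Restricting its degrees, that is,
  pulling back to the torus on which the other coordinates are 0, leaves finitely many factors to
  trivialize.\<close>

definition restr :: "nat \<Rightarrow> (nat \<Rightarrow> 'a::zero) \<Rightarrow> nat \<Rightarrow> 'a" where
  "restr n k = (\<lambda>i. if i < n then k i else 0)"

text \<open>With the coordinates of a factor frozen, shifts in that factor have no effect, so the
  degree there drops to 0; on the first n factors nothing changes.\<close>

lemma qper_trunc:
  assumes "qper w f"
  shows "qper (restr n w) (\<lambda>x. f (trunc (2 * n) x))"
proof -
  have t1: "trunc (2 * n) (x(2 * i := x (2 * i) + 2 * pi)) =
      (if i < n then (trunc (2 * n) x)(2 * i := trunc (2 * n) x (2 * i) + 2 * pi) else trunc (2 * n) x)"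
    and t2: "trunc (2 * n) (x(2 * i + 1 := x (2 * i + 1) + 2 * pi)) =
      (if i < n then (trunc (2 * n) x)(2 * i + 1 := trunc (2 * n) x (2 * i + 1) + 2 * pi) else trunc (2 * n) x)"
    and t3: "i < n \<Longrightarrow> trunc (2 * n) x (2 * i) = x (2 * i)" for x i
    by (auto simp: trunc_def fun_eq_iff)
  show ?thesis
    unfolding qper_def
  proof (intro conjI allI)
    show "smooth (\<lambda>x. f (trunc (2 * n) x))"
      using assms by (simp add: smooth_trunc qper_smooth)
    show "f (trunc (2 * n) (x(2 * i := x (2 * i) + 2 * pi))) = f (trunc (2 * n) x)" for x i
      by (cases "i < n") (simp_all only: t1 qper_shift[OF assms] if_True if_False)
    show "f (trunc (2 * n) (x(2 * i + 1 := x (2 * i + 1) + 2 * pi))) =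
      cis (of_int (restr n w i) * x (2 * i)) * f (trunc (2 * n) x)" for x i
    proof (cases "i < n")
      case True
      then show ?thesis
        by (simp only: t2 qper_shift(2)[OF assms] if_True t3 restr_def)
    next
      case False
      then show ?thesis
        by (simp only: t2 if_False restr_def) simp
    qed
  qed
qed

lemma gauge_restr:
  assumes "gauge ks ls"
  shows "gauge (map (restr n) ks) (map (restr n) ls)"
proof -
  obtain F G where FG: "qper_mat ks ls F" "qper_mat ls ks G"
    "\<And>x. F x * G x = 1\<^sub>m (length ks)" "\<And>x. G x * F x = 1\<^sub>m (length ls)"
    using assms unfolding gauge_def by blast
  have r: "restr n (k - l) = restr n k - restr n l" for k l :: "nat \<Rightarrow> int"
    by (auto simp: restr_def fun_eq_iff)
  have q: "qper_mat (map (restr n) ks') (map (restr n) ls') (\<lambda>x. H (trunc (2 * n) x))" if "qper_mat ks' ls' H" for ks' ls' H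
    unfolding qper_mat_def
    using qper_matD(1)[OF that] qper_trunc[OF qper_matD(4)[OF that], of _ _ n]
    by (auto simp: r)
  show ?thesis
    unfolding gauge_def using q[OF FG(1)] q[OF FG(2)] FG(3,4)
    by (intro exI[of _ "\<lambda>x. F (trunc (2 * n) x)"] exI[of _ "\<lambda>x. G (trunc (2 * n) x)"]) auto
qed

lemma gaugem_restr:
  assumes "gaugem X Y"
  shows "gaugem (image_mset (restr n) X) (image_mset (restr n) Y)"
  unfolding gaugem_def
proof
  fix p
  obtain ks ls where *: "mset ks = image_mset (\<lambda>v i. v i p) X" "mset ls = image_mset (\<lambda>v i. v i p) Y" "gauge ks ls"
    using assms unfolding gaugem_def by blast
  have r: "(\<lambda>i. restr n v i p) = restr n (\<lambda>i. v i p)" for v :: fam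
    by (auto simp: restr_def)
  show "\<exists>ks ls. mset ks = image_mset (\<lambda>v i. v i p) (image_mset (restr n) X) \<and>
    mset ls = image_mset (\<lambda>v i. v i p) (image_mset (restr n) Y) \<and> gauge ks ls"
    using * gauge_restr[OF *(3), of n]
    by (intro exI[of _ "map (restr n) ks"] exI[of _ "map (restr n) ls"])
       (simp add: image_mset.compositionality o_def r)
qed

lemma replicate_mset_add: "replicate_mset (m + n) x = replicate_mset m x + replicate_mset n x"
  by (induction m) auto

text \<open>A bundle and the one with opposite degree on the factor i add up to two bundles that are
  trivial on this factor. Removing one factor after the other completes any line bundle to a trivial
  sum, and as v is a family the complement has one size for all p.\<close>

lemma gaugem_complement:
  fixes v :: fam
  assumes "finite S" "\<And>l. l \<notin> S \<Longrightarrow> v l = 0"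
  shows "\<exists>C N. gaugem (add_mset v C) (replicate_mset N 0)"
  using assms
proof (induction S arbitrary: v rule: finite_induct)
  case empty
  then have "v = 0" by (intro ext) simp
  then show ?case by (intro exI[of _ "{#}"] exI[of _ 1]) (simp add: gaugem_refl)
next
  case (insert i S)
  obtain C N where C: "gaugem (add_mset (v(i := 0)) C) (replicate_mset N 0)"
    using insert.IH[of "v(i := 0)"] insert.prems by (metis fun_upd_apply insert_iff)
  have "gaugem {#v, v(i := - v i)#} {#v(i := 0), v(i := 0)#}"
    using gaugem_add[of v i "v i" "- v i"] by (simp only: fun_upd_triv add.right_inverse)
  from gaugem_plus[OF this gaugem_refl[of "C + C"]]
  have "gaugem (add_mset v (add_mset (v(i := - v i)) (C + C))) (add_mset (v(i := 0)) C + add_mset (v(i := 0)) C)"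
    by (simp add: ac_simps)
  from gaugem_trans[OF this gaugem_plus[OF C C]]
  have "gaugem (add_mset v (add_mset (v(i := - v i)) (C + C))) (replicate_mset (N + N) 0)"
    by (simp add: replicate_mset_add)
  then show ?case by blast
qed

lemma gaugem_complement_mset:
  fixes Z :: "fam multiset"
  assumes "finite S" "\<And>v l. v \<in># Z \<Longrightarrow> l \<notin> S \<Longrightarrow> v l = 0"
  shows "\<exists>C N. gaugem (Z + C) (replicate_mset N 0)"
  using assms(2)
proof (induction Z)
  case empty
  show ?case by (intro exI[of _ "{#}"] exI[of _ 0]) (simp add: gaugem_refl)
next
  case (add v Z)
  have "\<exists>C N. gaugem (Z + C) (replicate_mset N 0)"
    by (rule add.IH, rule add.prems) auto
  then obtain C N where C: "gaugem (Z + C) (replicate_mset N 0)" by auto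
  have "\<exists>C N. gaugem (add_mset v C) (replicate_mset N 0)"
    by (rule gaugem_complement[OF assms(1)], rule add.prems) auto
  then obtain C' N' where C': "gaugem (add_mset v C') (replicate_mset N' 0)" by auto
  have "gaugem (add_mset v Z + (C + C')) (replicate_mset (N' + N) 0)"
    using gaugem_plus[OF C' C] by (simp add: replicate_mset_add ac_simps)
  then show ?case by blast
qed

text \<open>Adding a complement of the restricted stabilizing summand replaces it by a trivial one.
  This matters for the action, since all degrees of a trivial summand are 0 and hence divisible by
  p.\<close>

theorem stably_trivial:
  fixes X :: "fam multiset"
  assumes "same_products {..<n} X (replicate_mset r 0)"
  shows "\<exists>N. gaugem (X + replicate_mset N 0) (replicate_mset (r + N) 0)"
proof -
  obtain Z where Z: "gaugem (X + Z) (replicate_mset r 0 + Z)"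
    using same_products_stable[OF _ assms] by auto
  define Z' where "Z' = image_mset (restr n) Z"
  have r0: "restr n (0::fam) = 0" by (auto simp: restr_def)
  have "image_mset (restr n) X = image_mset id X"
    using assms unfolding same_products_def by (intro image_mset_cong) (auto simp: restr_def fun_eq_iff)
  with gaugem_restr[OF Z, of n] have Z1: "gaugem (X + Z') (replicate_mset r 0 + Z')"
    by (simp add: Z'_def r0)
  have "\<exists>C N. gaugem (Z' + C) (replicate_mset N 0)"
    by (rule gaugem_complement_mset[of "{..<n}"]) (auto simp: Z'_def restr_def)
  then obtain C N where C: "gaugem (Z' + C) (replicate_mset N 0)" by blast
  have "gaugem (X + replicate_mset N 0) (X + (Z' + C))"
    by (rule gaugem_plus[OF gaugem_refl gaugem_sym[OF C]])
  moreover have "gaugem (X + (Z' + C)) (replicate_mset r 0 + (Z' + C))"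
    using gaugem_plus[OF Z1 gaugem_refl[of C]] by (simp add: ac_simps)
  moreover have "gaugem (replicate_mset r 0 + (Z' + C)) (replicate_mset (r + N) 0)"
    using gaugem_plus[OF gaugem_refl[of "replicate_mset r 0"] C] by (simp add: replicate_mset_add)
  ultimately show ?thesis by (blast intro: gaugem_trans)
qed

subsection \<open>Degrees with prescribed products\<close>

text \<open>Induction on the set of factors. With entry 1 at i, the vectors of \<open>Y\<close> have
  the same products over I and over I enlarged by i; they take care of the sets containing i.
  \<open>W\<close> corrects the sets without i, and \<open>u\<close> corrects the singleton of i, to
  which \<open>Y\<close> contributes its size.\<close>

lemma prescribed_products:
  fixes c :: "nat set \<Rightarrow> 'r::comm_ring_1"
  assumes "finite S"
  shows "\<exists>Z :: (nat \<Rightarrow> 'r) multiset. (\<forall>v\<in>#Z. \<forall>l. l \<notin> S \<longrightarrow> v l = 0) \<and>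
     (\<forall>I\<subseteq>S. I \<noteq> {} \<longrightarrow> (\<Sum>v\<in>#Z. \<Prod>l\<in>I. v l) = c I)"
  using assms
proof (induction S arbitrary: c rule: finite_induct)
  case empty
  show ?case by (intro exI[of _ "{#}"]) auto
next
  case (insert i S)
  obtain Y :: "(nat \<Rightarrow> 'r) multiset" where Y: "\<forall>v\<in>#Y. \<forall>l. l \<notin> S \<longrightarrow> v l = 0"
    "\<forall>I\<subseteq>S. I \<noteq> {} \<longrightarrow> (\<Sum>v\<in>#Y. \<Prod>l\<in>I. v l) = c (insert i I)"
    using insert.IH[of "\<lambda>I. c (insert i I)"] by (elim exE conjE) (rule that)
  obtain W :: "(nat \<Rightarrow> 'r) multiset" where W: "\<forall>v\<in>#W. \<forall>l. l \<notin> S \<longrightarrow> v l = 0"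
    "\<forall>I\<subseteq>S. I \<noteq> {} \<longrightarrow> (\<Sum>v\<in>#W. \<Prod>l\<in>I. v l) = c I - c (insert i I)"
    using insert.IH[of "\<lambda>I. c I - c (insert i I)"] by (elim exE conjE) (rule that)
  note Y2 = Y(2)[rule_format] and W2 = W(2)[rule_format]
  define u :: "nat \<Rightarrow> 'r" where "u = (\<lambda>l. if l = i then c {i} - of_nat (size Y) else 0)"
  define Z where "Z = add_mset u (image_mset (\<lambda>v. v(i := 1)) Y + W)"
  have "v l = 0" if "v \<in># Z" "l \<notin> insert i S" for v l
    using that Y(1) W(1) by (auto simp: Z_def u_def)
  moreover have "(\<Sum>v\<in>#Z. \<Prod>l\<in>I. v l) = c I" if I: "I \<subseteq> insert i S" "I \<noteq> {}" for I
  proof -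
    have fin: "finite I" using I(1) insert.hyps(1) finite_subset by blast
    have Zs: "(\<Sum>v\<in>#Z. \<Prod>l\<in>I. v l) = (\<Prod>l\<in>I. u l) + ((\<Sum>v\<in>#Y. \<Prod>l\<in>I. (v(i := 1)) l) + (\<Sum>v\<in>#W. \<Prod>l\<in>I. v l))"
      by (simp add: Z_def image_mset.compositionality o_def)
    show ?thesis
    proof (cases "i \<in> I")
      case False
      then have IS: "I \<subseteq> S" using I by auto
      obtain m where m: "m \<in> I" using I by auto
      have "(\<Prod>l\<in>I. u l) = 0"
        by (rule prod_zero[OF fin]) (use m False in \<open>auto simp: u_def\<close>)
      moreover have "(\<Prod>l\<in>I. (v(i := 1)) l) = (\<Prod>l\<in>I. v l)" for v :: "nat \<Rightarrow> 'r"
        by (rule prod.cong) (use False in auto)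
      ultimately show ?thesis
        unfolding Zs by (simp only: Y2[OF IS I(2)] W2[OF IS I(2)]) simp
    next
      case True
      have W0: "(\<Sum>v\<in>#W. \<Prod>l\<in>I. v l) = (\<Sum>v\<in>#W. 0)"
        by (intro arg_cong[of _ _ sum_mset] image_mset_cong prod_zero[OF fin])
           (use W(1) True insert.hyps(2) in auto)
      have Y1: "(\<Prod>l\<in>I. (v(i := 1)) l) = (\<Prod>l\<in>I - {i}. v l)" for v :: "nat \<Rightarrow> 'r"
      proof -
        have "(\<Prod>l\<in>I. (v(i := 1)) l) = (\<Prod>l\<in>I - {i}. (v(i := 1)) l)"
          using prod.remove[OF fin True, of "v(i := 1)"] by simp
        also have "\<dots> = (\<Prod>l\<in>I - {i}. v l)" by (rule prod.cong) auto
        finally show ?thesis .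
      qed
      show ?thesis
      proof (cases "I = {i}")
        case True
        then show ?thesis unfolding Zs W0 Y1 by (simp add: u_def)
      next
        case False
        then obtain m where m: "m \<in> I" "m \<noteq> i" using True by auto
        have "(\<Prod>l\<in>I. u l) = 0"
          by (rule prod_zero[OF fin]) (use m in \<open>auto simp: u_def\<close>)
        moreover have "(\<Sum>v\<in>#Y. \<Prod>l\<in>I - {i}. v l) = c (insert i (I - {i}))"
          by (rule Y2) (use I m in auto)
        ultimately show ?thesis unfolding Zs W0 Y1 using True by (simp add: insert_absorb)
      qed
    qed
  qed
  ultimately show ?case by blast
qed

subsection \<open>Roots of unity modulo a prime power\<close>

text \<open>By Euler's theorem h^(n+1) = 1 modulo p^n, whereas h^j differs from 1 modulo p for 1 <=
  j <= n. The geometric sum of the powers of h^j, multiplied by h^j - 1, is therefore 0 modulo p^n,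
  and h^j - 1 is a unit there.\<close>

lemma roots_of_unity_power_sums:
  assumes "n \<ge> 1" "prime p" "[p = 1] (mod (n + 1))"
  shows "\<exists>h :: int. \<forall>j\<in>{1..n}. int p ^ n dvd (\<Sum>s\<le>n. (h ^ s) ^ j)"
proof -
  obtain g where "residue_primroot p g"
    using prime_primitive_root_exists[of p] assms(2) prime_gt_1_nat by blast
  then have cop: "coprime p g" and ord: "ord p g = p - 1"
    using assms(2) by (auto simp: residue_primroot_def totient_prime)
  have p1: "p > 1" using assms(2) by (rule prime_gt_1_nat)
  have "n + 1 dvd p - 1"
    using assms(3) p1 by (simp add: cong_altdef_nat)
  then obtain m where m: "p - 1 = (n + 1) * m" by blast
  \<comment> \<open>With p - 1 = (n + 1) m, the exponent times n + 1 is the totient of p^n. The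
    factor p^(n-1) is prime to p - 1 and so has no influence on the order modulo p.\<close>
  define h where "h = g ^ (m * p ^ (n - 1))"
  have "coprime g (p ^ n)" using cop by (simp add: coprime_commute)
  then have "[g ^ totient (p ^ n) = 1] (mod p ^ n)" by (rule euler_theorem)
  moreover have "totient (p ^ n) = m * p ^ (n - 1) * (n + 1)"
  proof -
    have "totient (p ^ n) = p ^ (n - 1) * ((n + 1) * m)"
      using totient_prime_power[OF assms(2), of n] assms(1) unfolding m by auto
    then show ?thesis by (simp only: mult_ac)
  qed
  ultimately have h1: "[h ^ (n + 1) = 1] (mod p ^ n)"
    by (simp only: h_def power_mult[symmetric])
  have hj: "\<not> [h ^ j = 1] (mod p)" if j: "j \<in> {1..n}" for j
  proof
    assume "[h ^ j = 1] (mod p)"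
    then have "p - 1 dvd m * p ^ (n - 1) * j"
      by (simp only: h_def power_mult[symmetric] ord_divides ord)
    moreover have "coprime (p - 1) (p ^ (n - 1))"
      using coprime_diff_one_left_nat[of p] p1 by simp
    moreover have "m * p ^ (n - 1) * j = p ^ (n - 1) * (m * j)" by simp
    ultimately have "p - 1 dvd m * j"
      by (simp only: coprime_dvd_mult_right_iff)
    moreover have "m > 0" using m p1 by (cases m) auto
    ultimately have "n + 1 dvd j"
      unfolding m mult.commute[of "n + 1" m] by (simp only: nat_mult_dvd_cancel1)
    then show False using j by (auto dest: dvd_imp_le)
  qed
  show ?thesis
  proof (intro exI[of _ "int h"] ballI)
    fix j assume j: "j \<in> {1..n}"
    let ?q = "int h ^ j"
    have "(?q - 1) * (\<Sum>s\<le>n. ?q ^ s) = ?q ^ Suc n - 1"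
      by (simp only: power_diff_1_eq lessThan_Suc_atMost)
    also have "\<dots> = (int h ^ (n + 1)) ^ j - 1"
      by (simp only: power_mult[symmetric] mult.commute[of j] Suc_eq_plus1)
    finally have eq: "(?q - 1) * (\<Sum>s\<le>n. ?q ^ s) = (int h ^ (n + 1)) ^ j - 1" .
    have "[int (h ^ (n + 1)) = int 1] (mod int (p ^ n))"
      using h1 by (simp only: cong_int_iff)
    then have "[(int h ^ (n + 1)) ^ j = 1 ^ j] (mod int p ^ n)"
      by (intro cong_pow) simp
    then have "int p ^ n dvd (?q - 1) * (\<Sum>s\<le>n. ?q ^ s)"
      unfolding eq by (simp add: cong_iff_dvd_diff)
    moreover have "coprime (int p ^ n) (?q - 1)"
    proof -
      have "\<not> int p dvd ?q - 1"
      proof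
        assume "int p dvd ?q - 1"
        then have "[int (h ^ j) = int 1] (mod int p)" by (simp add: cong_iff_dvd_diff)
        then show False using hj[OF j] by (simp only: cong_int_iff)
      qed
      then show ?thesis
        using assms(2) by (simp add: prime_imp_coprime)
    qed
    ultimately have "int p ^ n dvd (\<Sum>s\<le>n. ?q ^ s)"
      by (simp add: coprime_dvd_mult_right_iff)
    moreover have "(\<Sum>s\<le>n. (int h ^ s) ^ j) = (\<Sum>s\<le>n. ?q ^ s)"
      by (simp flip: power_mult add: mult.commute)
    ultimately show "int p ^ n dvd (\<Sum>s\<le>n. (int h ^ s) ^ j)" by simp
  qed
qed

lemma sum_mset_apply: "(\<Sum>x\<in>#M. f x) p = (\<Sum>x\<in>#M. f x p)"
  for f :: "'a \<Rightarrow> 'b \<Rightarrow> 'c::comm_monoid_add"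
  by (induction M) auto

lemma sum_mset_mult_left: "(\<Sum>x\<in>#M. c * f x) = c * (\<Sum>x\<in>#M. f x :: 'a::semiring_0)"
  by (induction M) (auto simp: distrib_left)

lemma prod_apply: "(\<Prod>x\<in>A. f x) p = (\<Prod>x\<in>A. f x p)"
  for f :: "'a \<Rightarrow> 'b \<Rightarrow> 'c::comm_monoid_mult"
  by (induction A rule: infinite_finite_induct) auto

text \<open>The degrees \<open>p k\<close> split into the powers of a root of unity, which carry the
  nontrivial central character, and a correction of trivial central character.\<close>

theorem trivial_sum_exists:
  assumes "n \<ge> 1"
  shows "\<exists>r. \<forall>p. prime p \<and> [p = 1] (mod (n + 1)) \<longrightarrow>
    (\<exists>ks :: (nat \<Rightarrow> int) list. \<exists>\<kappa> :: nat \<Rightarrow> int. length ks = r \<and>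
       gauge (map (\<lambda>k l. int p * k l) ks) (replicate r 0) \<and>
       (\<forall>s<r. \<forall>l<n. [(ks ! s) l = \<kappa> s] (mod int p)) \<and>
       (\<exists>s<r. \<kappa> s = 1) \<and> (\<forall>l<n. (\<Sum>s<r. (ks ! s) l) = 0))"
proof -
  define adm where "adm p \<longleftrightarrow> prime p \<and> [p = 1] (mod (n + 1))" for p
  have "\<forall>p. \<exists>h :: int. adm p \<longrightarrow> (\<forall>j\<in>{1..n}. int p ^ n dvd (\<Sum>s\<le>n. (h ^ s) ^ j))"
    using roots_of_unity_power_sums[OF assms] unfolding adm_def by blast
  from choice[OF this] obtain h :: "nat \<Rightarrow> int" where
    h: "\<forall>p. adm p \<longrightarrow> (\<forall>j\<in>{1..n}. int p ^ n dvd (\<Sum>s\<le>n. (h p ^ s) ^ j))" by blast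
  \<comment> \<open>The identities in the ring of families have to hold at every p, so the
    characters are set to 0 at the other p.\<close>
  define kap where "kap s p = (if adm p then h p ^ s else 0)" for s p
  have cex: "\<exists>c. (\<Sum>s\<le>n. kap s p ^ j) = int p ^ j * c" if "j \<in> {1..n}" for p j
  proof (cases "adm p")
    case True
    have "int p ^ j dvd int p ^ n" using that by (simp add: le_imp_power_dvd)
    then have "int p ^ j dvd (\<Sum>s\<le>n. kap s p ^ j)"
      using h True that by (auto simp: kap_def intro: dvd_trans)
    then show ?thesis by (auto elim: dvdE)
  next
    case False
    then show ?thesis using that by (intro exI[of _ 0]) (simp add: kap_def)
  qed
  define c where "c j p = (SOME c. (\<Sum>s\<le>n. kap s p ^ j) = int p ^ j * c)" for j p
  have c: "(\<Sum>s\<le>n. kap s p ^ j) = int p ^ j * c j p" if "j \<in> {1..n}" for p j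
    unfolding c_def by (rule someI_ex[OF cex[OF that]])
  define P :: "nat \<Rightarrow> int" where "P = (\<lambda>p. int p)"
  \<comment> \<open>The correction has to supply the negatives of the power sums divided by p^j,
    where j is the number of factors in I.\<close>
  obtain Z :: "fam multiset" where Z: "\<forall>v\<in>#Z. \<forall>l. l \<notin> {..<n} \<longrightarrow> v l = 0"
    "\<forall>I\<subseteq>{..<n}. I \<noteq> {} \<longrightarrow> (\<Sum>v\<in>#Z. \<Prod>l\<in>I. v l) = - c (card I)"
    using prescribed_products[where S = "{..<n}" and c = "\<lambda>I. - c (card I)", OF finite_lessThan]
    by (elim exE conjE) (rule that)
  define V :: "nat \<Rightarrow> fam" where "V s = (\<lambda>l. if l < n then kap s else 0)" for s
  \<comment> \<open>The outer factor P turns k into the degree p k. The correction carries a second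
    factor P, so that its k is divisible by p and f can act trivially on it.\<close>
  define X where "X = image_mset (\<lambda>v l. P * v l) (image_mset V (mset_set {..n}) + image_mset (\<lambda>v l. P * v l) Z)"
  define r0 where "r0 = size X"
  have "same_products {..<n} X (replicate_mset r0 0)"
    unfolding same_products_def
  proof (intro conjI allI impI)
    show "size X = size (replicate_mset r0 0)" by (simp add: r0_def)
    show "\<forall>v\<in>#X + replicate_mset r0 0. \<forall>l. l \<notin> {..<n} \<longrightarrow> v l = 0"
      using Z(1) by (auto simp: X_def V_def)
    fix I assume I: "I \<subseteq> {..<n}"
    show "(\<Sum>v\<in>#X. \<Prod>l\<in>I. v l) = (\<Sum>v\<in>#replicate_mset r0 0. \<Prod>l\<in>I. v l)"
    proof (cases "I = {}")
      case True
      then show ?thesis by (simp add: r0_def)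
    next
      case False
      have fin: "finite I" using I finite_subset by blast
      have rhs: "(\<Sum>v\<in>#replicate_mset r0 0. \<Prod>l\<in>I. v l) = (0 :: nat \<Rightarrow> int)"
      proof -
        have "0 < card I" using False fin by (simp add: card_gt_0_iff)
        then have "0 ^ card I = (0 :: nat \<Rightarrow> int)" by (rule zero_power)
        then show ?thesis by simp
      qed
      have j: "card I \<in> {1..n}"
        using False fin card_mono[OF _ I] by (auto simp: Suc_le_eq card_gt_0_iff)
      have "(\<Sum>v\<in>#X. \<Prod>l\<in>I. v l) p = 0" for p
      proof -
        have "(\<Sum>v\<in>#X. \<Prod>l\<in>I. v l) p = (\<Sum>s\<le>n. \<Prod>l\<in>I. int p * V s l p)
            + (\<Sum>v\<in>#Z. \<Prod>l\<in>I. int p * (int p * v l p))"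
          by (simp add: sum_mset_apply prod_apply X_def P_def image_mset.compositionality o_def sum_unfold_sum_mset)
        also have "(\<Sum>s\<le>n. \<Prod>l\<in>I. int p * V s l p) = (\<Sum>s\<le>n. int p ^ card I * kap s p ^ card I)"
        proof (intro sum.cong HOL.refl)
          fix s
          have "(\<Prod>l\<in>I. int p * V s l p) = (\<Prod>l\<in>I. int p * kap s p)"
            by (rule prod.cong) (use I in \<open>auto simp: V_def\<close>)
          then show "(\<Prod>l\<in>I. int p * V s l p) = int p ^ card I * kap s p ^ card I"
            by (simp add: power_mult_distrib)
        qed
        \<comment> \<open>One p^j comes from the degrees p k, the other from the divisibility of the
          power sum; the correction yields p^(2 j) as well, and the two contributions
          cancel.\<close>
        also have "\<dots> = int p ^ card I * (int p ^ card I * c (card I) p)"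
          by (simp only: c[OF j] flip: sum_distrib_left)
        also have "(\<Sum>v\<in>#Z. \<Prod>l\<in>I. int p * (int p * v l p)) = (\<Sum>v\<in>#Z. (int p ^ card I * int p ^ card I) * (\<Prod>l\<in>I. v l p))"
          by (simp add: prod.distrib mult.assoc)
        also have "\<dots> = (int p ^ card I * int p ^ card I) * (\<Sum>v\<in>#Z. \<Prod>l\<in>I. v l p)"
          by (rule sum_mset_mult_left)
        also have "(\<Sum>v\<in>#Z. \<Prod>l\<in>I. v l p) = (\<Sum>v\<in>#Z. \<Prod>l\<in>I. v l) p"
          by (simp only: sum_mset_apply prod_apply)
        also have "\<dots> = - c (card I) p"
          using Z(2) I False by simp
        finally show ?thesis by simp
      qed
      then show ?thesis unfolding rhs by auto
    qed
  qed
  from stably_trivial[OF this] obtain N where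
    N: "gaugem (X + replicate_mset N 0) (replicate_mset (r0 + N) 0)" by (elim exE) (rule that)
  obtain zs where zs: "mset zs = Z" using ex_mset[of Z] by (elim exE) (rule that)
  define fs where "fs = map V [0..<Suc n] @ map (\<lambda>v l. P * v l) zs @ replicate N 0"
  have "size Z = length zs" using arg_cong[OF zs, of size] by simp
  moreover have "length fs = Suc n + length zs + N"
    unfolding fs_def by (simp del: upt_Suc)
  moreover have "r0 = Suc n + size Z"
    unfolding r0_def X_def by simp
  ultimately have len: "length fs = r0 + N" by simp
  have msfs: "mset (map (\<lambda>v l. P * v l) fs) = X + replicate_mset N 0"
  proof -
    have "mset (map V [0..<Suc n]) = image_mset V (mset_set {..n})"
      by (simp only: mset_map mset_upt atLeast0LessThan lessThan_Suc_atMost)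
    moreover have "(\<lambda>l. P * (0::fam) l) = 0" by (intro ext) simp
    ultimately show ?thesis
      by (simp only: fs_def X_def mset_map mset_append zs image_mset_union mset_replicate image_replicate_mset add.assoc)
  qed
  show ?thesis
  proof (intro exI[of _ "r0 + N"] allI impI)
    fix p assume "prime p \<and> [p = 1] (mod (n + 1))"
    then have adm: "adm p" by (simp add: adm_def)
    define ks where "ks = map (\<lambda>v l. v l p) fs"
    define \<kappa> where "\<kappa> s = (if s \<le> n then h p ^ s else 0)" for s
    have "gauge (map (\<lambda>k l. int p * k l) ks) (replicate (r0 + N) 0)"
    proof -
      have "mset (map (\<lambda>k l. int p * k l) ks) = image_mset (\<lambda>v i. v i p) (mset (map (\<lambda>v l. P * v l) fs))"
        by (simp add: ks_def image_mset.compositionality o_def P_def)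
      moreover have "mset (replicate (r0 + N) (0 :: nat \<Rightarrow> int)) = image_mset (\<lambda>v i. v i p) (replicate_mset (r0 + N) 0)"
      proof -
        have "(\<lambda>i. (0 :: fam) i p) = 0" by (intro ext) simp
        then show ?thesis by (simp only: mset_replicate image_replicate_mset)
      qed
      ultimately show ?thesis
        using N unfolding gaugem_iff msfs[symmetric] by blast
    qed
    moreover have "[(ks ! s) l = \<kappa> s] (mod int p)" if "s < r0 + N" "l < n" for s l
    proof (cases "s \<le> n")
      case True
      then have "fs ! s = V s" by (simp add: fs_def nth_append del: upt_Suc)
      with that True adm show ?thesis by (simp add: ks_def len V_def kap_def \<kappa>_def)
    next
      case False
      then have "fs ! s \<in> set (map (\<lambda>v l. P * v l) zs @ replicate N 0)"
        using that(1) len by (auto simp: fs_def nth_append)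
      then obtain z :: fam where "fs ! s = (\<lambda>l. P * z l) \<or> fs ! s = 0" by auto
      with that False show ?thesis by (auto simp: ks_def len \<kappa>_def P_def cong_0_iff)
    qed
    \<comment> \<open>The summand s = 0 has character h^0 = 1, and on it f acts
      nontrivially.\<close>
    moreover have "\<exists>s<r0 + N. \<kappa> s = 1"
      using len by (intro exI[of _ 0]) (auto simp: \<kappa>_def fs_def)
    moreover have "(\<Sum>s<r0 + N. (ks ! s) l) = 0" if "l < n" for l
    proof -
      have "(\<Sum>v\<in>#X. \<Prod>m\<in>{l}. v m) = (\<Sum>v\<in>#replicate_mset r0 0. \<Prod>m\<in>{l}. v m)"
        using \<open>same_products {..<n} X (replicate_mset r0 0)\<close> that unfolding same_products_def by blast
      then have "(\<Sum>v\<in>#X + replicate_mset N 0. v l) = 0" by simp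
      then have "(\<Sum>v\<in>#X + replicate_mset N 0. v l) p = 0"
        by simp
      then have "(\<Sum>v\<in>#X + replicate_mset N 0. v l p) = 0"
        by (simp only: sum_mset_apply)
      then have "(\<Sum>v\<in>#mset fs. int p * v l p) = 0"
        by (simp add: msfs[symmetric] P_def image_mset.compositionality o_def)
      then have "int p * (\<Sum>v\<in>#mset fs. v l p) = 0"
        by (simp only: sum_mset_mult_left)
      moreover have "int p \<noteq> 0"
        using adm prime_gt_0_nat[of p] by (simp add: adm_def)
      ultimately have "(\<Sum>v\<in>#mset fs. v l p) = 0"
        by (blast dest: mult_eq_0_iff[THEN iffD1])
      moreover have "(\<Sum>v\<in>#mset fs. v l p) = (\<Sum>s<length fs. (fs ! s) l p)"
        by (simp add: sum_mset_sum_list sum_list_sum_nth atLeast0LessThan flip: mset_map)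
      ultimately show ?thesis by (simp add: ks_def len)
    qed
    ultimately show "\<exists>ks :: (nat \<Rightarrow> int) list. \<exists>\<kappa> :: nat \<Rightarrow> int. length ks = r0 + N \<and>
       gauge (map (\<lambda>k l. int p * k l) ks) (replicate (r0 + N) 0) \<and>
       (\<forall>s<r0 + N. \<forall>l<n. [(ks ! s) l = \<kappa> s] (mod int p)) \<and>
       (\<exists>s<r0 + N. \<kappa> s = 1) \<and> (\<forall>l<n. (\<Sum>s<r0 + N. (ks ! s) l) = 0)"
      by (intro exI[of _ ks] exI[of _ \<kappa>]) (simp add: ks_def len)
  qed
qed

subsection \<open>The cocycle\<close>

definition pshift :: "nat \<Rightarrow> (nat \<Rightarrow> real) \<Rightarrow> (nat \<Rightarrow> int) \<Rightarrow> nat \<Rightarrow> real" where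
  "pshift n x c = (\<lambda>j. if j < 2 * n then x j + 2 * pi * of_int (c j) else x j)"

lemma cis_2pi_int: "cis (2 * pi * of_int m) = 1"
  by (simp add: cis_multiple_2pi)

lemma cis_add_2pi_int: "cis (t + 2 * pi * of_int m) = cis t"
  by (simp add: cis_2pi_int flip: cis_mult)

lemma qper_int_shift:
  assumes "qper w f"
  shows "f (x(2 * i := x (2 * i) + 2 * pi * of_int m)) = f x"
    and "f (x(2 * i + 1 := x (2 * i + 1) + 2 * pi * of_int m)) = cis (of_int (w i * m) * x (2 * i)) * f x"
proof -
  have 1: "f (x(2 * i := x (2 * i) + 2 * pi * of_nat k)) = f x" for k x
  proof (induction k)
    case (Suc k)
    let ?y = "x(2 * i := x (2 * i) + 2 * pi * of_nat k)"
    have eq: "x(2 * i := x (2 * i) + 2 * pi * of_nat (Suc k)) = ?y(2 * i := ?y (2 * i) + 2 * pi)"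
      by (simp add: algebra_simps)
    show ?case
      by (rule HOL.trans[OF arg_cong[OF eq, of f] HOL.trans[OF qper_shift(1)[OF assms] Suc]])
  qed simp
  have 2: "f (x(2 * i + 1 := x (2 * i + 1) + 2 * pi * of_nat k)) = cis (of_int (w i * of_nat k) * x (2 * i)) * f x" for k x
  proof (induction k)
    case (Suc k)
    let ?y = "x(2 * i + 1 := x (2 * i + 1) + 2 * pi * of_nat k)"
    have eq: "x(2 * i + 1 := x (2 * i + 1) + 2 * pi * of_nat (Suc k)) = ?y(2 * i + 1 := ?y (2 * i + 1) + 2 * pi)"
      by (simp add: algebra_simps)
    have "f (x(2 * i + 1 := x (2 * i + 1) + 2 * pi * of_nat (Suc k))) = cis (of_int (w i) * ?y (2 * i)) * f ?y"
      by (rule HOL.trans[OF arg_cong[OF eq, of f] qper_shift(2)[OF assms]])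
    also have "?y (2 * i) = x (2 * i)" by simp
    also have "cis (of_int (w i) * x (2 * i)) * f ?y = cis (of_int (w i * of_nat (Suc k)) * x (2 * i)) * f x"
    proof -
      have eq: "cis (of_int (w i * of_nat (Suc k)) * x (2 * i)) =
          cis (of_int (w i) * x (2 * i)) * cis (of_int (w i * of_nat k) * x (2 * i))"
        by (simp add: cis_mult algebra_simps)
      show ?thesis unfolding Suc eq by (simp only: mult.assoc)
    qed
    finally show ?case .
  qed simp
  show "f (x(2 * i := x (2 * i) + 2 * pi * of_int m)) = f x"
  proof (cases "m \<ge> 0")
    case True
    then show ?thesis using 1[of x "nat m"] by simp
  next
    case False
    then show ?thesis using 1[of "x(2 * i := x (2 * i) + 2 * pi * of_int m)" "nat (- m)"] by simp
  qed
  show "f (x(2 * i + 1 := x (2 * i + 1) + 2 * pi * of_int m)) = cis (of_int (w i * m) * x (2 * i)) * f x"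
  proof (cases "m \<ge> 0")
    case True
    then show ?thesis using 2[of x "nat m"] by simp
  next
    case False
    let ?y = "x(2 * i + 1 := x (2 * i + 1) + 2 * pi * of_int m)"
    have "f x = cis (of_int (w i * (- m)) * x (2 * i)) * f ?y"
      using 2[of ?y "nat (- m)"] False by simp
    then have "cis (of_int (w i * m) * x (2 * i)) * f x = f ?y"
      by (simp add: mult.assoc[symmetric] cis_mult)
    then show ?thesis by simp
  qed
qed

text \<open>On each factor the even coordinate is shifted first. The factor caused by the odd shift
  then involves the shifted even coordinate, which changes its phase by an integral multiple of 2 pi
  only.\<close>

lemma qper_pshift:
  assumes "qper w f"
  shows "f (pshift n x c) = cis (\<Sum>i<n. of_int (w i * c (2 * i + 1)) * x (2 * i)) * f x"
proof (induction n)
  case 0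
  then show ?case by (simp add: pshift_def)
next
  case (Suc n)
  let ?y = "pshift n x c"
  let ?z = "?y(2 * n := ?y (2 * n) + 2 * pi * of_int (c (2 * n)))"
  have "pshift (Suc n) x c = ?z(2 * n + 1 := ?z (2 * n + 1) + 2 * pi * of_int (c (2 * n + 1)))"
    by (auto simp: pshift_def fun_eq_iff less_Suc_eq)
  then have "f (pshift (Suc n) x c) = cis (of_int (w n * c (2 * n + 1)) * ?z (2 * n)) * f ?z"
    by (simp only: qper_int_shift(2)[OF assms])
  also have "f ?z = f ?y" by (rule qper_int_shift(1)[OF assms])
  also have "cis (of_int (w n * c (2 * n + 1)) * ?z (2 * n)) = cis (of_int (w n * c (2 * n + 1)) * x (2 * n))"
  proof -
    have "of_int (w n * c (2 * n + 1)) * ?z (2 * n) =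
      of_int (w n * c (2 * n + 1)) * x (2 * n) + 2 * pi * of_int (w n * c (2 * n + 1) * c (2 * n))"
      by (simp add: pshift_def algebra_simps)
    then show ?thesis by (simp only: cis_add_2pi_int)
  qed
  finally show ?case
    by (simp only: Suc.IH sum.lessThan_Suc mult.assoc[symmetric] cis_mult add.commute)
qed

section \<open>Lifts of translations and the Heisenberg cocycle\<close>

lemma mat_diag_carrier: "mat_diag r f \<in> carrier_mat r r"
  by (simp add: mat_diag_def)

lemma mat_collect:
  fixes G F X Y Z :: "complex mat"
  assumes c: "G \<in> carrier_mat r r" "F \<in> carrier_mat r r" "X \<in> carrier_mat r r" "Y \<in> carrier_mat r r" "Z \<in> carrier_mat r r"
  shows "(G * X) * Y * (Z * F) = G * (X * Y * Z) * F"
proof -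
  have "(G * X) * Y * (Z * F) = G * X * (Y * (Z * F))"
    by (rule assoc_mult_mat[OF mult_carrier_mat[OF c(1,3)] c(4) mult_carrier_mat[OF c(5,2)]])
  also have "Y * (Z * F) = Y * Z * F"
    by (rule assoc_mult_mat[OF c(4,5,2), symmetric])
  also have "G * X * (Y * Z * F) = G * (X * (Y * Z * F))"
    by (rule assoc_mult_mat[OF c(1,3) mult_carrier_mat[OF mult_carrier_mat[OF c(4,5)] c(2)]])
  also have "X * (Y * Z * F) = X * (Y * Z) * F"
    by (rule assoc_mult_mat[OF c(3) mult_carrier_mat[OF c(4,5)] c(2), symmetric])
  also have "X * (Y * Z) = X * Y * Z"
    by (rule assoc_mult_mat[OF c(3,4,5), symmetric])
  also have "G * (X * Y * Z * F) = G * (X * Y * Z) * F"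
    by (rule assoc_mult_mat[OF c(1) mult_carrier_mat[OF mult_carrier_mat[OF c(3,4)] c(5)] c(2), symmetric])
  finally show ?thesis .
qed

lemma diag_collect:
  fixes G F :: "complex mat"
  assumes "G \<in> carrier_mat r r" "F \<in> carrier_mat r r"
  shows "(G * mat_diag r f) * mat_diag r g * (mat_diag r h * F) = G * mat_diag r (\<lambda>s. f s * g s * h s) * F"
  unfolding mat_collect[OF assms mat_diag_carrier mat_diag_carrier mat_diag_carrier] mat_diag_diag ..

text \<open>The polarized form of the Heisenberg cocycle: even places hold the exponents of the a_i,
  odd places those of the b_i.\<close>

definition heis_cocycle :: "nat \<Rightarrow> (nat \<Rightarrow> int) \<Rightarrow> (nat \<Rightarrow> int) \<Rightarrow> int" where
  "heis_cocycle n q q' = (\<Sum>i<n. q (2 * i + 1) * q' (2 * i))"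

lemma heis_cocycle_add: "heis_cocycle n (q + q') s = heis_cocycle n q s + heis_cocycle n q' s" "heis_cocycle n s (q + q') = heis_cocycle n s q + heis_cocycle n s q'"
  by (simp_all add: heis_cocycle_def distrib_left distrib_right sum.distrib)

lemma heis_cocycle_minus: "heis_cocycle n (- s) t = - heis_cocycle n s t" "heis_cocycle n s (- t) = - heis_cocycle n s t"
  by (simp_all add: heis_cocycle_def sum_negf)

lemma heis_cocycle_diff: "heis_cocycle n (q - q') s = heis_cocycle n q s - heis_cocycle n q' s" "heis_cocycle n s (q - q') = heis_cocycle n s q - heis_cocycle n s q'"
  by (simp_all add: heis_cocycle_def left_diff_distrib right_diff_distrib sum_subtractf)

lemma heis_cocycle_0: "heis_cocycle n 0 s = 0" "heis_cocycle n s 0 = 0"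
  by (simp_all add: heis_cocycle_def)

text \<open>\<open>F\<close> trivializes the sum of the \<open>r\<close> line bundles with degrees \<open>p d s\<close>, and \<open>G\<close> is its inverse.
  The translation of the torus by \<open>q/p\<close> lifts to each summand; \<open>A q w\<close> is such a lift read in the
  trivialization, with the central element acting on the summand \<open>s\<close> by
  \<open>exp (2 \<pi> \<i> \<kappa> s / p)\<close>. The lifts compose by the Heisenberg cocycle on all summands alike, because
  \<open>d s l\<close> agrees with \<open>\<kappa> s\<close> modulo \<open>p\<close>.\<close>

locale heis_bundle =
  fixes n p r :: nat and d :: "nat \<Rightarrow> nat \<Rightarrow> int" and \<kappa> :: "nat \<Rightarrow> int"
    and F G :: "(nat \<Rightarrow> real) \<Rightarrow> complex mat"
  assumes n1: "n \<ge> 1" and p: "prime p"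
    and Fc: "F x \<in> carrier_mat r r" and Gc: "G x \<in> carrier_mat r r"
    and FG: "F x * G x = 1\<^sub>m r" and GF: "G x * F x = 1\<^sub>m r"
    and qF: "s < r \<Longrightarrow> t < r \<Longrightarrow> qper (\<lambda>l. int p * d s l) (\<lambda>x. F x $$ (s, t))"
    and qG: "s < r \<Longrightarrow> t < r \<Longrightarrow> qper (\<lambda>l. - (int p * d s l)) (\<lambda>x. G x $$ (t, s))"
    and dk: "s < r \<Longrightarrow> l < n \<Longrightarrow> [d s l = \<kappa> s] (mod int p)"
    and dsum: "l < n \<Longrightarrow> (\<Sum>s<r. d s l) = 0"
    and k1: "\<exists>s<r. \<kappa> s = 1"
begin

lemma pnz: "real p \<noteq> 0" "int p \<noteq> 0"
  using p prime_gt_0_nat by auto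

definition sh :: "(nat \<Rightarrow> int) \<Rightarrow> (nat \<Rightarrow> real) \<Rightarrow> nat \<Rightarrow> real" where
  "sh q x = (\<lambda>j. if j < 2 * n then x j + 2 * pi * of_int (q j) / of_nat p else x j)"

text \<open>A full period in an odd coordinate multiplies sections of degree p d by the phase p d x;
  a p-th part of the period is lifted with a p-th part of this phase.\<close>

definition phase :: "(nat \<Rightarrow> int) \<Rightarrow> int \<Rightarrow> nat \<Rightarrow> (nat \<Rightarrow> real) \<Rightarrow> real" where
  "phase q w s x = (\<Sum>i<n. of_int (d s i * q (2 * i + 1)) * x (2 * i)) + 2 * pi * of_int (\<kappa> s * w) / of_nat p"

definition A :: "(nat \<Rightarrow> int) \<Rightarrow> int \<Rightarrow> (nat \<Rightarrow> real) \<Rightarrow> complex mat" where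
  "A q w x = G (sh q x) * mat_diag r (\<lambda>s. cis (phase q w s x)) * F x"

definition twist :: "nat \<Rightarrow> (nat \<Rightarrow> int) \<Rightarrow> (nat \<Rightarrow> real) \<Rightarrow> real" where
  "twist s c x = (\<Sum>i<n. of_int (int p * d s i * c (2 * i + 1)) * x (2 * i))"

lemma A_carrier: "A q w x \<in> carrier_mat r r"
  unfolding A_def by (rule mult_carrier_mat[OF mult_carrier_mat[OF Gc mat_diag_carrier] Fc])

lemma F_pshift: "F (pshift n x c) = mat_diag r (\<lambda>s. cis (twist s c x)) * F x"
  by (rule eq_matI)
     (use Fc[of x] Fc[of "pshift n x c"] in
       \<open>auto simp: mat_diag_mult_left[OF Fc] twist_def qper_pshift[OF qF]\<close>)

lemma G_pshift: "G (pshift n x c) = G x * mat_diag r (\<lambda>s. cis (- twist s c x))"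
  by (rule eq_matI)
     (use Gc[of x] Gc[of "pshift n x c"] in
       \<open>auto simp: mat_diag_mult_right[OF Gc] twist_def qper_pshift[OF qG] sum_negf\<close>)

lemma sh_pshift: "sh q (pshift n x c) = pshift n (sh q x) c"
  by (auto simp: sh_def pshift_def)

lemma sh_add: "sh q (sh q' x) = sh (q + q') x"
  by (auto simp: sh_def add_divide_distrib distrib_left)

lemma sh_mod: "sh (\<lambda>j. q j + int p * c j) x = pshift n (sh q x) c"
  using pnz by (auto simp: sh_def pshift_def field_simps)

lemma twist_sh: "cis (twist s c (sh q x)) = cis (twist s c x)"
proof -
  have "twist s c (sh q x) = twist s c x + 2 * pi * of_int (\<Sum>i<n. d s i * c (2 * i + 1) * q (2 * i))"
  proof -
    have "twist s c (sh q x) = (\<Sum>i<n. of_int (int p * d s i * c (2 * i + 1)) * x (2 * i)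
        + 2 * pi * of_int (d s i * c (2 * i + 1) * q (2 * i)))"
      unfolding twist_def by (rule sum.cong) (use pnz in \<open>auto simp: sh_def field_simps\<close>)
    then show ?thesis by (simp only: twist_def sum.distrib of_int_sum sum_distrib_left)
  qed
  then show ?thesis by (simp only: cis_add_2pi_int)
qed

lemma twist_sh': "cis (- twist s c (sh q x)) = cis (- twist s c x)"
  using arg_cong[OF twist_sh[of s c q x], of cnj] by (simp add: cis_cnj)

lemma phase_pshift: "cis (phase q w s (pshift n x c)) = cis (phase q w s x)"
proof -
  have "phase q w s (pshift n x c) = phase q w s x + 2 * pi * of_int (\<Sum>i<n. d s i * q (2 * i + 1) * c (2 * i))"
    by (simp add: phase_def pshift_def sum.distrib sum_distrib_left algebra_simps)
  then show ?thesis by (simp only: cis_add_2pi_int)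
qed

text \<open>The phases that \<open>G\<close> and \<open>F\<close> acquire under a lattice
  translation cancel, so \<open>A\<close> descends to the torus.\<close>

lemma A_pshift: "A q w (pshift n x c) = A q w x"
proof -
  have "A q w (pshift n x c) = G (sh q x) * mat_diag r (\<lambda>s. cis (- twist s c x)) *
      mat_diag r (\<lambda>s. cis (phase q w s x)) * (mat_diag r (\<lambda>s. cis (twist s c x)) * F x)"
    by (simp only: A_def sh_pshift G_pshift F_pshift twist_sh' phase_pshift)
  also have "\<dots> = A q w x"
    unfolding diag_collect[OF Gc Fc] A_def by (simp add: cis_mult)
  finally show ?thesis .
qed

text \<open>For a full period the phase grows by exactly the \<open>twist\<close> that
  \<open>G\<close> takes back. This is why the p-th powers of the generators act trivially.\<close>

lemma A_mod: "A (\<lambda>j. q j + int p * c j) (w + int p * w') x = A q w x"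
proof -
  have "phase (\<lambda>j. q j + int p * c j) (w + int p * w') s x = twist s c x + phase q w s x + 2 * pi * of_int (\<kappa> s * w')" for s
    using pnz by (simp add: phase_def twist_def sum.distrib distrib_left distrib_right add_divide_distrib mult_ac)
  then have "cis (phase (\<lambda>j. q j + int p * c j) (w + int p * w') s x) = cis (twist s c x) * cis (phase q w s x)" for s
    by (simp only: cis_add_2pi_int cis_mult)
  then have "A (\<lambda>j. q j + int p * c j) (w + int p * w') x =
      G (sh q x) * mat_diag r (\<lambda>s. cis (- twist s c x)) *
      mat_diag r (\<lambda>s. cis (twist s c x) * cis (phase q w s x)) * (mat_diag r (\<lambda>s. 1) * F x)"
    using Fc[of x] by (simp add: A_def sh_mod G_pshift twist_sh' mat_diag_one)
  also have "\<dots> = A q w x"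
    unfolding diag_collect[OF Gc Fc] A_def by (simp add: mult.assoc[symmetric] cis_mult)
  finally show ?thesis .
qed

text \<open>The inner F and G cancel and the phases multiply. As the first phase is evaluated at the
  translated point, it contributes an extra 2 pi/p times the sum of the d s i q (2 i + 1) q' (2 i).
  Modulo 2 pi, d s i may be replaced by \<kappa> s, and what remains is \<kappa> s times the
  cocycle, uniformly in s.\<close>

lemma A_mult: "A q w (sh q' x) * A q' w' x = A (q + q') (w + w' + heis_cocycle n q q') x"
proof -
  let ?D = "\<lambda>q w x. mat_diag r (\<lambda>s. cis (phase q w s x))"
  have "A q w (sh q' x) * A q' w' x = G (sh q (sh q' x)) * ?D q w (sh q' x) * (F (sh q' x) * G (sh q' x)) * (?D q' w' x * F x)"
  proof -
    have "A q w (sh q' x) * A q' w' x = (G (sh q (sh q' x)) * ?D q w (sh q' x)) * F (sh q' x) * (G (sh q' x) * (?D q' w' x * F x))"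
      unfolding A_def by (simp only: assoc_mult_mat[OF Gc mat_diag_carrier Fc])
    also have "\<dots> = (G (sh q (sh q' x)) * ?D q w (sh q' x)) * (F (sh q' x) * G (sh q' x)) * (?D q' w' x * F x)"
    proof -
      have "P * X * (Y * Z) = P * (X * Y) * Z" if "P \<in> carrier_mat r r" "X \<in> carrier_mat r r" "Y \<in> carrier_mat r r" "Z \<in> carrier_mat r r" for P X Y Z :: "complex mat"
        using that by (simp add: assoc_mult_mat[of _ r r _ r _ r])
      then show ?thesis
        by (meson Gc Fc mat_diag_carrier mult_carrier_mat)
    qed
    finally show ?thesis .
  qed
  also have "\<dots> = (G (sh q (sh q' x)) * mat_diag r (\<lambda>s. 1)) * (?D q w (sh q' x) * ?D q' w' x) * (mat_diag r (\<lambda>s. 1) * F x)"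
  proof -
    have c: "?D q w (sh q' x) \<in> carrier_mat r r" "?D q' w' x \<in> carrier_mat r r" by (rule mat_diag_carrier)+
    have 1: "(G (sh q (sh q' x)) * ?D q w (sh q' x)) * (F (sh q' x) * G (sh q' x)) = G (sh q (sh q' x)) * ?D q w (sh q' x)"
      unfolding FG by (rule right_mult_one_mat[OF mult_carrier_mat[OF Gc c(1)]])
    have 2: "G (sh q (sh q' x)) * mat_diag r (\<lambda>s. 1) = G (sh q (sh q' x))" "mat_diag r (\<lambda>s. 1) * F x = F x"
      using Gc[of "sh q (sh q' x)"] Fc[of x] by simp_all
    have 3: "G (sh q (sh q' x)) * ?D q w (sh q' x) * (?D q' w' x * F x) = G (sh q (sh q' x)) * ?D q w (sh q' x) * ?D q' w' x * F x"
      by (rule assoc_mult_mat[OF mult_carrier_mat[OF Gc c(1)] c(2) Fc, symmetric])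
    have 4: "G (sh q (sh q' x)) * ?D q w (sh q' x) * ?D q' w' x = G (sh q (sh q' x)) * (?D q w (sh q' x) * ?D q' w' x)"
      by (rule assoc_mult_mat[OF Gc c])
    show ?thesis unfolding 1 2 3 4 ..
  qed
  also have "?D q w (sh q' x) * ?D q' w' x = ?D (q + q') (w + w' + heis_cocycle n q q') x"
  proof -
    have "cis (phase q w s (sh q' x)) * cis (phase q' w' s x) = cis (phase (q + q') (w + w' + heis_cocycle n q q') s x)" if s: "s < r" for s
    proof -
      have "\<forall>i. \<exists>e. i < n \<longrightarrow> d s i = \<kappa> s + int p * e"
        using dk[OF s] by (metis cong_iff_lin cong_sym)
      then obtain e where e: "\<And>i. i < n \<Longrightarrow> d s i = \<kappa> s + int p * e i" by metis
      define m where "m = (\<Sum>i<n. e i * q (2 * i + 1) * q' (2 * i))"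
      have "(\<Sum>i<n. of_int (d s i * q (2 * i + 1)) * (sh q' x) (2 * i)) =
        (\<Sum>i<n. of_int (d s i * q (2 * i + 1)) * x (2 * i)) +
        (\<Sum>i<n. of_int (d s i * q (2 * i + 1)) * (2 * pi * of_int (q' (2 * i)) / of_nat p))"
        by (simp add: sh_def distrib_left sum.distrib)
      also have "(\<Sum>i<n. of_int (d s i * q (2 * i + 1)) * (2 * pi * of_int (q' (2 * i)) / of_nat p)) =
        (\<Sum>i<n. 2 * pi * of_int (\<kappa> s * (q (2 * i + 1) * q' (2 * i))) / of_nat p + 2 * pi * of_int (e i * q (2 * i + 1) * q' (2 * i)))"
        by (rule sum.cong) (use pnz e in \<open>auto simp: field_simps\<close>)
      also have "\<dots> = 2 * pi * of_int (\<kappa> s * heis_cocycle n q q') / of_nat p + 2 * pi * of_int m"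
        by (simp add: sum.distrib heis_cocycle_def m_def sum_distrib_left sum_divide_distrib)
      finally have "phase q w s (sh q' x) + phase q' w' s x =
          phase (q + q') (w + w' + heis_cocycle n q q') s x + 2 * pi * of_int m"
        by (simp add: phase_def sum.distrib algebra_simps add_divide_distrib)
      then show ?thesis by (simp only: cis_mult cis_add_2pi_int)
    qed
    then show ?thesis
      unfolding mat_diag_diag by (auto simp: mat_diag_def)
  qed
  finally show ?thesis using Gc[of "sh q (sh q' x)"] Fc[of x] by (simp add: A_def sh_add)
qed

lemma A_zero: "A 0 0 x = 1\<^sub>m r"
proof -
  have "sh 0 x = x" by (auto simp: sh_def)
  moreover have "mat_diag r (\<lambda>s. cis (phase 0 0 s x)) = 1\<^sub>m r"
    by (simp add: phase_def mat_diag_one)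
  ultimately show ?thesis using Gc[of x] by (simp add: A_def GF)
qed

end

text \<open>The condition on \<open>a\<close> keeps the translation inside
  \<open>Euclidean_space N\<close>.\<close>

lemma C_k_translate:
  assumes "\<And>j. j \<ge> N \<Longrightarrow> a j = 0"
  shows "C_k k N f \<Longrightarrow> C_k k N (\<lambda>x. f (\<lambda>j. x j + a j))"
proof (induction k arbitrary: f)
  case 0
  have E: "(\<lambda>j. x j + a j) \<in> topspace (Euclidean_space N)" if "x \<in> topspace (Euclidean_space N)" for x
    using that assms by (auto simp: topspace_Euclidean_space)
  have c: "continuous_on (topspace (Euclidean_space N)) (\<lambda>x j. x j + a j)"
    by (intro continuous_on_coordinatewise_then_product continuous_intros
        continuous_on_product_then_coordinatewise[OF continuous_on_id])
  show ?case
    using "0.prems" unfolding C_k.simps continuous_map_Euclidean_space_iff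
    by (rule continuous_on_compose2[OF _ c]) (auto intro: E)
next
  case (Suc k)
  have E: "(\<lambda>j. x j + a j) \<in> topspace (Euclidean_space N)" if "x \<in> topspace (Euclidean_space N)" for x
    using that assms by (auto simp: topspace_Euclidean_space)
  show ?case
  proof (rule C_k_SucI)
    show "continuous_map (Euclidean_space N) euclidean (\<lambda>x. f (\<lambda>j. x j + a j))"
      using Suc.IH[OF C_k_Suc_D[OF Suc.prems]] by (rule C_k_continuous)
    fix i assume i: "i < N"
    obtain f' where f': "C_k k N f'" "\<And>x. x \<in> topspace (Euclidean_space N) \<Longrightarrow>
       ((\<lambda>t. f (x(i := t))) has_vector_derivative f' x) (at (x i))"
      using C_k_SucE[OF Suc.prems i] by blast
    have d: "((\<lambda>t. f (\<lambda>j. (x(i := t)) j + a j)) has_vector_derivative f' (\<lambda>j. x j + a j)) (at (x i))"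
      if x: "x \<in> topspace (Euclidean_space N)" for x
    proof -
      have "((\<lambda>t. f ((\<lambda>j. x j + a j)(i := t))) has_vector_derivative f' (\<lambda>j. x j + a j)) (at (x i + a i))"
        using f'(2)[OF E[OF x]] by simp
      moreover have "((\<lambda>t. t + a i) has_vector_derivative 1) (at (x i))"
        by (auto intro!: derivative_eq_intros simp: has_real_derivative_iff_has_vector_derivative[symmetric])
      ultimately have "(((\<lambda>t. f ((\<lambda>j. x j + a j)(i := t))) \<circ> (\<lambda>t. t + a i)) has_vector_derivative
          1 *\<^sub>R f' (\<lambda>j. x j + a j)) (at (x i))"
        by (intro vector_diff_chain_at) auto
      moreover have "(\<lambda>t. f ((\<lambda>j. x j + a j)(i := t))) \<circ> (\<lambda>t. t + a i) = (\<lambda>t. f (\<lambda>j. (x(i := t)) j + a j))"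
        by (auto simp: fun_eq_iff intro!: arg_cong[of _ _ f])
      ultimately show ?thesis by simp
    qed
    show "\<exists>g. C_k k N g \<and> (\<forall>x\<in>topspace (Euclidean_space N).
           ((\<lambda>t. f (\<lambda>j. (x(i := t)) j + a j)) has_vector_derivative g x) (at (x i)))"
      by (rule exI[of _ "\<lambda>x. f' (\<lambda>j. x j + a j)"], rule conjI, rule Suc.IH[OF f'(1)], rule ballI, rule d)
  qed
qed

lemma C_k_sum: "(\<And>i. i \<in> A \<Longrightarrow> C_k k N (f i)) \<Longrightarrow> C_k k N (\<lambda>x. \<Sum>i\<in>A. f i x)"
  by (induction A rule: infinite_finite_induct) (auto intro: C_k_add C_k_const)

subsection \<open>Alternating forms\<close>

lemma alternating_formsD:
  assumes "\<alpha> \<in> alternating_forms k d" "x \<in> tuples k d"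
  shows "i < k \<Longrightarrow> v \<in> carrier_vec d \<Longrightarrow> w \<in> carrier_vec d \<Longrightarrow> \<alpha> (x(i := v + w)) = \<alpha> (x(i := v)) + \<alpha> (x(i := w))"
    and "i < k \<Longrightarrow> v \<in> carrier_vec d \<Longrightarrow> \<alpha> (x(i := c \<cdot>\<^sub>v v)) = c * \<alpha> (x(i := v))"
    and "i < k \<Longrightarrow> j < k \<Longrightarrow> i \<noteq> j \<Longrightarrow> x i = x j \<Longrightarrow> \<alpha> x = 0"
  using assms unfolding alternating_forms_def by auto

lemma tuples_upd: "x \<in> tuples k d \<Longrightarrow> i < k \<Longrightarrow> v \<in> carrier_vec d \<Longrightarrow> x(i := v) \<in> tuples k d"
  by (auto simp: tuples_def PiE_iff extensional_def)

lemma tuples_nth: "x \<in> tuples k d \<Longrightarrow> i < k \<Longrightarrow> x i \<in> carrier_vec d"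
  by (auto simp: tuples_def)

lemma tuples_restrict: "(\<And>i. i < k \<Longrightarrow> f i \<in> carrier_vec d) \<Longrightarrow> restrict f {..<k} \<in> tuples k d"
  by (auto simp: tuples_def)

lemma alternating_forms_lincomb:
  assumes "\<alpha> \<in> alternating_forms k d" "\<beta> \<in> alternating_forms k d"
  shows "(\<lambda>x\<in>tuples k d. a * \<alpha> x + b * \<beta> x) \<in> alternating_forms k d"
  unfolding alternating_forms_def
  using alternating_formsD[OF assms(1)] alternating_formsD[OF assms(2)]
  by (simp add: tuples_upd distrib_left mult.left_commute)

lemma alternating_form_expand:
  assumes \<alpha>: "\<alpha> \<in> alternating_forms k d" and y: "y \<in> tuples k d" and i: "i < k"
  shows "\<alpha> (y(i := Matrix.vec d g)) = (\<Sum>t<d. g t * \<alpha> (y(i := unit_vec d t)))"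
proof -
  have "\<alpha> (y(i := Matrix.vec d (\<lambda>t. if t < l then g t else 0))) = (\<Sum>t<l. g t * \<alpha> (y(i := unit_vec d t)))"
    if "l \<le> d" for l
    using that
  proof (induction l)
    case 0
    have z: "Matrix.vec d (\<lambda>t. if t < (0::nat) then g t else 0) = 0 \<cdot>\<^sub>v 0\<^sub>v d" by (rule eq_vecI) auto
    show ?case unfolding z alternating_formsD(2)[OF \<alpha> y i zero_carrier_vec] by simp
  next
    case (Suc l)
    have eq: "Matrix.vec d (\<lambda>t. if t < Suc l then g t else 0) =
        Matrix.vec d (\<lambda>t. if t < l then g t else 0) + g l \<cdot>\<^sub>v unit_vec d l"
      using Suc.prems by (intro eq_vecI) (auto simp: less_Suc_eq)
    have IH: "\<alpha> (y(i := Matrix.vec d (\<lambda>t. if t < l then g t else 0))) = (\<Sum>t<l. g t * \<alpha> (y(i := unit_vec d t)))"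
      by (rule Suc.IH) (use Suc.prems in simp)
    show ?case
      unfolding eq alternating_formsD(1)[OF \<alpha> y i vec_carrier smult_carrier_vec[THEN iffD2, OF unit_vec_carrier]]
        alternating_formsD(2)[OF \<alpha> y i unit_vec_carrier] IH sum.lessThan_Suc ..
  qed
  from this[of d] have "\<alpha> (y(i := Matrix.vec d (\<lambda>t. if t < d then g t else 0))) = (\<Sum>t<d. g t * \<alpha> (y(i := unit_vec d t)))"
    by simp
  moreover have "Matrix.vec d (\<lambda>t. if t < d then g t else 0) = Matrix.vec d g" by (rule eq_vecI) auto
  ultimately show ?thesis by (simp only:)
qed

lemma alternating_form_scale:
  assumes \<alpha>: "\<alpha> \<in> alternating_forms k d" and x: "x \<in> tuples k d"
  shows "\<alpha> (\<lambda>i\<in>{..<k}. c i \<cdot>\<^sub>v x i) = (\<Prod>i<k. c i) * \<alpha> x"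
proof -
  define T where "T l = (\<lambda>i\<in>{..<k}. if i < l then c i \<cdot>\<^sub>v x i else x i)" for l
  have T: "T l \<in> tuples k d" for l
    unfolding T_def by (rule tuples_restrict) (use x in \<open>auto simp: tuples_nth\<close>)
  have "\<alpha> (T l) = (\<Prod>i<l. c i) * \<alpha> x" if "l \<le> k" for l
    using that
  proof (induction l)
    case 0
    have "T 0 = x" using x by (auto simp: T_def tuples_def PiE_iff extensional_def fun_eq_iff)
    then show ?case by simp
  next
    case (Suc l)
    have u: "T (Suc l) = (T l)(l := c l \<cdot>\<^sub>v x l)" "(T l)(l := x l) = T l"
      using Suc.prems by (auto simp: T_def fun_eq_iff)
    have "\<alpha> ((T l)(l := c l \<cdot>\<^sub>v x l)) = c l * \<alpha> ((T l)(l := x l))"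
      by (rule alternating_formsD(2)[OF \<alpha> T]) (use Suc.prems tuples_nth[OF x, of l] in auto)
    then have "\<alpha> (T (Suc l)) = c l * \<alpha> (T l)" unfolding u .
    then show ?case using Suc by simp
  qed
  from this[of k] have "\<alpha> (T k) = (\<Prod>i<k. c i) * \<alpha> x" by simp
  moreover have "T k = (\<lambda>i\<in>{..<k}. c i \<cdot>\<^sub>v x i)" by (auto simp: T_def)
  ultimately show ?thesis by (simp only:)
qed

text \<open>The form is a polynomial in the entries of its arguments, which are expanded in the unit
  vectors one at a time.\<close>

lemma alternating_form_C_k:
  assumes \<alpha>: "\<alpha> \<in> alternating_forms k d"
    and g: "\<And>i t. i < k \<Longrightarrow> t < d \<Longrightarrow> C_k K N (g i t)"
  shows "C_k K N (\<lambda>x. \<alpha> (\<lambda>i\<in>{..<k}. Matrix.vec d (\<lambda>t. g i t x)))"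
proof -
  define T where "T l y x = (\<lambda>i\<in>{..<k}. if i < l then Matrix.vec d (\<lambda>t. g i t x) else y i)" for l y x
  have T: "T l y x \<in> tuples k d" if "y \<in> tuples k d" for l y x
    unfolding T_def by (rule tuples_restrict) (use that in \<open>auto simp: tuples_nth\<close>)
  have "C_k K N (\<lambda>x. \<alpha> (T l y x))" if "l \<le> k" "y \<in> tuples k d" for l y
    using that
  proof (induction l arbitrary: y)
    case 0
    have "T 0 y = (\<lambda>x. y)" using 0 by (auto simp: T_def tuples_def PiE_iff extensional_def fun_eq_iff)
    then show ?case by (simp add: C_k_const)
  next
    case (Suc l)
    have l: "l < k" using Suc.prems by simp
    have u1: "T (Suc l) y x = (T l y x)(l := Matrix.vec d (\<lambda>t. g l t x))"
      and u2: "(T l y x)(l := unit_vec d t) = T l (y(l := unit_vec d t)) x" for x t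
      using l by (auto simp: T_def fun_eq_iff)
    show ?case
      unfolding u1 alternating_form_expand[OF \<alpha> T[OF Suc.prems(2)] l] u2
    proof (intro C_k_sum C_k_mult)
      fix t assume "t \<in> {..<d}"
      then show "C_k K N (g l t)" using g l by simp
      show "C_k K N (\<lambda>x. \<alpha> (T l (y(l := unit_vec d t)) x))"
        by (rule Suc.IH) (use l in \<open>auto intro: tuples_upd[OF Suc.prems(2) l] simp del: fun_upd_apply\<close>)
    qed
  qed
  from this[of k "\<lambda>i\<in>{..<k}. 0\<^sub>v d"]
  have "C_k K N (\<lambda>x. \<alpha> (T k (\<lambda>i\<in>{..<k}. 0\<^sub>v d) x))" by (simp add: tuples_restrict)
  moreover have "T k (\<lambda>i\<in>{..<k}. 0\<^sub>v d) = (\<lambda>x. \<lambda>i\<in>{..<k}. Matrix.vec d (\<lambda>t. g i t x))"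
    by (auto simp: T_def fun_eq_iff)
  ultimately show ?thesis by simp
qed

text \<open>The form used to recognize a nonzero element of the top exterior power.\<close>

definition det_form :: "nat \<Rightarrow> (nat \<Rightarrow> complex vec) \<Rightarrow> complex" where
  "det_form r = (\<lambda>x\<in>tuples r r. Determinant.det (Matrix.mat r r (\<lambda>(i, t). x i $ t)))"

lemma det_form_alternating: "det_form r \<in> alternating_forms r r"
proof -
  let ?M = "\<lambda>x. Matrix.mat r r (\<lambda>(i, t). x i $ t) :: complex mat"
  have exp: "Determinant.det (?M (x(i := v))) = (\<Sum>t<r. v $ t * cofactor (?M x) i t)"
    if "i < r" for x i v
  proof -
    have "mat_delete (?M (x(i := v))) i t = mat_delete (?M x) i t" if "t < r" for t
      using that \<open>i < r\<close> by (auto simp: mat_delete_def)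
    then have "cofactor (?M (x(i := v))) i t = cofactor (?M x) i t" if "t < r" for t
      using that by (simp add: cofactor_def)
    then show ?thesis
      using laplace_expansion_row[of "?M (x(i := v))" r i] that by simp
  qed
  have df: "det_form r (x(i := v)) = (\<Sum>t<r. v $ t * cofactor (?M x) i t)"
    if "x \<in> tuples r r" "i < r" "v \<in> carrier_vec r" for x i v
    using exp[OF that(2)] tuples_upd[OF that] by (simp add: det_form_def)
  show ?thesis
    unfolding alternating_forms_def
  proof (intro CollectI conjI ballI allI impI)
    show "det_form r \<in> extensional (tuples r r)" by (simp add: det_form_def)
    fix x i assume xi: "x \<in> tuples r r" "i < r"
    show "det_form r (x(i := v + w)) = det_form r (x(i := v)) + det_form r (x(i := w))"
      if "v \<in> carrier_vec r" "w \<in> carrier_vec r" for v w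
      using that by (simp add: df[OF xi] distrib_right sum.distrib)
    show "det_form r (x(i := c \<cdot>\<^sub>v v)) = c * det_form r (x(i := v))" if "v \<in> carrier_vec r" for c v
      using that by (simp add: df[OF xi] sum_distrib_left mult.assoc)
    show "det_form r x = 0" if "j < r" "i \<noteq> j" "x i = x j" for j
      unfolding det_form_def using xi that
      by (simp add: det_identical_rows[of "?M x" r i j])
  qed
qed

lemma alternating_form_compose:
  assumes \<alpha>: "\<alpha> \<in> alternating_forms k d" and M: "M \<in> carrier_mat d d"
  shows "(\<lambda>x\<in>tuples k d. \<alpha> (\<lambda>i\<in>{..<k}. M *\<^sub>v x i)) \<in> alternating_forms k d"
proof -
  have t: "(\<lambda>i\<in>{..<k}. M *\<^sub>v x i) \<in> tuples k d" if "x \<in> tuples k d" for x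
    by (rule tuples_restrict) (use M in \<open>auto intro: mult_mat_vec_carrier tuples_nth[OF that]\<close>)
  have u: "(\<lambda>l\<in>{..<k}. M *\<^sub>v (x(i := v)) l) = (\<lambda>l\<in>{..<k}. M *\<^sub>v x l)(i := M *\<^sub>v v)" if "i < k" for x i v
    using that by (auto simp: fun_eq_iff)
  show ?thesis
    unfolding alternating_forms_def
  proof (intro CollectI conjI ballI allI impI)
    show "(\<lambda>x\<in>tuples k d. \<alpha> (\<lambda>i\<in>{..<k}. M *\<^sub>v x i)) \<in> extensional (tuples k d)" by simp
    fix x i assume xi: "x \<in> tuples k d" "i < k"
    let ?f = "\<lambda>x\<in>tuples k d. \<alpha> (\<lambda>i\<in>{..<k}. M *\<^sub>v x i)"
    have f: "?f (x(i := v)) = \<alpha> ((\<lambda>l\<in>{..<k}. M *\<^sub>v x l)(i := M *\<^sub>v v))" if "v \<in> carrier_vec d" for v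
      using tuples_upd[OF xi that] u[OF xi(2), of x v] by (simp del: fun_upd_apply)
    show "?f (x(i := v + w)) = ?f (x(i := v)) + ?f (x(i := w))" if "v \<in> carrier_vec d" "w \<in> carrier_vec d" for v w
      unfolding f[OF that(1)] f[OF that(2)] f[OF add_carrier_vec[OF that]] mult_add_distrib_mat_vec[OF M that]
      by (rule alternating_formsD(1)[OF \<alpha> t[OF xi(1)] xi(2)]) (use M that in auto)
    show "?f (x(i := c \<cdot>\<^sub>v v)) = c * ?f (x(i := v))" if "v \<in> carrier_vec d" for c v
      unfolding f[OF that] f[OF smult_carrier_vec[THEN iffD2, OF that]] mult_mat_vec[OF M that]
      by (rule alternating_formsD(2)[OF \<alpha> t[OF xi(1)] xi(2)]) (use M that in auto)
    show "?f x = 0" if "j < k" "i \<noteq> j" "x i = x j" for j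
      using alternating_formsD(3)[OF \<alpha> t[OF xi(1)] xi(2) that(1,2)] that xi by simp
  qed
qed

subsection \<open>The bundle maps\<close>

text \<open>A discontinuous choice of preimages under the covering. The bundle map and the section
  feed it only into expressions that are invariant under lattice translations.\<close>

definition lift :: "nat \<Rightarrow> torus_pt \<Rightarrow> nat \<Rightarrow> real" where
  "lift m \<theta> = (\<lambda>j. if j < m then Arg (\<theta> j) else 0)"

lemma torus_cover_lift:
  assumes "\<theta> \<in> torus m"
  shows "torus_cover m (lift m \<theta>) = \<theta>"
proof (rule ext)
  fix j
  have "cis (Arg (\<theta> j)) = \<theta> j" if "j < m"
  proof -
    have "norm (\<theta> j) = 1" using PiE_mem[of \<theta> "{..<m}" "\<lambda>_. sphere 0 1" j] assms that by (simp add: torus_def)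
    then have "\<theta> j \<noteq> 0" by auto
    then show ?thesis using cis_Arg[of "\<theta> j"] \<open>norm (\<theta> j) = 1\<close> by (simp add: sgn_eq)
  qed
  then show "torus_cover m (lift m \<theta>) j = \<theta> j"
    using assms by (auto simp: torus_cover_def lift_def torus_def PiE_iff extensional_def)
qed

lemma torus_cover_in_torus: "torus_cover m x \<in> torus m"
  by (auto simp: torus_cover_def torus_def)

lemma trunc_lift: "trunc m (lift m \<theta>) = lift m \<theta>"
  by (auto simp: trunc_def lift_def)

lemma torus_cover_eq_pshift:
  assumes "torus_cover (2 * n) x = torus_cover (2 * n) y"
  shows "\<exists>c. trunc (2 * n) x = pshift n (trunc (2 * n) y) c"
proof -
  have "\<exists>m :: int. x j = y j + 2 * pi * of_int m" if "j < 2 * n" for j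
  proof -
    have "cis (x j) = cis (y j)"
      using fun_cong[OF assms, of j] that by (simp add: torus_cover_def)
    then have "cos (x j) = cos (y j)" "sin (x j) = sin (y j)" by (simp_all add: complex_eq_iff)
    then show ?thesis by (metis sin_cos_eq_iff mult.assoc mult.commute)
  qed
  then have "\<forall>j. \<exists>m :: int. j < 2 * n \<longrightarrow> x j = y j + 2 * pi * of_int m" by blast
  from choice[OF this] obtain c :: "nat \<Rightarrow> int" where "\<forall>j. j < 2 * n \<longrightarrow> x j = y j + 2 * pi * of_int (c j)" by blast
  then have "trunc (2 * n) x = pshift n (trunc (2 * n) y) c"
    by (auto simp: trunc_def pshift_def)
  then show ?thesis by (rule exI[of _ c])
qed

context heis_bundle
begin

abbreviation "E \<equiv> total_space (2 * n) r"

definition rot :: "(nat \<Rightarrow> int) \<Rightarrow> torus_pt \<Rightarrow> torus_pt" where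
  "rot q \<theta> = (\<lambda>j\<in>{..<2 * n}. cis (2 * pi * of_int (q j) / of_nat p) * \<theta> j)"

definition B :: "(nat \<Rightarrow> int) \<Rightarrow> int \<Rightarrow> vb_pt \<Rightarrow> vb_pt" where
  "B q w = (\<lambda>e\<in>E. (rot q (fst e), A q w (lift (2 * n) (fst e)) *\<^sub>v snd e))"

text \<open>The central coordinate of the inverse of (q, w) in the Heisenberg group.\<close>

definition winv :: "(nat \<Rightarrow> int) \<Rightarrow> int \<Rightarrow> int" where
  "winv q w = heis_cocycle n q q - w"

lemma rot_cover: "rot q (torus_cover (2 * n) x) = torus_cover (2 * n) (sh q x)"
  by (auto simp: rot_def torus_cover_def sh_def cis_mult add.commute)

lemma rot_torus: "\<theta> \<in> torus (2 * n) \<Longrightarrow> rot q \<theta> \<in> torus (2 * n)"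
  using rot_cover[of q "lift (2 * n) \<theta>"] torus_cover_lift[of \<theta> "2 * n"] torus_cover_in_torus by metis

lemma rot_add: "rot q (rot q' \<theta>) = rot (q + q') \<theta>"
proof (rule ext)
  fix j
  have "cis (2 * pi * of_int (q j) / of_nat p) * cis (2 * pi * of_int (q' j) / of_nat p)
    = cis (2 * pi * of_int (q j + q' j) / of_nat p)"
    by (simp add: cis_mult distrib_left add_divide_distrib)
  then show "rot q (rot q' \<theta>) j = rot (q + q') \<theta> j"
    by (simp add: rot_def mult.assoc[symmetric])
qed

lemma rot_mod: "rot (\<lambda>j. q j + int p * c j) \<theta> = rot q \<theta>"
proof (rule ext)
  fix j
  have "2 * pi * of_int (q j + int p * c j) / of_nat p = 2 * pi * of_int (q j) / of_nat p + 2 * pi * of_int (c j)"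
    using pnz by (simp add: field_simps)
  then have "cis (2 * pi * of_int (q j + int p * c j) / of_nat p) = cis (2 * pi * of_int (q j) / of_nat p)"
    by (simp only: cis_add_2pi_int)
  then show "rot (\<lambda>j. q j + int p * c j) \<theta> j = rot q \<theta> j"
    unfolding rot_def restrict_def by (simp only:)
qed

lemma rot_0: "\<theta> \<in> torus (2 * n) \<Longrightarrow> rot 0 \<theta> = \<theta>"
  by (auto simp: rot_def torus_def PiE_iff extensional_def)

lemma A_cover:
  assumes "torus_cover (2 * n) x = torus_cover (2 * n) y"
  shows "A q w (trunc (2 * n) x) = A q w (trunc (2 * n) y)"
  using torus_cover_eq_pshift[OF assms] A_pshift by metis

lemma A_lift_cover: "A q w (lift (2 * n) (torus_cover (2 * n) x)) = A q w (trunc (2 * n) x)"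
  using A_cover[of "lift (2 * n) (torus_cover (2 * n) x)" x q w] torus_cover_lift[OF torus_cover_in_torus]
  by (simp add: trunc_lift)

lemma trunc_sh: "trunc (2 * n) (sh q x) = sh q (trunc (2 * n) x)"
  by (auto simp: trunc_def sh_def)

lemma A_lift_rot:
  assumes "\<theta> \<in> torus (2 * n)"
  shows "A q w (lift (2 * n) (rot q' \<theta>)) = A q w (sh q' (lift (2 * n) \<theta>))"
proof -
  have "rot q' \<theta> = torus_cover (2 * n) (sh q' (lift (2 * n) \<theta>))"
    using rot_cover[of q' "lift (2 * n) \<theta>"] torus_cover_lift[OF assms] by simp
  then show ?thesis by (simp add: A_lift_cover trunc_sh trunc_lift)
qed

lemma E_iff: "e \<in> E \<longleftrightarrow> fst e \<in> torus (2 * n) \<and> snd e \<in> carrier_vec r"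
  by (auto simp: total_space_def mem_Times_iff)

lemma B_in: "e \<in> E \<Longrightarrow> B q w e \<in> E"
  using mult_mat_vec_carrier[OF A_carrier] by (auto simp: B_def E_iff rot_torus)

lemma B_mult:
  assumes "e \<in> E"
  shows "B q w (B q' w' e) = B (q + q') (w + w' + heis_cocycle n q q') e"
proof -
  let ?x = "lift (2 * n) (fst e)"
  have e: "fst e \<in> torus (2 * n)" "snd e \<in> carrier_vec r" using assms by (auto simp: E_iff)
  have "A q w (sh q' ?x) *\<^sub>v (A q' w' ?x *\<^sub>v snd e) = A (q + q') (w + w' + heis_cocycle n q q') ?x *\<^sub>v snd e"
    unfolding A_mult[symmetric] by (rule assoc_mult_mat_vec[OF A_carrier A_carrier e(2), symmetric])
  moreover have "B q' w' e = (rot q' (fst e), A q' w' ?x *\<^sub>v snd e)" using assms by (simp add: B_def)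
  ultimately show ?thesis
    using assms B_in[OF assms, of q' w'] e by (simp add: B_def A_lift_rot rot_add)
qed

lemma B_0: "e \<in> E \<Longrightarrow> B 0 0 e = e"
  by (auto simp: B_def E_iff rot_0 A_zero prod_eq_iff)

lemma B_mod: "B (\<lambda>j. q j + int p * c j) (w + int p * w') = B q w"
  by (simp add: B_def rot_mod A_mod)

lemma B_inv:
  assumes "e \<in> E"
  shows "B (- q) (winv q w) (B q w e) = e" "B q w (B (- q) (winv q w) e) = e"
  using B_0[OF assms] by (simp_all add: B_mult[OF assms] winv_def heis_cocycle_minus)

lemma B_bij: "bij_betw (B q w) E E"
  by (rule bij_betw_byWitness[where f' = "B (- q) (winv q w)"]) (auto simp: B_inv B_in)

lemma inv_into_B:
  assumes "e \<in> E"
  shows "inv_into E (B q w) e = B (- q) (winv q w) e"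
  by (rule inv_into_f_eq[OF bij_betw_imp_inj_on[OF B_bij] B_in[OF assms] B_inv(2)[OF assms]])

lemma rot_bij: "bij_betw (rot q) (torus (2 * n)) (torus (2 * n))"
  by (rule bij_betw_byWitness[where f' = "rot (- q)"]) (auto simp: rot_add rot_0 rot_torus)

lemma C_k_phase: "C_k k N (\<lambda>x. cis (phase q w s x))"
proof -
  have "C_k k N (\<lambda>x. cis ((\<Sum>i<l. of_int (d s i * q (2 * i + 1)) * x (2 * i)) + b))" for l b
  proof (induction l)
    case 0
    then show ?case by (simp add: C_k_const)
  next
    case (Suc l)
    have "cis ((\<Sum>i<Suc l. of_int (d s i * q (2 * i + 1)) * x (2 * i)) + b) =
      cis ((\<Sum>i<l. of_int (d s i * q (2 * i + 1)) * x (2 * i)) + b) * cis (of_int (d s l * q (2 * l + 1)) * x (2 * l))" for x :: "nat \<Rightarrow> real"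
      by (simp add: cis_mult algebra_simps)
    then show ?case by (simp only:) (intro C_k_mult Suc C_k_cis)
  qed
  then show ?thesis unfolding phase_def by blast
qed

lemma C_k_A:
  assumes N: "N \<ge> 2 * n" and tu: "t < r" "u < r"
  shows "C_k k N (\<lambda>x. A q w (trunc (2 * n) x) $$ (t, u))"
proof -
  have ph: "phase q w s (trunc (2 * n) x) = phase q w s x" for s x
    by (simp add: phase_def trunc_def)
  define a where "a j = (if j < 2 * n then 2 * pi * of_int (q j) / of_nat p else 0)" for j
  have shx: "sh q (trunc (2 * n) x) = trunc (2 * n) (\<lambda>j. x j + a j)" for x
    by (auto simp: sh_def trunc_def a_def)
  have "A q w (trunc (2 * n) x) $$ (t, u) =
    (\<Sum>s\<in>{0..<r}. G (trunc (2 * n) (\<lambda>j. x j + a j)) $$ (t, s) * cis (phase q w s x) * F (trunc (2 * n) x) $$ (s, u))" for x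
    using tu Fc[of "trunc (2 * n) x"] Gc[of "trunc (2 * n) (\<lambda>j. x j + a j)"]
    by (simp add: A_def shx mat_diag_mult_right[OF Gc] scalar_prod_def ph)
  moreover have "C_k k N (\<lambda>x. G (trunc (2 * n) (\<lambda>j. x j + a j)) $$ (t, s))" if "s < r" for s
  proof -
    have "smooth (\<lambda>x. G (trunc (2 * n) x) $$ (t, s))"
      using qper_smooth[OF qG[OF that tu(1)]] by (rule smooth_trunc)
    then show ?thesis
      using C_k_translate[of N a k "\<lambda>x. G (trunc (2 * n) x) $$ (t, s)"] N by (auto simp: smooth_iff a_def)
  qed
  moreover have "C_k k N (\<lambda>x. F (trunc (2 * n) x) $$ (s, u))" if "s < r" for s
    using smooth_trunc[OF qper_smooth[OF qF[OF that tu(2)]]] by (simp add: smooth_iff)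
  ultimately show ?thesis
    by (simp only:) (intro C_k_sum C_k_mult C_k_phase, auto)
qed

lemma bundle_cover_E: "bundle_cover (2 * n) r x \<in> E"
  by (auto simp: bundle_cover_def total_space_def torus_cover_in_torus)

lemma B_smooth: "smooth_bundle_map (2 * n) r (B q w)"
  unfolding smooth_bundle_map_def smooth_fun_bundle_def C_infinity_def
proof (intro conjI allI impI)
  fix j k assume j: "j < 2 * n"
  have "(\<lambda>x. fst (B q w (bundle_cover (2 * n) r x)) j) =
      (\<lambda>x. cis (2 * pi * of_int (q j) / of_nat p) * cis (1 * x j))"
    using j bundle_cover_E by (simp add: B_def rot_def bundle_cover_def torus_cover_def)
  then show "C_k k (2 * n + 2 * r) (\<lambda>x. fst (B q w (bundle_cover (2 * n) r x)) j)"
    by (simp only:) (intro C_k_mult C_k_const C_k_cis)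
next
  fix t k assume t: "t < r"
  have "snd (B q w (bundle_cover (2 * n) r x)) $ t =
      (\<Sum>u\<in>{0..<r}. A q w (trunc (2 * n) x) $$ (t, u) *
        (of_real (x (2 * n + 2 * u)) + \<i> * of_real (x (2 * n + 2 * u + 1))))" for x
  proof -
    have "snd (B q w (bundle_cover (2 * n) r x)) =
      A q w (trunc (2 * n) x) *\<^sub>v Matrix.vec r (\<lambda>k. Complex (x (2 * n + 2 * k)) (x (2 * n + 2 * k + 1)))"
      using bundle_cover_E[of x] by (simp add: B_def bundle_cover_def A_lift_cover)
    then show ?thesis
      using t A_carrier[of q w "trunc (2 * n) x"] by (simp add: scalar_prod_def Complex_eq)
  qed
  then show "C_k k (2 * n + 2 * r) (\<lambda>x. snd (B q w (bundle_cover (2 * n) r x)) $ t)"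
    by (simp only:) (intro C_k_sum C_k_mult C_k_add C_k_const C_k_coord C_k_A, use t in auto)
qed

lemma rot_smooth: "smooth_torus_map (2 * n) (rot q)"
  unfolding smooth_torus_map_def smooth_fun_torus_def C_infinity_def
proof (intro allI impI)
  fix j k assume j: "j < 2 * n"
  then have "(\<lambda>x. rot q (torus_cover (2 * n) x) j) = (\<lambda>x. cis (2 * pi * of_int (q j) / of_nat p) * cis (1 * x j))"
    by (simp add: rot_def torus_cover_def)
  then show "C_k k (2 * n) (\<lambda>x. rot q (torus_cover (2 * n) x) j)"
    by (simp only:) (intro C_k_mult C_k_const C_k_cis)
qed

lemma smooth_torus_map_cong:
  assumes "\<And>\<theta>. \<theta> \<in> torus m \<Longrightarrow> f \<theta> = g \<theta>"
  shows "smooth_torus_map m f \<longleftrightarrow> smooth_torus_map m g"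
  using assms[OF torus_cover_in_torus] by (simp add: smooth_torus_map_def smooth_fun_torus_def)

lemma base_map_B: "\<theta> \<in> torus (2 * n) \<Longrightarrow> base_map r (B q w) \<theta> = rot q \<theta>"
  by (simp add: base_map_def B_def E_iff)

lemma fibre_map_B: "\<theta> \<in> torus (2 * n) \<Longrightarrow> v \<in> carrier_vec r \<Longrightarrow> fibre_map (B q w) \<theta> v = A q w (lift (2 * n) \<theta>) *\<^sub>v v"
  by (simp add: fibre_map_def B_def E_iff)

lemma A_inverse:
  "A (- q) (winv q w) (sh q x) * A q w x = 1\<^sub>m r" "A q w x * A (- q) (winv q w) (sh q x) = 1\<^sub>m r"
proof -
  show 1: "A (- q) (winv q w) (sh q x) * A q w x = 1\<^sub>m r"
    unfolding A_mult by (simp add: winv_def heis_cocycle_minus A_zero)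
  show "A q w x * A (- q) (winv q w) (sh q x) = 1\<^sub>m r"
    by (rule mat_mult_left_right_inverse[OF A_carrier A_carrier 1])
qed

lemma B_automorphism: "bundle_automorphism (2 * n) r (B q w)"
  unfolding bundle_automorphism_def
proof (intro conjI ballI)
  show "bundle_diffeo (2 * n) r (B q w)"
    unfolding bundle_diffeo_def
  proof (intro conjI B_bij B_smooth)
    show "smooth_bundle_map (2 * n) r (inv_into E (B q w))"
      using B_smooth[of "- q" "winv q w"]
      by (simp add: smooth_bundle_map_def smooth_fun_bundle_def inv_into_B[OF bundle_cover_E])
  qed
  show "torus_diffeo (2 * n) (base_map r (B q w))"
    unfolding torus_diffeo_def
  proof (intro conjI)
    show bij: "bij_betw (base_map r (B q w)) (torus (2 * n)) (torus (2 * n))"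
      using rot_bij[of q] by (simp cong: bij_betw_cong add: base_map_B)
    show "smooth_torus_map (2 * n) (base_map r (B q w))"
      using rot_smooth[of q] smooth_torus_map_cong[of "2 * n" "base_map r (B q w)" "rot q"] base_map_B by blast
    have "inv_into (torus (2 * n)) (base_map r (B q w)) \<theta> = rot (- q) \<theta>" if "\<theta> \<in> torus (2 * n)" for \<theta>
      by (rule inv_into_f_eq[OF bij_betw_imp_inj_on[OF bij] rot_torus[OF that]])
         (simp add: base_map_B rot_torus[OF that] rot_add rot_0[OF that])
    then show "smooth_torus_map (2 * n) (inv_into (torus (2 * n)) (base_map r (B q w)))"
      using rot_smooth[of "- q"] smooth_torus_map_cong by blast
  qed
  show "fst (B q w (\<theta>, v)) = base_map r (B q w) \<theta>" if "\<theta> \<in> torus (2 * n)" "v \<in> carrier_vec r" for \<theta> v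
    using that by (simp add: base_map_B) (simp add: B_def E_iff)
  fix \<theta> assume \<theta>: "\<theta> \<in> torus (2 * n)"
  let ?x = "lift (2 * n) \<theta>"
  let ?M = "A q w ?x" and ?M' = "A (- q) (winv q w) (sh q ?x)"
  show "linear_iso r (fibre_map (B q w) \<theta>)"
    unfolding linear_iso_def
  proof (intro conjI ballI allI)
    have "bij_betw (\<lambda>v. ?M *\<^sub>v v) (carrier_vec r) (carrier_vec r)"
      by (rule bij_betw_byWitness[where f' = "\<lambda>v. ?M' *\<^sub>v v"])
         (auto simp: A_inverse assoc_mult_mat_vec[OF A_carrier A_carrier, symmetric]
           intro!: mult_mat_vec_carrier[OF A_carrier])
    then show "bij_betw (fibre_map (B q w) \<theta>) (carrier_vec r) (carrier_vec r)"
      by (simp cong: bij_betw_cong add: fibre_map_B[OF \<theta>])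
    show "fibre_map (B q w) \<theta> (v + v') = fibre_map (B q w) \<theta> v + fibre_map (B q w) \<theta> v'"
      if "v \<in> carrier_vec r" "v' \<in> carrier_vec r" for v v'
      using that by (simp add: fibre_map_B[OF \<theta>] mult_add_distrib_mat_vec[OF A_carrier])
    show "fibre_map (B q w) \<theta> (c \<cdot>\<^sub>v v) = c \<cdot>\<^sub>v fibre_map (B q w) \<theta> v" if "v \<in> carrier_vec r" for c v
      using that by (simp add: fibre_map_B[OF \<theta>] mult_mat_vec[OF A_carrier])
  qed
qed

subsection \<open>The invariant section\<close>

text \<open>The columns of \<open>G\<close> are the frames of the line bundles, on the covering,
  read in the trivialization. The section \<open>sect\<close> is their wedge product, a decomposable
  element being given by evaluation at a tuple.\<close>

definition cols :: "(nat \<Rightarrow> real) \<Rightarrow> nat \<Rightarrow> complex vec" where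
  "cols x = (\<lambda>i\<in>{..<r}. Matrix.vec r (\<lambda>t. G x $$ (t, i)))"

definition sect :: "torus_pt \<Rightarrow> ext_elem" where
  "sect \<theta> = (\<lambda>\<alpha>\<in>alternating_forms r r. \<alpha> (cols (lift (2 * n) \<theta>)))"

lemma cols_tuples: "cols x \<in> tuples r r"
  unfolding cols_def by (rule tuples_restrict) auto

text \<open>Lattice translations multiply the columns by phases whose product is 1, because the
  degrees of the summands add up to 0 on each factor.\<close>

lemma alt_cols_pshift:
  assumes "\<alpha> \<in> alternating_forms r r"
  shows "\<alpha> (cols (pshift n x c)) = \<alpha> (cols x)"
proof -
  have "cols (pshift n x c) = (\<lambda>i\<in>{..<r}. cis (- twist i c x) \<cdot>\<^sub>v cols x i)"
    unfolding cols_def G_pshift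
    by (rule restrict_ext, rule eq_vecI) (auto simp: mat_diag_mult_right[OF Gc])
  then have "\<alpha> (cols (pshift n x c)) = (\<Prod>i<r. cis (- twist i c x)) * \<alpha> (cols x)"
    by (simp add: alternating_form_scale[OF assms cols_tuples])
  also have "(\<Prod>i<r. cis (- twist i c x)) = cis (\<Sum>i<r. - twist i c x)"
    by (induction r) (auto simp: cis_mult add.commute)
  also have "(\<Sum>i<r. twist i c x) = 0"
  proof -
    have "(\<Sum>s<r. twist s c x) = (\<Sum>i<n. \<Sum>s<r. of_int (int p * d s i * c (2 * i + 1)) * x (2 * i))"
      unfolding twist_def by (rule sum.swap)
    also have "\<dots> = (\<Sum>i<n. of_int (int p * (\<Sum>s<r. d s i) * c (2 * i + 1)) * x (2 * i))"
      by (simp add: sum_distrib_left sum_distrib_right mult.assoc)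
    also have "\<dots> = 0" by (simp add: dsum)
    finally show ?thesis .
  qed
  then have "cis (\<Sum>i<r. - twist i c x) = 1" by (simp add: sum_negf)
  finally show ?thesis by simp
qed

lemma alt_cols_cover:
  assumes "\<alpha> \<in> alternating_forms r r"
  shows "\<alpha> (cols (lift (2 * n) (torus_cover (2 * n) x))) = \<alpha> (cols (trunc (2 * n) x))"
proof -
  have "torus_cover (2 * n) (lift (2 * n) (torus_cover (2 * n) x)) = torus_cover (2 * n) x"
    by (rule torus_cover_lift[OF torus_cover_in_torus])
  from torus_cover_eq_pshift[OF this] show ?thesis
    using alt_cols_pshift[OF assms] by (auto simp: trunc_lift)
qed

lemma sect_det_section: "det_section (2 * n) r sect"
  unfolding det_section_def
proof (intro conjI ballI)
  show "sect \<in> torus (2 * n) \<rightarrow> ext_power r r"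
    by (auto simp: ext_power_def sect_def alternating_forms_lincomb cols_tuples)
  fix \<alpha> assume \<alpha>: "\<alpha> \<in> alternating_forms r r"
  have "C_k k (2 * n) (\<lambda>x. \<alpha> (cols (trunc (2 * n) x)))" for k
    unfolding cols_def
  proof (rule alternating_form_C_k[OF \<alpha>])
    fix i t assume "i < r" "t < r"
    then show "C_k k (2 * n) (\<lambda>x. G (trunc (2 * n) x) $$ (t, i))"
      using smooth_trunc[OF qper_smooth[OF qG]] by (simp add: smooth_iff)
  qed
  then show "smooth_fun_torus (2 * n) (\<lambda>\<theta>. sect \<theta> \<alpha>)"
    using \<alpha> by (simp add: smooth_fun_torus_def sect_def alt_cols_cover C_infinity_def)
qed

lemma sect_nowhere_vanishing: "nowhere_vanishing (2 * n) r sect"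
  unfolding nowhere_vanishing_def
proof
  fix \<theta> assume "\<theta> \<in> torus (2 * n)"
  let ?x = "lift (2 * n) \<theta>"
  have "Matrix.mat r r (\<lambda>(i, t). cols ?x i $ t) = (G ?x)\<^sup>T"
    by (rule eq_matI) (use Gc[of ?x] in \<open>auto simp: cols_def\<close>)
  then have "det_form r (cols ?x) = Determinant.det (G ?x)"
    using cols_tuples[of ?x] by (simp add: det_form_def det_transpose[OF Gc])
  moreover have "Determinant.det (F ?x) * Determinant.det (G ?x) = 1"
    using det_mult[OF Fc[of ?x] Gc[of ?x]] by (simp add: FG)
  ultimately have "sect \<theta> (det_form r) \<noteq> ext_zero r r (det_form r)"
    by (auto simp: sect_def ext_zero_def det_form_alternating)
  then show "sect \<theta> \<noteq> ext_zero r r" by auto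
qed

text \<open>This is the determinant of the lift in the line bundle frames. Its dependence on x
  disappears because the degrees add up to 0 on each factor; for the same reason the sum of the
  \<kappa> s is divisible by p, so the central part is an integral multiple of 2 pi.\<close>

lemma phase_prod: "(\<Prod>s<r. cis (phase q w s x)) = 1"
proof -
  \<comment> \<open>The characters are compared with the degrees on one factor, say 0, which exists
    by n >= 1.\<close>
  have "[(\<Sum>s<r. \<kappa> s) = (\<Sum>s<r. d s 0)] (mod int p)"
    by (rule cong_sum, rule cong_sym, rule dk) (use n1 in auto)
  then have "int p dvd (\<Sum>s<r. \<kappa> s)"
    using dsum[of 0] n1 by (simp add: cong_0_iff)
  then obtain e where e: "(\<Sum>s<r. \<kappa> s) = int p * e" by (elim dvdE)
  have "(\<Prod>s<r. cis (phase q w s x)) = cis (\<Sum>s<r. phase q w s x)"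
    by (induction r) (auto simp: cis_mult add.commute)
  also have "(\<Sum>s<r. phase q w s x) = (\<Sum>s<r. \<Sum>i<n. of_int (d s i * q (2 * i + 1)) * x (2 * i)) +
      2 * pi * of_int ((\<Sum>s<r. \<kappa> s) * w) / of_nat p"
    by (simp add: phase_def sum.distrib sum_distrib_left sum_distrib_right sum_divide_distrib)
  also have "(\<Sum>s<r. \<Sum>i<n. of_int (d s i * q (2 * i + 1)) * x (2 * i)) = 0"
  proof -
    have "(\<Sum>s<r. \<Sum>i<n. of_int (d s i * q (2 * i + 1)) * x (2 * i)) =
        (\<Sum>i<n. \<Sum>s<r. of_int (d s i * q (2 * i + 1)) * x (2 * i))"
      by (rule sum.swap)
    also have "\<dots> = (\<Sum>i<n. of_int ((\<Sum>s<r. d s i) * q (2 * i + 1)) * x (2 * i))"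
      by (simp add: sum_distrib_right)
    also have "\<dots> = 0" by (simp add: dsum)
    finally show ?thesis .
  qed
  also have "cis (0 + 2 * pi * of_int ((\<Sum>s<r. \<kappa> s) * w) / of_nat p) = cis (2 * pi * of_int (e * w))"
    using pnz by (simp add: e mult_ac)
  finally show ?thesis by (simp only: cis_2pi_int)
qed

text \<open>\<open>A\<close> carries the columns of \<open>G\<close> to those at the translated
  point, each multiplied by the phase of its summand, and the product of these phases is 1.\<close>

lemma sect_invariant:
  assumes \<theta>: "\<theta> \<in> torus (2 * n)"
  shows "det_map r (B q w) (\<theta>, sect \<theta>) = (base_map r (B q w) \<theta>, sect (base_map r (B q w) \<theta>))"
proof -
  let ?x = "lift (2 * n) \<theta>"
  let ?M = "A q w ?x"
  have rot: "rot q \<theta> = torus_cover (2 * n) (sh q ?x)"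
    using rot_cover[of q ?x] torus_cover_lift[OF \<theta>] by simp
  have "ext_map r r (fibre_map (B q w) \<theta>) (sect \<theta>) \<alpha> = sect (rot q \<theta>) \<alpha>" if \<alpha>: "\<alpha> \<in> alternating_forms r r" for \<alpha>
  proof -
    have eq: "(\<lambda>x\<in>tuples r r. \<alpha> (\<lambda>i\<in>{..<r}. fibre_map (B q w) \<theta> (x i))) = (\<lambda>x\<in>tuples r r. \<alpha> (\<lambda>i\<in>{..<r}. ?M *\<^sub>v x i))"
      by (rule restrict_ext, rule arg_cong[of _ _ \<alpha>], rule restrict_ext)
         (simp add: fibre_map_B[OF \<theta>] tuples_nth)
    have "ext_map r r (fibre_map (B q w) \<theta>) (sect \<theta>) \<alpha> = \<alpha> (\<lambda>i\<in>{..<r}. ?M *\<^sub>v cols ?x i)"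
      using \<alpha> alternating_form_compose[OF \<alpha> A_carrier] cols_tuples
      by (simp add: ext_map_def eq sect_def)
    also have "(\<lambda>i\<in>{..<r}. ?M *\<^sub>v cols ?x i) = (\<lambda>i\<in>{..<r}. cis (phase q w i ?x) \<cdot>\<^sub>v cols (sh q ?x) i)"
    proof (rule restrict_ext)
      fix i assume "i \<in> {..<r}"
      then have i: "i < r" by simp
      have ci: "cols y i = col (G y) i" for y
        using i Gc[of y] by (intro eq_vecI) (auto simp: cols_def)
      have "?M * G ?x = G (sh q ?x) * mat_diag r (\<lambda>s. cis (phase q w s ?x)) * (F ?x * G ?x)"
        unfolding A_def by (rule assoc_mult_mat[OF mult_carrier_mat[OF Gc mat_diag_carrier] Fc Gc])
      also have "\<dots> = G (sh q ?x) * mat_diag r (\<lambda>s. cis (phase q w s ?x))"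
        unfolding FG by (rule right_mult_one_mat[OF mult_carrier_mat[OF Gc mat_diag_carrier]])
      finally have MG: "?M * G ?x = G (sh q ?x) * mat_diag r (\<lambda>s. cis (phase q w s ?x))" .
      have "?M *\<^sub>v cols ?x i = col (?M * G ?x) i"
        unfolding ci using i Gc[of ?x] A_carrier[of q w ?x] by (simp add: col_mult2)
      also have "\<dots> = cis (phase q w i ?x) \<cdot>\<^sub>v cols (sh q ?x) i"
        unfolding MG ci using i Gc[of "sh q ?x"]
        by (intro eq_vecI) (auto simp: mat_diag_mult_right[OF Gc] mult.commute)
      finally show "?M *\<^sub>v cols ?x i = cis (phase q w i ?x) \<cdot>\<^sub>v cols (sh q ?x) i" .
    qed
    also have "\<alpha> \<dots> = \<alpha> (cols (sh q ?x))"
      by (simp add: alternating_form_scale[OF \<alpha> cols_tuples] phase_prod)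
    also have "\<dots> = sect (rot q \<theta>) \<alpha>"
      using \<alpha> by (simp add: sect_def rot alt_cols_cover trunc_sh trunc_lift)
    finally show ?thesis .
  qed
  then have "ext_map r r (fibre_map (B q w) \<theta>) (sect \<theta>) = sect (rot q \<theta>)"
    by (intro ext) (auto simp: ext_map_def sect_def)
  then show ?thesis using \<theta> by (simp add: det_map_def base_map_B)
qed

text \<open>The action on the base forces q to vanish modulo p on the first 2 n places, and one may
  pass to a q that is 0 there. Then the lift is conjugate, by \<open>F\<close>, to the diagonal
  matrix of the central characters, and a summand with \<kappa> s = 1 forces w to vanish modulo
  p.\<close>

lemma B_trivial:
  assumes "\<And>e. e \<in> E \<Longrightarrow> B q w e = e"
  shows "j < 2 * n \<Longrightarrow> int p dvd q j" "int p dvd w"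
proof -
  let ?\<theta> = "torus_cover (2 * n) (\<lambda>j. 0)"
  have \<theta>: "?\<theta> \<in> torus (2 * n)" by (rule torus_cover_in_torus)
  have cis1: "int p dvd a" if "cis (2 * pi * of_int a / of_nat p) = 1" for a
  proof -
    have "cos (2 * pi * of_int a / of_nat p) = 1"
      using arg_cong[OF that, of Re] by (simp only: cis.sel one_complex.sel)
    then obtain m :: int where "2 * pi * of_int a / of_nat p = of_int m * 2 * pi"
      unfolding cos_one_2pi_int by (rule exE)
    then have "of_int a = (of_int (int p * m) :: real)" using pnz by (simp add: field_simps)
    then have "a = int p * m" by (simp only: of_int_eq_iff)
    then show ?thesis by simp
  qed
  show q: "int p dvd q j" if "j < 2 * n" for j
  proof (rule cis1)
    have "rot q ?\<theta> = ?\<theta>" using assms[of "(?\<theta>, 0\<^sub>v r)"] \<theta> by (simp add: B_def E_iff)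
    from fun_cong[OF this, of j] that show "cis (2 * pi * of_int (q j) / of_nat p) = 1"
      by (simp add: rot_def torus_cover_def)
  qed
  then have "\<forall>j. \<exists>c. j < 2 * n \<longrightarrow> q j = int p * c" by (auto elim: dvdE)
  from choice[OF this] obtain c where c: "\<And>j. j < 2 * n \<Longrightarrow> q j = int p * c j" by blast
  define q0 where "q0 j = q j - int p * c j" for j
  have q0: "q0 j = 0" if "j < 2 * n" for j using c[OF that] by (simp add: q0_def)
  have "B q w = B q0 w"
    using B_mod[of q0 c w 0] by (simp add: q0_def)
  have fx: "A q0 w (lift (2 * n) ?\<theta>) *\<^sub>v v = v" if "v \<in> carrier_vec r" for v
    using assms[of "(?\<theta>, v)"] \<theta> that unfolding \<open>B q w = B q0 w\<close> by (simp add: B_def E_iff)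
  let ?x = "lift (2 * n) ?\<theta>"
  let ?D = "mat_diag r (\<lambda>s. cis (2 * pi * of_int (\<kappa> s * w) / of_nat p))"
  have A0: "A q0 w ?x = G ?x * ?D * F ?x"
  proof -
    have "sh q0 ?x = ?x" using q0 by (auto simp: sh_def)
    then show ?thesis using q0 by (simp add: A_def phase_def)
  qed
  have "A q0 w ?x = 1\<^sub>m r"
  proof (rule eq_matI)
    fix i t assume "i < dim_row (1\<^sub>m r)" "t < dim_col (1\<^sub>m r)"
    then have it: "i < r" "t < r" by auto
    have "A q0 w ?x $$ (i, t) = (A q0 w ?x *\<^sub>v unit_vec r t) $ i"
      using it A_carrier[of q0 w ?x] by (simp add: scalar_prod_right_unit)
    also have "\<dots> = unit_vec r t $ i" by (simp only: fx[OF unit_vec_carrier])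
    finally show "A q0 w ?x $$ (i, t) = 1\<^sub>m r $$ (i, t)" using it by simp
  qed (use A_carrier[of q0 w ?x] in auto)
  then have "F ?x * (G ?x * ?D * F ?x) * G ?x = 1\<^sub>m r"
    unfolding A0 by (simp only: right_mult_one_mat[OF Fc] FG)
  moreover have "F ?x * (G ?x * ?D * F ?x) * G ?x = ?D"
  proof -
    have "F ?x * (G ?x * ?D * F ?x) * G ?x = (F ?x * G ?x) * ?D * (F ?x * G ?x)"
      by (rule mat_collect[OF Fc Gc Gc mat_diag_carrier Fc, symmetric])
    then show ?thesis
      by (simp only: FG left_mult_one_mat[OF mat_diag_carrier] right_mult_one_mat[OF mat_diag_carrier])
  qed
  ultimately have D: "?D = 1\<^sub>m r" by simp
  obtain s where s: "s < r" "\<kappa> s = 1" using k1 by blast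
  have "?D $$ (s, s) = 1" unfolding D using s by simp
  then have "cis (2 * pi * of_int w / of_nat p) = 1" using s by (simp add: mat_diag_def)
  then show "int p dvd w" by (rule cis1)
qed

end

subsection \<open>Normal forms\<close>

lemma (in group) commute_int_pow:
  assumes "x \<in> carrier G" "y \<in> carrier G" "x \<otimes> y = y \<otimes> x"
  shows "x \<otimes> y [^] (k::int) = y [^] k \<otimes> x"
proof -
  note c = assms(1,2)
  have nat: "x \<otimes> y [^] (m::nat) = y [^] m \<otimes> x" for m
    by (rule group_commutes_pow[OF assms(3)[symmetric] c(2,1), symmetric])
  show ?thesis
  proof (cases k rule: int_cases2)
    case (nonneg m)
    show ?thesis unfolding nonneg int_pow_int by (rule nat)
  next
    case (nonpos m)
    let ?z = "y [^] m"
    have z: "?z \<in> carrier G" by (rule nat_pow_closed[OF c(2)])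
    have iz: "inv ?z \<in> carrier G" by (rule inv_closed[OF z])
    have "x \<otimes> inv ?z = inv ?z \<otimes> (?z \<otimes> x) \<otimes> inv ?z"
      by (simp only: m_assoc[symmetric] c(1) z iz m_closed l_inv l_one)
    also have "\<dots> = inv ?z \<otimes> (x \<otimes> ?z) \<otimes> inv ?z" by (simp only: nat)
    also have "\<dots> = inv ?z \<otimes> x"
      by (simp only: m_assoc c(1) z iz m_closed r_inv r_one)
    finally show ?thesis unfolding nonpos int_pow_neg_int[OF c(2)] .
  qed
qed

text \<open>Effectiveness needs to know that the relations are strong enough to reduce every word to
  a normal form. They are therefore collected for an arbitrary group, away from the classes of
  words.\<close>

locale heis_group = group G for G (structure) +
  fixes n :: nat and \<alpha> \<beta> :: "nat \<Rightarrow> 'a" and \<phi> :: 'a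
  assumes cl: "i < n \<Longrightarrow> \<alpha> i \<in> carrier G" "i < n \<Longrightarrow> \<beta> i \<in> carrier G" "\<phi> \<in> carrier G"
    and aa: "i < n \<Longrightarrow> j < n \<Longrightarrow> \<alpha> i \<otimes> \<alpha> j = \<alpha> j \<otimes> \<alpha> i"
    and bb: "i < n \<Longrightarrow> j < n \<Longrightarrow> \<beta> i \<otimes> \<beta> j = \<beta> j \<otimes> \<beta> i"
    and fa: "i < n \<Longrightarrow> \<phi> \<otimes> \<alpha> i = \<alpha> i \<otimes> \<phi>" and fb: "i < n \<Longrightarrow> \<phi> \<otimes> \<beta> i = \<beta> i \<otimes> \<phi>"
    and ba: "i < n \<Longrightarrow> j < n \<Longrightarrow> i \<noteq> j \<Longrightarrow> \<beta> j \<otimes> \<alpha> i = \<alpha> i \<otimes> \<beta> j"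
    and ab: "i < n \<Longrightarrow> \<alpha> i \<otimes> \<beta> i = \<phi> \<otimes> \<beta> i \<otimes> \<alpha> i"
begin

primrec PA :: "nat \<Rightarrow> (nat \<Rightarrow> int) \<Rightarrow> 'a" where
  "PA 0 q = \<one>"
| "PA (Suc k) q = PA k q \<otimes> \<alpha> k [^] q (2 * k)"

primrec PB :: "nat \<Rightarrow> (nat \<Rightarrow> int) \<Rightarrow> 'a" where
  "PB 0 q = \<one>"
| "PB (Suc k) q = PB k q \<otimes> \<beta> k [^] q (2 * k + 1)"

text \<open>The sign of w fits the cocycle: moving some \<beta> to the right of its \<alpha>
  produces the inverse of \<phi>.\<close>

definition NF :: "(nat \<Rightarrow> int) \<Rightarrow> int \<Rightarrow> 'a" where
  "NF q w = PA n q \<otimes> PB n q \<otimes> \<phi> [^] (- w)"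

lemma PA_carrier: "k \<le> n \<Longrightarrow> PA k q \<in> carrier G"
  by (induction k) (auto simp: cl)

lemma PB_carrier: "k \<le> n \<Longrightarrow> PB k q \<in> carrier G"
  by (induction k) (auto simp: cl)

lemma commute_PA:
  assumes "x \<in> carrier G" "\<And>i. i < n \<Longrightarrow> i < k \<Longrightarrow> x \<otimes> \<alpha> i = \<alpha> i \<otimes> x"
  shows "k \<le> n \<Longrightarrow> x \<otimes> PA k q = PA k q \<otimes> x"
  using assms(2)
proof (induction k)
  case (Suc k)
  have k: "k < n" "k \<le> n" using Suc.prems by auto
  note c = assms(1) PA_carrier[OF k(2), of q] cl(1)[OF k(1)]
  have IH: "x \<otimes> PA k q = PA k q \<otimes> x" by (rule Suc.IH) (use Suc.prems in auto)
  have p: "x \<otimes> \<alpha> k [^] q (2 * k) = \<alpha> k [^] q (2 * k) \<otimes> x"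
    by (rule commute_int_pow) (use Suc.prems c in auto)
  have "x \<otimes> PA (Suc k) q = (x \<otimes> PA k q) \<otimes> \<alpha> k [^] q (2 * k)"
    using c by (simp add: m_assoc)
  also have "\<dots> = PA k q \<otimes> (x \<otimes> \<alpha> k [^] q (2 * k))"
    unfolding IH using c by (simp add: m_assoc)
  also have "\<dots> = PA (Suc k) q \<otimes> x"
    unfolding p using c by (simp add: m_assoc)
  finally show ?case .
qed (use assms(1) in simp)

lemma commute_PB:
  assumes "x \<in> carrier G" "\<And>i. i < n \<Longrightarrow> i < k \<Longrightarrow> x \<otimes> \<beta> i = \<beta> i \<otimes> x"
  shows "k \<le> n \<Longrightarrow> x \<otimes> PB k q = PB k q \<otimes> x"
  using assms(2)
proof (induction k)
  case (Suc k)
  have k: "k < n" "k \<le> n" using Suc.prems by auto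
  note c = assms(1) PB_carrier[OF k(2), of q] cl(2)[OF k(1)]
  have IH: "x \<otimes> PB k q = PB k q \<otimes> x" by (rule Suc.IH) (use Suc.prems in auto)
  have p: "x \<otimes> \<beta> k [^] q (2 * k + 1) = \<beta> k [^] q (2 * k + 1) \<otimes> x"
    by (rule commute_int_pow) (use Suc.prems c in auto)
  have "x \<otimes> PB (Suc k) q = (x \<otimes> PB k q) \<otimes> \<beta> k [^] q (2 * k + 1)"
    using c by (simp add: m_assoc)
  also have "\<dots> = PB k q \<otimes> (x \<otimes> \<beta> k [^] q (2 * k + 1))"
    unfolding IH using c by (simp add: m_assoc)
  also have "\<dots> = PB (Suc k) q \<otimes> x"
    unfolding p using c by (simp add: m_assoc)
  finally show ?case .
qed (use assms(1) in simp)

lemma PA_cong: "(\<And>i. i < k \<Longrightarrow> q (2 * i) = q' (2 * i)) \<Longrightarrow> PA k q = PA k q'"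
  by (induction k) auto

lemma PB_cong: "(\<And>i. i < k \<Longrightarrow> q (2 * i + 1) = q' (2 * i + 1)) \<Longrightarrow> PB k q = PB k q'"
  by (induction k) auto

lemma alpha_PA: "i < k \<Longrightarrow> k \<le> n \<Longrightarrow> \<alpha> i \<otimes> PA k q = PA k (wt (2 * i) 1 + q)"
proof (induction k)
  case (Suc k)
  have k: "k < n" "k \<le> n" using Suc.prems by auto
  have i: "i < n" using Suc.prems by simp
  note c = PA_carrier[OF k(2), of q] cl(1)[OF k(1)] cl(1)[OF i]
  show ?case
  proof (cases "i = k")
    case True
    have "\<alpha> k \<otimes> PA k q = PA k q \<otimes> \<alpha> k"
      by (rule commute_PA[OF c(2)]) (use k aa in auto)
    then have "\<alpha> k \<otimes> PA (Suc k) q = PA k q \<otimes> (\<alpha> k \<otimes> \<alpha> k [^] q (2 * k))"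
      using c by (simp add: m_assoc[symmetric])
    also have "\<alpha> k \<otimes> \<alpha> k [^] q (2 * k) = \<alpha> k [^] (1 + q (2 * k))"
      using int_pow_mult[OF c(2), of 1 "q (2 * k)"] c by (simp add: int_pow_1)
    also have "PA k q = PA k (wt (2 * k) 1 + q)"
      by (rule PA_cong) (simp add: wt_def)
    finally have "\<alpha> k \<otimes> PA (Suc k) q = PA k (wt (2 * k) 1 + q) \<otimes> \<alpha> k [^] (1 + q (2 * k))" .
    moreover have "(wt (2 * k) 1 + q) (2 * k) = 1 + q (2 * k)" by (simp add: wt_def)
    ultimately show ?thesis by (simp only: True PA.simps)
  next
    case False
    then have "i < k" using Suc.prems by simp
    have "\<alpha> i \<otimes> PA (Suc k) q = (\<alpha> i \<otimes> PA k q) \<otimes> \<alpha> k [^] q (2 * k)"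
      using c by (simp add: m_assoc)
    then have "\<alpha> i \<otimes> PA (Suc k) q = PA k (wt (2 * i) 1 + q) \<otimes> \<alpha> k [^] q (2 * k)"
      by (simp only: Suc.IH[OF \<open>i < k\<close> k(2)])
    moreover have "(wt (2 * i) 1 + q) (2 * k) = q (2 * k)" using False by (simp add: wt_def)
    ultimately show ?thesis by (simp only: PA.simps)
  qed
qed simp

lemma beta_PB: "i < k \<Longrightarrow> k \<le> n \<Longrightarrow> \<beta> i \<otimes> PB k q = PB k (wt (2 * i + 1) 1 + q)"
proof (induction k)
  case (Suc k)
  have k: "k < n" "k \<le> n" using Suc.prems by auto
  have i: "i < n" using Suc.prems by simp
  note c = PB_carrier[OF k(2), of q] cl(2)[OF k(1)] cl(2)[OF i]
  show ?case
  proof (cases "i = k")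
    case True
    have "\<beta> k \<otimes> PB k q = PB k q \<otimes> \<beta> k"
      by (rule commute_PB[OF c(2)]) (use k bb in auto)
    then have "\<beta> k \<otimes> PB (Suc k) q = PB k q \<otimes> (\<beta> k \<otimes> \<beta> k [^] q (2 * k + 1))"
      using c by (simp add: m_assoc[symmetric])
    also have "\<beta> k \<otimes> \<beta> k [^] q (2 * k + 1) = \<beta> k [^] (1 + q (2 * k + 1))"
      using int_pow_mult[OF c(2), of 1 "q (2 * k + 1)"] c by (simp add: int_pow_1)
    also have "PB k q = PB k (wt (2 * k + 1) 1 + q)"
      by (rule PB_cong) (simp add: wt_def)
    finally have "\<beta> k \<otimes> PB (Suc k) q = PB k (wt (2 * k + 1) 1 + q) \<otimes> \<beta> k [^] (1 + q (2 * k + 1))" .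
    moreover have "(wt (2 * k + 1) 1 + q) (2 * k + 1) = 1 + q (2 * k + 1)" by (simp add: wt_def)
    ultimately show ?thesis by (simp only: True PB.simps)
  next
    case False
    then have "i < k" using Suc.prems by simp
    have "\<beta> i \<otimes> PB (Suc k) q = (\<beta> i \<otimes> PB k q) \<otimes> \<beta> k [^] q (2 * k + 1)"
      using c by (simp add: m_assoc)
    then have "\<beta> i \<otimes> PB (Suc k) q = PB k (wt (2 * i + 1) 1 + q) \<otimes> \<beta> k [^] q (2 * k + 1)"
      by (simp only: Suc.IH[OF \<open>i < k\<close> k(2)])
    moreover have "(wt (2 * i + 1) 1 + q) (2 * k + 1) = q (2 * k + 1)" using False by (simp add: wt_def)
    ultimately show ?thesis by (simp only: PB.simps)
  qed
qed simp

lemma phi_pow_commute: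
  shows "i < n \<Longrightarrow> \<phi> [^] (k::int) \<otimes> \<alpha> i = \<alpha> i \<otimes> \<phi> [^] k"
    and "i < n \<Longrightarrow> \<phi> [^] (k::int) \<otimes> \<beta> i = \<beta> i \<otimes> \<phi> [^] k"
  using commute_int_pow[OF cl(1) cl(3) fa[symmetric], of i k]
    commute_int_pow[OF cl(2) cl(3) fb[symmetric], of i k] by auto

text \<open>By \<open>gen\<close> the rule passes to products, provided that the power of \<phi>
  commutes with the second factor; it is then enough to verify it for \<alpha> i and its
  inverse.\<close>

lemma beta_alpha_pow:
  assumes i: "i < n"
  shows "\<beta> i \<otimes> \<alpha> i [^] (a::int) = \<alpha> i [^] a \<otimes> \<beta> i \<otimes> \<phi> [^] (- a)"
proof -
  note c = cl(1)[OF i] cl(2)[OF i] cl(3)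
  have gen: "\<beta> i \<otimes> (x \<otimes> y) = x \<otimes> y \<otimes> \<beta> i \<otimes> \<phi> [^] (- (s + t))"
    if x: "x \<in> carrier G" "\<beta> i \<otimes> x = x \<otimes> \<beta> i \<otimes> \<phi> [^] (- s)"
      and y: "y \<in> carrier G" "\<beta> i \<otimes> y = y \<otimes> \<beta> i \<otimes> \<phi> [^] (- t)" "\<phi> [^] (- s) \<otimes> y = y \<otimes> \<phi> [^] (- s)"
    for x y and s t :: int
  proof -
    have "\<beta> i \<otimes> (x \<otimes> y) = (\<beta> i \<otimes> x) \<otimes> y" using c x(1) y(1) by (simp add: m_assoc)
    also have "\<dots> = x \<otimes> \<beta> i \<otimes> (\<phi> [^] (- s) \<otimes> y)" unfolding x(2) using c x(1) y(1) by (simp add: m_assoc)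
    also have "\<dots> = x \<otimes> (\<beta> i \<otimes> y) \<otimes> \<phi> [^] (- s)" unfolding y(3) using c x(1) y(1) by (simp add: m_assoc)
    also have "\<dots> = x \<otimes> y \<otimes> \<beta> i \<otimes> (\<phi> [^] (- t) \<otimes> \<phi> [^] (- s))" unfolding y(2) using c x(1) y(1) by (simp add: m_assoc)
    also have "\<phi> [^] (- t) \<otimes> \<phi> [^] (- s) = \<phi> [^] (- (s + t))"
      by (subst int_pow_mult[OF c(3), symmetric]) (simp add: add.commute)
    finally show ?thesis .
  qed
  have pos: "\<beta> i \<otimes> \<alpha> i = \<alpha> i \<otimes> \<beta> i \<otimes> \<phi> [^] (- 1 :: int)"
  proof -
    have "\<alpha> i \<otimes> \<beta> i \<otimes> inv \<phi> = (\<phi> \<otimes> (\<beta> i \<otimes> \<alpha> i)) \<otimes> inv \<phi>"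
      using ab[OF i] c by (simp add: m_assoc)
    also have "\<phi> \<otimes> (\<beta> i \<otimes> \<alpha> i) = (\<beta> i \<otimes> \<alpha> i) \<otimes> \<phi>"
      using fa[OF i] fb[OF i] c by (metis m_assoc)
    also have "(\<beta> i \<otimes> \<alpha> i) \<otimes> \<phi> \<otimes> inv \<phi> = \<beta> i \<otimes> \<alpha> i"
      using c by (simp add: m_assoc)
    finally show ?thesis using c by (simp add: int_pow_neg int_pow_1)
  qed
  have neg: "\<beta> i \<otimes> inv \<alpha> i = inv \<alpha> i \<otimes> \<beta> i \<otimes> \<phi> [^] (1 :: int)"
  proof -
    have "inv \<alpha> i \<otimes> \<beta> i \<otimes> \<phi> = inv \<alpha> i \<otimes> (\<phi> \<otimes> \<beta> i)"
      using fb[OF i] c by (simp add: m_assoc)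
    also have "\<phi> \<otimes> \<beta> i = \<alpha> i \<otimes> \<beta> i \<otimes> inv \<alpha> i"
      using ab[OF i] c by (simp add: m_assoc)
    also have "inv \<alpha> i \<otimes> (\<alpha> i \<otimes> \<beta> i \<otimes> inv \<alpha> i) = \<beta> i \<otimes> inv \<alpha> i"
      using c by (simp add: m_assoc[symmetric])
    finally show ?thesis using c by (simp add: int_pow_1)
  qed
  have fai: "\<phi> [^] (k::int) \<otimes> inv \<alpha> i = inv \<alpha> i \<otimes> \<phi> [^] k" for k
    using commute_int_pow[of "\<phi> [^] k" "\<alpha> i" "-1"] phi_pow_commute(1)[OF i, of k] c
    by (simp add: int_pow_neg int_pow_1)
  show ?thesis
  proof (induction a rule: int_induct[where k = 0])
    case base
    then show ?case using c by simp
  next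
    case (step1 a)
    have "\<alpha> i [^] (a + 1) = \<alpha> i [^] a \<otimes> \<alpha> i"
      using int_pow_mult[OF c(1), of a 1] c by (simp add: int_pow_1)
    then show ?case
      using gen[of "\<alpha> i [^] a" a "\<alpha> i" 1] step1 pos phi_pow_commute(1)[OF i, of "- a"] c by simp
  next
    case (step2 a)
    have "\<alpha> i [^] (a - 1) = \<alpha> i [^] a \<otimes> inv \<alpha> i"
      using int_pow_mult[OF c(1), of a "- 1"] c by (simp add: int_pow_neg int_pow_1)
    then show ?case
      using gen[of "\<alpha> i [^] a" a "inv \<alpha> i" "- 1"] step2 neg fai[of "- a"] c by simp
  qed
qed

lemma beta_PA:
  assumes i: "i < n"
  shows "k \<le> n \<Longrightarrow> \<beta> i \<otimes> PA k q = PA k q \<otimes> \<beta> i \<otimes> \<phi> [^] (if i < k then - q (2 * i) else 0)"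
proof (induction k)
  case 0
  then show ?case using cl(2)[OF i] by simp
next
  case (Suc k)
  have k: "k < n" "k \<le> n" using Suc.prems by auto
  note c = PA_carrier[OF k(2), of q] cl(1)[OF k(1)] cl(2)[OF i] cl(3)
  let ?f = "\<phi> [^] (if i < k then - q (2 * i) else 0)"
  let ?y = "\<alpha> k [^] q (2 * k)"
  have fy: "?f \<otimes> ?y = ?y \<otimes> ?f"
    by (rule commute_int_pow) (use c phi_pow_commute(1)[OF k(1)] in auto)
  have "\<beta> i \<otimes> PA (Suc k) q = (\<beta> i \<otimes> PA k q) \<otimes> ?y" using c by (simp add: m_assoc)
  also have "\<dots> = PA k q \<otimes> \<beta> i \<otimes> (?f \<otimes> ?y)"
    unfolding Suc.IH[OF k(2)] using c by (simp add: m_assoc)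
  also have "\<dots> = PA k q \<otimes> (\<beta> i \<otimes> ?y) \<otimes> ?f"
    unfolding fy using c by (simp add: m_assoc)
  also have "\<dots> = PA (Suc k) q \<otimes> \<beta> i \<otimes> \<phi> [^] (if i < Suc k then - q (2 * i) else 0)"
  proof (cases "i = k")
    case True
    then show ?thesis
      using c beta_alpha_pow[OF i, of "q (2 * k)"] by (simp add: m_assoc)
  next
    case False
    have "\<beta> i \<otimes> ?y = ?y \<otimes> \<beta> i"
      by (rule commute_int_pow) (use c ba[OF k(1) i] False in auto)
    then show ?thesis using c False by (simp add: m_assoc less_Suc_eq)
  qed
  finally show ?case .
qed

lemma NF_carrier: "NF q w \<in> carrier G"
  unfolding NF_def using PA_carrier PB_carrier cl by simp

lemma NF_alpha:
  assumes i: "i < n"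
  shows "\<alpha> i \<otimes> NF q w = NF (wt (2 * i) 1 + q) w"
proof -
  have "PB n (wt (2 * i) 1 + q) = PB n q"
  proof (rule PB_cong)
    fix l
    have "2 * l + 1 \<noteq> 2 * i" by presburger
    then show "(wt (2 * i) 1 + q) (2 * l + 1) = q (2 * l + 1)" by (simp add: wt_def)
  qed
  then show ?thesis
    using alpha_PA[OF i, of q] PA_carrier[of n q] PB_carrier[of n q] cl(1)[OF i] cl(3)
    by (simp add: NF_def m_assoc[symmetric])
qed

text \<open>Crossing the \<alpha>-part costs the power - q (2 i) of \<phi>, and q (2 i) is precisely
  the cocycle of the unit vector at 2 i + 1 with q.\<close>

lemma NF_beta:
  assumes i: "i < n"
  shows "\<beta> i \<otimes> NF q w = NF (wt (2 * i + 1) 1 + q) (w + q (2 * i))"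
proof -
  note c = PA_carrier[of n q] PB_carrier[of n q] cl(2)[OF i] cl(3)
  have PA: "PA n (wt (2 * i + 1) 1 + q) = PA n q"
  proof (rule PA_cong)
    fix l
    have "2 * l \<noteq> 2 * i + 1" by presburger
    then show "(wt (2 * i + 1) 1 + q) (2 * l) = q (2 * l)" by (simp add: wt_def)
  qed
  let ?f = "\<phi> [^] (- q (2 * i))"
  have f: "?f \<otimes> PB n q = PB n q \<otimes> ?f"
    by (rule commute_PB) (use c phi_pow_commute(2) in auto)
  have "\<beta> i \<otimes> NF q w = (\<beta> i \<otimes> PA n q) \<otimes> PB n q \<otimes> \<phi> [^] (- w)"
    using c by (simp add: NF_def m_assoc)
  also have "\<dots> = PA n q \<otimes> \<beta> i \<otimes> (?f \<otimes> PB n q) \<otimes> \<phi> [^] (- w)"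
    using beta_PA[OF i, of n q] c i by (simp add: m_assoc)
  also have "\<dots> = PA n q \<otimes> (\<beta> i \<otimes> PB n q) \<otimes> (?f \<otimes> \<phi> [^] (- w))"
    unfolding f using c by (simp add: m_assoc)
  also have "?f \<otimes> \<phi> [^] (- w) = \<phi> [^] (- (w + q (2 * i)))"
    by (subst int_pow_mult[OF c(4), symmetric]) (simp add: add.commute)
  also have "\<beta> i \<otimes> PB n q = PB n (wt (2 * i + 1) 1 + q)"
    by (rule beta_PB[OF i]) simp
  finally show ?thesis unfolding NF_def[of "wt (2 * i + 1) 1 + q"] PA .
qed

lemma NF_phi: "\<phi> \<otimes> NF q w = NF q (w - 1)"
proof -
  note c = PA_carrier[of n q] PB_carrier[of n q] cl(3)
  have a: "\<phi> \<otimes> PA n q = PA n q \<otimes> \<phi>" by (rule commute_PA) (use c fa in auto)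
  have b: "\<phi> \<otimes> PB n q = PB n q \<otimes> \<phi>" by (rule commute_PB) (use c fb in auto)
  have "\<phi> \<otimes> NF q w = (\<phi> \<otimes> PA n q) \<otimes> PB n q \<otimes> \<phi> [^] (- w)"
    using c by (simp add: NF_def m_assoc)
  also have "\<dots> = PA n q \<otimes> (\<phi> \<otimes> PB n q) \<otimes> \<phi> [^] (- w)"
    unfolding a using c by (simp add: m_assoc)
  also have "\<dots> = PA n q \<otimes> PB n q \<otimes> (\<phi> \<otimes> \<phi> [^] (- w))"
    unfolding b using c by (simp add: m_assoc)
  also have "\<phi> \<otimes> \<phi> [^] (- w) = \<phi> [^] (- (w - 1))"
    using int_pow_mult[OF c(3), of 1 "- w"] c by (simp add: int_pow_1)
  finally show ?thesis by (simp add: NF_def)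
qed

lemma int_pow_dvd:
  assumes "x \<in> carrier G" "x [^] (p::nat) = \<one>" "int p dvd k"
  shows "x [^] k = \<one>"
proof -
  obtain m where "k = int p * m" using assms(3) by blast
  then have "x [^] k = (x [^] int p) [^] m" using assms(1) by (simp add: int_pow_pow)
  then show ?thesis using assms by (simp add: int_pow_int)
qed

lemma NF_trivial:
  assumes "\<And>i. i < n \<Longrightarrow> \<alpha> i [^] (p::nat) = \<one>" "\<And>i. i < n \<Longrightarrow> \<beta> i [^] p = \<one>" "\<phi> [^] p = \<one>"
    and "\<And>j. j < 2 * n \<Longrightarrow> int p dvd q j" "int p dvd w"
  shows "NF q w = \<one>"
proof -
  have "PA k q = \<one>" if "k \<le> n" for k
    using that by (induction k) (auto simp: int_pow_dvd[OF cl(1) assms(1)] assms(4))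
  moreover have "PB k q = \<one>" if "k \<le> n" for k
    using that by (induction k) (auto simp: int_pow_dvd[OF cl(2) assms(2)] assms(4))
  moreover have "\<phi> [^] (- w) = \<one>"
    by (rule int_pow_dvd[OF cl(3) assms(3)]) (use assms(5) in simp)
  ultimately show ?thesis by (simp add: NF_def)
qed

end

subsection \<open>The action of \<open>\<Gamma>\<^bsub>n,p\<^esub>\<close>\<close>

definition heis_mult :: "nat \<Rightarrow> (nat \<Rightarrow> int) \<times> int \<Rightarrow> (nat \<Rightarrow> int) \<times> int \<Rightarrow> (nat \<Rightarrow> int) \<times> int" where
  "heis_mult n g h = (fst g + fst h, snd g + snd h + heis_cocycle n (fst g) (fst h))"

definition letter_sign :: "bool \<Rightarrow> int" where
  "letter_sign b = (if b then 1 else - 1)"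

text \<open>The commutator of \<open>a\<^sub>i\<close> and \<open>b\<^sub>i\<close> has the value \<open>(0, -1)\<close>, which dictates the sign for \<open>f\<close>.\<close>

fun letter_val :: "Gamma_gen \<times> bool \<Rightarrow> (nat \<Rightarrow> int) \<times> int" where
  "letter_val (gen_a i, b) = (wt (2 * (i - 1)) (letter_sign b), 0)"
| "letter_val (gen_b i, b) = (wt (2 * (i - 1) + 1) (letter_sign b), 0)"
| "letter_val (gen_f, b) = (0, - letter_sign b)"

primrec word_val :: "nat \<Rightarrow> Gamma_gen word \<Rightarrow> (nat \<Rightarrow> int) \<times> int" where
  "word_val n [] = (0, 0)"
| "word_val n (l # u) = heis_mult n (letter_val l) (word_val n u)"

definition cong_pair :: "nat \<Rightarrow> (nat \<Rightarrow> int) \<times> int \<Rightarrow> (nat \<Rightarrow> int) \<times> int \<Rightarrow> bool" where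
  "cong_pair p g h \<longleftrightarrow> (\<forall>j. [fst g j = fst h j] (mod int p)) \<and> [snd g = snd h] (mod int p)"

lemma heis_mult_assoc: "heis_mult n (heis_mult n g h) k = heis_mult n g (heis_mult n h k)"
  by (simp add: heis_mult_def heis_cocycle_add add_ac)

lemma heis_mult_unit: "heis_mult n (0, 0) g = g" "heis_mult n g (0, 0) = g"
  by (simp_all add: heis_mult_def heis_cocycle_0)

lemma word_val_append: "word_val n (u @ v) = heis_mult n (word_val n u) (word_val n v)"
  by (induction u) (simp_all add: heis_mult_unit heis_mult_assoc)

lemma cong_pair_refl: "cong_pair p g g" and cong_pair_sym: "cong_pair p g h \<Longrightarrow> cong_pair p h g"
  and cong_pair_trans: "cong_pair p g h \<Longrightarrow> cong_pair p h k \<Longrightarrow> cong_pair p g k"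
  by (auto simp: cong_pair_def intro: cong_sym cong_trans)

lemma cong_pair_heis_mult:
  assumes "cong_pair p g g'" "cong_pair p h h'"
  shows "cong_pair p (heis_mult n g h) (heis_mult n g' h')"
  using assms unfolding cong_pair_def heis_mult_def heis_cocycle_def
  by (auto intro!: cong_add cong_sum cong_mult)

lemma heis_cocycle_wt:
  "heis_cocycle n (wt (2 * i) a) s = 0"
  "heis_cocycle n s (wt (2 * i + 1) a) = 0"
  "i < n \<Longrightarrow> heis_cocycle n (wt (2 * i + 1) a) s = a * s (2 * i)"
proof -
  have "2 * l + 1 \<noteq> 2 * i" "2 * l \<noteq> 2 * i + 1" for l by presburger+
  then show "heis_cocycle n (wt (2 * i) a) s = 0" "heis_cocycle n s (wt (2 * i + 1) a) = 0"
    by (auto simp: heis_cocycle_def wt_def)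
  assume "i < n"
  have "heis_cocycle n (wt (2 * i + 1) a) s = (\<Sum>l<n. if l = i then a * s (2 * i) else 0)"
    unfolding heis_cocycle_def by (rule sum.cong) (auto simp: wt_def)
  with \<open>i < n\<close> show "heis_cocycle n (wt (2 * i + 1) a) s = a * s (2 * i)" by simp
qed

lemma word_val_commutator:
  assumes "letter_val (x, True) = (q, w)" "letter_val (x, False) = (- q, - w)"
    "letter_val (y, True) = (q', w')" "letter_val (y, False) = (- q', - w')"
    "heis_cocycle n q q = 0" "heis_cocycle n q' q' = 0"
  shows "word_val n (commutator_word x y) = (0, heis_cocycle n q q' - heis_cocycle n q' q)"
  using assms by (simp add: commutator_word_def heis_mult_def heis_cocycle_add heis_cocycle_diff heis_cocycle_minus heis_cocycle_0)

lemma letter_val_inv: "letter_val (x, False) = (- fst (letter_val (x, True)), - snd (letter_val (x, True)))"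
  by (cases x) (auto simp: letter_sign_def wt_def)

lemma heis_cocycle_letter_val: "heis_cocycle n (fst (letter_val (x, True))) (fst (letter_val (x, True))) = 0"
  by (cases x) (simp_all add: heis_cocycle_wt(1) heis_cocycle_wt(2)[simplified] heis_cocycle_0)

lemma word_val_commutator':
  "word_val n (commutator_word x y) =
    (0, heis_cocycle n (fst (letter_val (x, True))) (fst (letter_val (y, True))) - heis_cocycle n (fst (letter_val (y, True))) (fst (letter_val (x, True))))"
  by (rule word_val_commutator[where w = "snd (letter_val (x, True))" and w' = "snd (letter_val (y, True))"])
     (simp_all add: letter_val_inv heis_cocycle_letter_val)

lemma word_val_power: "word_val n (power_word x k) = ((\<lambda>j. int k * fst (letter_val (x, True)) j), int k * snd (letter_val (x, True)))"
proof (induction k)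
  case (Suc k)
  have "heis_cocycle n (fst (letter_val (x, True))) (\<lambda>j. int k * fst (letter_val (x, True)) j) = int k * heis_cocycle n (fst (letter_val (x, True))) (fst (letter_val (x, True)))"
    by (simp add: heis_cocycle_def sum_distrib_left mult.left_commute)
  then show ?case using Suc
    by (simp add: power_word_def heis_mult_def heis_cocycle_letter_val fun_eq_iff distrib_right)
qed (simp add: power_word_def fun_eq_iff)

lemma cong_pair_zeroI: "(\<And>j. int p dvd fst g j) \<Longrightarrow> int p dvd snd g \<Longrightarrow> cong_pair p g (0, 0)"
  by (simp add: cong_pair_def cong_0_iff)

text \<open>The value of a commutator is central and given by the antisymmetrized cocycle. Among the
  relators it is nonzero only for a_i and b_i, where it is -1 and is offset by the trailing inverse
  of f, whose value is 1. The power relators have values divisible by p.\<close>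

lemma word_val_relator:
  assumes "r \<in> Gamma_relators n p"
  shows "cong_pair p (word_val n r) (0, 0)"
proof -
  consider (pow) x where "r = power_word x p"
    | (aa) i j where "r = commutator_word (gen_a i) (gen_a j)"
    | (bb) i j where "r = commutator_word (gen_b i) (gen_b j)"
    | (af) i where "r = commutator_word (gen_a i) gen_f"
    | (bf) i where "r = commutator_word (gen_b i) gen_f"
    | (ab) i j where "r = commutator_word (gen_a i) (gen_b j)" "i \<in> {1..n}" "j \<in> {1..n}" "i \<noteq> j"
    | (abf) i where "r = commutator_word (gen_a i) (gen_b i) @ [(gen_f, False)]" "i \<in> {1..n}"
    using assms unfolding Gamma_relators_def by blast
  then show ?thesis
  proof cases
    case pow
    then show ?thesis by (intro cong_pair_zeroI) (simp_all add: word_val_power)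
  next
    case ab
    have "heis_cocycle n (wt (2 * (j - 1) + 1) 1) (wt (2 * (i - 1)) 1) = 1 * wt (2 * (i - 1)) 1 (2 * (j - 1))"
      by (rule heis_cocycle_wt(3)) (use ab in auto)
    also have "\<dots> = 0" using ab by (auto simp: wt_def)
    finally show ?thesis
      using ab heis_cocycle_wt(1) by (simp add: word_val_commutator' letter_sign_def cong_pair_refl)
  next
    case abf
    have "heis_cocycle n (wt (2 * (i - 1) + 1) 1) (wt (2 * (i - 1)) 1) = 1 * wt (2 * (i - 1)) 1 (2 * (i - 1))"
      by (rule heis_cocycle_wt(3)) (use abf in auto)
    also have "\<dots> = 1" by (simp add: wt_def)
    finally show ?thesis
      using abf heis_cocycle_wt(1) by (simp add: word_val_append word_val_commutator' letter_sign_def heis_mult_def heis_cocycle_0 cong_pair_refl)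
  qed (simp_all add: word_val_commutator' heis_cocycle_wt[simplified] heis_cocycle_0 cong_pair_refl)
qed

lemma word_val_word_eq: "word_eq (Gamma_gens n) (Gamma_relators n p) u v \<Longrightarrow> cong_pair p (word_val n u) (word_val n v)"
proof (induction rule: word_eq.induct)
  case (cancel x b)
  have "word_val n [(x, b), (x, \<not> b)] = (0, 0)"
    by (cases b) (simp_all add: heis_mult_def letter_val_inv heis_cocycle_0 heis_cocycle_minus heis_cocycle_letter_val)
  then show ?case by (simp add: cong_pair_refl)
qed (auto simp: word_val_append intro: cong_pair_refl cong_pair_sym cong_pair_trans cong_pair_heis_mult word_val_relator)

section \<open>Normal forms in the presented group\<close>

definition word_class :: "nat \<Rightarrow> nat \<Rightarrow> Gamma_gen word \<Rightarrow> Gamma_gen word set" where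
  "word_class n p u = word_rel (Gamma_gens n) (Gamma_relators n p) `` {u}"

abbreviation "Gamma_words n \<equiv> words (Gamma_gens n)"

lemma word_class_carrier: "u \<in> Gamma_words n \<Longrightarrow> word_class n p u \<in> carrier (Gamma n p)"
  by (simp add: word_class_def Gamma_def presented_group_def quotientI)

lemma word_class_ex: "\<gamma> \<in> carrier (Gamma n p) \<Longrightarrow> \<exists>u\<in>Gamma_words n. \<gamma> = word_class n p u"
  by (auto simp: word_class_def Gamma_def presented_group_def elim: quotientE)

lemma word_class_mult: "u \<in> Gamma_words n \<Longrightarrow> v \<in> Gamma_words n \<Longrightarrow> word_class n p u \<otimes>\<^bsub>Gamma n p\<^esub> word_class n p v = word_class n p (u @ v)"
  by (simp add: word_class_def Gamma_def presented_group_mult)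

lemma word_class_one: "\<one>\<^bsub>Gamma n p\<^esub> = word_class n p []"
  by (simp add: word_class_def Gamma_def presented_group_def)

lemma word_class_eqI: "word_eq (Gamma_gens n) (Gamma_relators n p) u v \<Longrightarrow> word_class n p u = word_class n p v"
  unfolding word_class_def by (rule equiv_class_eq[OF equiv_word_rel]) (simp add: word_rel_def)

lemma word_class_relator: "r \<in> Gamma_relators n p \<Longrightarrow> r \<in> Gamma_words n \<Longrightarrow> word_class n p r = \<one>\<^bsub>Gamma n p\<^esub>"
  unfolding word_class_one by (intro word_class_eqI word_eq.relator)

lemma group_Gamma: "group (Gamma n p)"
  unfolding Gamma_def by (rule group_presented_group)

lemma Gamma_words_letter: "x \<in> Gamma_gens n \<Longrightarrow> [(x, b)] \<in> Gamma_words n"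
  by (simp add: words_def)

lemma word_class_letter_inv:
  assumes "x \<in> Gamma_gens n"
  shows "word_class n p [(x, False)] = inv\<^bsub>Gamma n p\<^esub> word_class n p [(x, True)]"
proof -
  interpret group "Gamma n p" by (rule group_Gamma)
  have "word_class n p [(x, False)] \<otimes>\<^bsub>Gamma n p\<^esub> word_class n p [(x, True)] = \<one>\<^bsub>Gamma n p\<^esub>"
    using word_class_eqI[OF word_eq.cancel[OF assms], of p False] assms by (simp add: word_class_mult Gamma_words_letter word_class_one)
  then show ?thesis
    by (intro inv_equality[symmetric]) (simp_all add: word_class_carrier Gamma_words_letter assms)
qed

lemma word_class_power:
  assumes "x \<in> Gamma_gens n"
  shows "word_class n p [(x, True)] [^]\<^bsub>Gamma n p\<^esub> k = word_class n p (power_word x k)"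
proof (induction k)
  case 0
  then show ?case using group_Gamma[of n p] by (simp add: power_word_def word_class_one group.is_monoid monoid.nat_pow_0)
next
  case (Suc k)
  have "power_word x k \<in> Gamma_words n" using assms by (auto simp: power_word_def words_def)
  moreover have "power_word x (Suc k) = power_word x k @ [(x, True)]"
    by (simp add: power_word_def replicate_append_same)
  ultimately show ?case
    using Suc assms group_Gamma[of n p] by (simp add: word_class_mult Gamma_words_letter group.is_monoid monoid.nat_pow_Suc)
qed

lemma word_class_commutator:
  assumes "x \<in> Gamma_gens n" "y \<in> Gamma_gens n"
  shows "word_class n p (commutator_word x y) =
    word_class n p [(x, True)] \<otimes>\<^bsub>Gamma n p\<^esub> word_class n p [(y, True)] \<otimes>\<^bsub>Gamma n p\<^esub>
    inv\<^bsub>Gamma n p\<^esub> word_class n p [(x, True)] \<otimes>\<^bsub>Gamma n p\<^esub> inv\<^bsub>Gamma n p\<^esub> word_class n p [(y, True)]"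
  using assms unfolding word_class_letter_inv[symmetric, OF assms(1)] word_class_letter_inv[symmetric, OF assms(2)]
  by (simp add: word_class_mult words_def commutator_word_def)

lemma (in group) commutator_eq:
  assumes "x \<in> carrier G" "y \<in> carrier G" "z \<in> carrier G" "x \<otimes> y \<otimes> inv x \<otimes> inv y = z"
  shows "x \<otimes> y = z \<otimes> y \<otimes> x"
proof -
  have "z \<otimes> y \<otimes> x = x \<otimes> y \<otimes> (inv x \<otimes> (inv y \<otimes> y) \<otimes> x)"
    unfolding assms(4)[symmetric] using assms(1,2) by (simp only: m_assoc m_closed inv_closed)
  then show ?thesis using assms(1,2) by simp
qed

lemma Gamma_relatorsI:
  "x \<in> Gamma_gens n \<Longrightarrow> power_word x p \<in> Gamma_relators n p"
  "i \<in> {1..n} \<Longrightarrow> j \<in> {1..n} \<Longrightarrow> commutator_word (gen_a i) (gen_a j) \<in> Gamma_relators n p"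
  "i \<in> {1..n} \<Longrightarrow> j \<in> {1..n} \<Longrightarrow> commutator_word (gen_b i) (gen_b j) \<in> Gamma_relators n p"
  "i \<in> {1..n} \<Longrightarrow> commutator_word (gen_a i) (gen_f) \<in> Gamma_relators n p"
  "i \<in> {1..n} \<Longrightarrow> commutator_word (gen_b i) (gen_f) \<in> Gamma_relators n p"
  "i \<in> {1..n} \<Longrightarrow> j \<in> {1..n} \<Longrightarrow> i \<noteq> j \<Longrightarrow> commutator_word (gen_a i) (gen_b j) \<in> Gamma_relators n p"
  "i \<in> {1..n} \<Longrightarrow> commutator_word (gen_a i) (gen_b i) @ [(gen_f, False)] \<in> Gamma_relators n p"
  by (simp_all only: Gamma_relators_def Un_iff mem_Collect_eq) iprover+

text \<open>The generators are numbered from 1 and the factors of the torus from 0, hence the shift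
  \<open>i + 1\<close>.\<close>

lemma heis_group_Gamma:
  "heis_group (Gamma n p) n (\<lambda>i. word_class n p [(gen_a (i + 1), True)]) (\<lambda>i. word_class n p [(gen_b (i + 1), True)])
     (word_class n p [(gen_f, True)])"
proof -
  interpret group "Gamma n p" by (rule group_Gamma)
  have g: "gen_f \<in> Gamma_gens n" "i < n \<Longrightarrow> gen_a (i + 1) \<in> Gamma_gens n" "i < n \<Longrightarrow> gen_b (i + 1) \<in> Gamma_gens n" for i
    by (auto simp: Gamma_gens_def)
  have c: "x \<in> Gamma_gens n \<Longrightarrow> word_class n p [(x, True)] \<in> carrier (Gamma n p)" for x
    by (simp add: word_class_carrier Gamma_words_letter)
  have cw: "x \<in> Gamma_gens n \<Longrightarrow> y \<in> Gamma_gens n \<Longrightarrow> commutator_word x y \<in> Gamma_words n" for x y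
    by (simp add: words_def commutator_word_def)
  have comm: "word_class n p [(x, True)] \<otimes>\<^bsub>Gamma n p\<^esub> word_class n p [(y, True)] = word_class n p [(y, True)] \<otimes>\<^bsub>Gamma n p\<^esub> word_class n p [(x, True)]"
    if "x \<in> Gamma_gens n" "y \<in> Gamma_gens n" "commutator_word x y \<in> Gamma_relators n p" for x y
  proof -
    have "word_class n p [(x, True)] \<otimes>\<^bsub>Gamma n p\<^esub> word_class n p [(y, True)] = \<one>\<^bsub>Gamma n p\<^esub> \<otimes>\<^bsub>Gamma n p\<^esub> word_class n p [(y, True)] \<otimes>\<^bsub>Gamma n p\<^esub> word_class n p [(x, True)]"
      by (rule commutator_eq[OF c[OF that(1)] c[OF that(2)] one_closed])
        (rule HOL.trans[OF word_class_commutator[OF that(1,2), symmetric] word_class_relator[OF that(3) cw[OF that(1,2)]]])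
    also have "\<one>\<^bsub>Gamma n p\<^esub> \<otimes>\<^bsub>Gamma n p\<^esub> word_class n p [(y, True)] = word_class n p [(y, True)]"
      by (rule l_one[OF c[OF that(2)]])
    finally show ?thesis .
  qed
  have i: "k < n \<Longrightarrow> k + 1 \<in> {1..n}" for k by simp
  have ne: "k \<noteq> l \<Longrightarrow> k + 1 \<noteq> l + 1" for k l :: nat by simp
  note r = Gamma_relatorsI(2)[OF i i] Gamma_relatorsI(3)[OF i i] Gamma_relatorsI(4)[OF i]
    Gamma_relatorsI(5)[OF i] Gamma_relatorsI(6)[OF i i ne] Gamma_relatorsI(7)[OF i]
  have ab: "word_class n p [(gen_a (i + 1), True)] \<otimes>\<^bsub>Gamma n p\<^esub> word_class n p [(gen_b (i + 1), True)] =
    word_class n p [(gen_f, True)] \<otimes>\<^bsub>Gamma n p\<^esub> word_class n p [(gen_b (i + 1), True)] \<otimes>\<^bsub>Gamma n p\<^esub> word_class n p [(gen_a (i + 1), True)]"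
    if i: "i < n" for i
  proof -
    let ?c = "commutator_word (gen_a (i + 1)) (gen_b (i + 1))"
    note x = g(2)[OF i] g(3)[OF i]
    have "word_class n p (?c @ [(gen_f, False)]) = \<one>\<^bsub>Gamma n p\<^esub>"
      by (rule word_class_relator[OF r(6)[OF i] words_append[OF cw[OF x] Gamma_words_letter[OF g(1)]]])
    then have "word_class n p ?c \<otimes>\<^bsub>Gamma n p\<^esub> inv\<^bsub>Gamma n p\<^esub> word_class n p [(gen_f, True)] = \<one>\<^bsub>Gamma n p\<^esub>"
      by (simp only: word_class_mult[OF cw[OF x] Gamma_words_letter[OF g(1)], symmetric] word_class_letter_inv[OF g(1), symmetric])
    then have "word_class n p ?c = \<one>\<^bsub>Gamma n p\<^esub> \<otimes>\<^bsub>Gamma n p\<^esub> word_class n p [(gen_f, True)]"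
      using inv_solve_right'[OF one_closed word_class_carrier[OF cw[OF x]] c[OF g(1)]] by (simp only:)
    then have "word_class n p ?c = word_class n p [(gen_f, True)]"
      by (simp only: l_one[OF c[OF g(1)]])
    then show ?thesis
      by (intro commutator_eq[OF c[OF x(1)] c[OF x(2)] c[OF g(1)]]) (rule HOL.trans[OF word_class_commutator[OF x, symmetric]])
  qed
  show ?thesis
  proof (unfold_locales, goal_cases)
    case (1 i)
    then show ?case by (rule c[OF g(2)])
  next
    case (2 i)
    then show ?case by (rule c[OF g(3)])
  next
    case 3
    then show ?case by (rule c[OF g(1)])
  next
    case (4 i j)
    then show ?case by (intro comm g r(1))
  next
    case (5 i j)
    then show ?case by (intro comm g r(2))
  next
    case (6 i)
    then show ?case by (intro comm[symmetric] g r(3))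
  next
    case (7 i)
    then show ?case by (intro comm[symmetric] g r(4))
  next
    case (8 i j)
    then show ?case by (intro comm[symmetric] g r(5))
  next
    case (9 i)
    then show ?case by (rule ab)
  qed
qed

definition Gamma_NF :: "nat \<Rightarrow> nat \<Rightarrow> (nat \<Rightarrow> int) \<times> int \<Rightarrow> Gamma_gen word set" where
  "Gamma_NF n p g = heis_group.NF (Gamma n p) n (\<lambda>i. word_class n p [(gen_a (i + 1), True)])
     (\<lambda>i. word_class n p [(gen_b (i + 1), True)]) (word_class n p [(gen_f, True)]) (fst g) (snd g)"

lemma Gamma_NF_carrier: "Gamma_NF n p g \<in> carrier (Gamma n p)"
  unfolding Gamma_NF_def by (rule heis_group.NF_carrier[OF heis_group_Gamma])

lemma Gamma_NF_letter:
  assumes "x \<in> Gamma_gens n"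
  shows "word_class n p [(x, True)] \<otimes>\<^bsub>Gamma n p\<^esub> Gamma_NF n p g = Gamma_NF n p (heis_mult n (letter_val (x, True)) g)"
proof (cases x)
  case (gen_a i)
  then have i: "i - 1 < n" "i = i - 1 + 1" using assms by (auto simp: Gamma_gens_def)
  have h: "heis_mult n (letter_val (x, True)) g = (wt (2 * (i - 1)) 1 + fst g, snd g)"
    by (simp only: gen_a heis_mult_def letter_val.simps fst_conv snd_conv letter_sign_def if_True heis_cocycle_wt(1) add_0_left add_0_right)
  show ?thesis
    using heis_group.NF_alpha[OF heis_group_Gamma i(1), of p "fst g" "snd g", folded i(2)]
    unfolding h unfolding Gamma_NF_def fst_conv snd_conv gen_a .
next
  case (gen_b i)
  then have i: "i - 1 < n" "i = i - 1 + 1" using assms by (auto simp: Gamma_gens_def)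
  have h: "heis_mult n (letter_val (x, True)) g = (wt (2 * (i - 1) + 1) 1 + fst g, snd g + fst g (2 * (i - 1)))"
    by (simp only: gen_b heis_mult_def letter_val.simps fst_conv snd_conv letter_sign_def if_True heis_cocycle_wt(3)[OF i(1)] add_0_left mult_1_left)
  show ?thesis
    using heis_group.NF_beta[OF heis_group_Gamma i(1), of p "fst g" "snd g", folded i(2)]
    unfolding h unfolding Gamma_NF_def fst_conv snd_conv gen_b .
next
  case gen_f
  have h: "heis_mult n (letter_val (x, True)) g = (fst g, snd g - 1)"
    by (simp add: gen_f heis_mult_def letter_sign_def heis_cocycle_0)
  show ?thesis
    using heis_group.NF_phi[OF heis_group_Gamma, of n p "fst g" "snd g"]
    unfolding h unfolding Gamma_NF_def fst_conv snd_conv gen_f .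
qed

lemma Gamma_NF_letter':
  assumes "x \<in> Gamma_gens n"
  shows "word_class n p [(x, b)] \<otimes>\<^bsub>Gamma n p\<^esub> Gamma_NF n p g = Gamma_NF n p (heis_mult n (letter_val (x, b)) g)"
proof (cases b)
  case False
  interpret group "Gamma n p" by (rule group_Gamma)
  let ?h = "heis_mult n (letter_val (x, False)) g"
  have "heis_mult n (letter_val (x, True)) (letter_val (x, False)) = (0, 0)"
    by (simp add: heis_mult_def letter_val_inv heis_cocycle_minus heis_cocycle_letter_val)
  then have "Gamma_NF n p g = word_class n p [(x, True)] \<otimes>\<^bsub>Gamma n p\<^esub> Gamma_NF n p ?h"
    unfolding Gamma_NF_letter[OF assms] by (simp only: heis_mult_assoc[symmetric] heis_mult_unit)
  then have "Gamma_NF n p ?h = inv\<^bsub>Gamma n p\<^esub> word_class n p [(x, True)] \<otimes>\<^bsub>Gamma n p\<^esub> Gamma_NF n p g"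
    using inv_solve_left[OF Gamma_NF_carrier word_class_carrier[OF Gamma_words_letter[OF assms]] Gamma_NF_carrier] by blast
  then show ?thesis
    by (simp only: False word_class_letter_inv[OF assms])
qed (simp only: Gamma_NF_letter[OF assms])

lemma Gamma_NF_trivial:
  assumes "\<And>j. j < 2 * n \<Longrightarrow> int p dvd fst g j" "int p dvd snd g"
  shows "Gamma_NF n p g = \<one>\<^bsub>Gamma n p\<^esub>"
proof -
  have pw: "word_class n p [(x, True)] [^]\<^bsub>Gamma n p\<^esub> p = \<one>\<^bsub>Gamma n p\<^esub>" if "x \<in> Gamma_gens n" for x
  proof -
    have "power_word x p \<in> Gamma_words n" using that by (auto simp: power_word_def words_def)
    then show ?thesis
      unfolding word_class_power[OF that] by (rule word_class_relator[OF Gamma_relatorsI(1)[OF that]])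
  qed
  have g: "gen_f \<in> Gamma_gens n" "i < n \<Longrightarrow> gen_a (i + 1) \<in> Gamma_gens n" "i < n \<Longrightarrow> gen_b (i + 1) \<in> Gamma_gens n" for i
    by (auto simp: Gamma_gens_def)
  show ?thesis
    unfolding Gamma_NF_def
    by (rule heis_group.NF_trivial[OF heis_group_Gamma pw[OF g(2)] pw[OF g(3)] pw[OF g(1)] assms])
qed

lemma Gamma_NF_one: "Gamma_NF n p (0, 0) = \<one>\<^bsub>Gamma n p\<^esub>"
  by (rule Gamma_NF_trivial) simp_all

text \<open>Together with \<open>Gamma_NF_trivial\<close> this shows that a word is trivial in the
  group once its value vanishes modulo p, which is what effectiveness requires.\<close>

lemma word_class_eq_Gamma_NF: "u \<in> Gamma_words n \<Longrightarrow> word_class n p u = Gamma_NF n p (word_val n u)"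
proof (induction u)
  case (Cons l u)
  obtain x b where l: "l = (x, b)" by (cases l)
  have x: "x \<in> Gamma_gens n" and u: "u \<in> Gamma_words n" using Cons.prems by (auto simp: l words_def)
  have "word_class n p (l # u) = word_class n p [(x, b)] \<otimes>\<^bsub>Gamma n p\<^esub> word_class n p u"
    using word_class_mult[OF Gamma_words_letter[OF x] u, of p b] by (simp only: l append.simps)
  then show ?case
    by (simp only: Cons.IH[OF u] Gamma_NF_letter'[OF x] l word_val.simps)
qed (simp only: word_val.simps Gamma_NF_one word_class_one)

lemma word_class_eqD:
  assumes "u \<in> Gamma_words n" "v \<in> Gamma_words n" "word_class n p u = word_class n p v"
  shows "cong_pair p (word_val n u) (word_val n v)"
  using eq_equiv_class[OF assms(3)[unfolded word_class_def] equiv_word_rel assms(2)]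
  by (auto simp: word_rel_def intro: word_val_word_eq)

context heis_bundle
begin

text \<open>The choice of a representative word is harmless: two of them have values congruent
  modulo p, and congruent values give the same bundle map by \<open>B_mod\<close>.\<close>

definition act :: "Gamma_gen word set \<Rightarrow> vb_pt \<Rightarrow> vb_pt" where
  "act \<gamma> = (let g = word_val n (SOME u. u \<in> Gamma_words n \<and> \<gamma> = word_class n p u) in B (fst g) (snd g))"

lemma B_cong_pair:
  assumes "cong_pair p g h"
  shows "B (fst g) (snd g) = B (fst h) (snd h)"
proof -
  have dvd: "int p dvd fst g j - fst h j" "int p dvd snd g - snd h" for j
    using assms by (auto simp: cong_pair_def cong_iff_dvd_diff)
  have "fst g = (\<lambda>j. fst h j + int p * ((fst g j - fst h j) div int p))"
    "snd g = snd h + int p * ((snd g - snd h) div int p)"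
    by (simp_all add: dvd)
  then show ?thesis using B_mod by metis
qed

lemma act_word_class:
  assumes "u \<in> Gamma_words n"
  shows "act (word_class n p u) = B (fst (word_val n u)) (snd (word_val n u))"
proof -
  let ?v = "SOME v. v \<in> Gamma_words n \<and> word_class n p u = word_class n p v"
  have "?v \<in> Gamma_words n \<and> word_class n p u = word_class n p ?v"
    by (rule someI[of _ u]) (use assms in simp)
  then have "cong_pair p (word_val n ?v) (word_val n u)"
    using word_class_eqD[OF _ assms, of ?v p] by (elim conjE) (simp only: simp_thms)
  then show ?thesis unfolding act_def Let_def by (rule B_cong_pair)
qed

lemma act_B: "\<gamma> \<in> carrier (Gamma n p) \<Longrightarrow> \<exists>g. \<gamma> = Gamma_NF n p g \<and> act \<gamma> = B (fst g) (snd g)"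
  using word_class_ex[of \<gamma> n p] act_word_class word_class_eq_Gamma_NF by metis

lemma act_group_action: "group_action (Gamma n p) E act"
  unfolding group_action_def group_hom_def group_hom_axioms_def
proof (intro conjI group_Gamma group_BijGroup homI)
  have ext: "B q w \<in> extensional E" for q w by (simp add: B_def)
  fix \<gamma> assume \<gamma>: "\<gamma> \<in> carrier (Gamma n p)"
  show B: "act \<gamma> \<in> carrier (BijGroup E)"
    using act_B[OF \<gamma>] by (auto simp: BijGroup_def Bij_def ext B_bij)
  fix \<delta> assume \<delta>: "\<delta> \<in> carrier (Gamma n p)"
  obtain u v where uv: "u \<in> Gamma_words n" "\<gamma> = word_class n p u" "v \<in> Gamma_words n" "\<delta> = word_class n p v"
    using word_class_ex[OF \<gamma>] word_class_ex[OF \<delta>] by blast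
  have D: "act \<delta> \<in> carrier (BijGroup E)"
    using act_B[OF \<delta>] by (auto simp: BijGroup_def Bij_def ext B_bij)
  have "act \<gamma> \<otimes>\<^bsub>BijGroup E\<^esub> act \<delta> = compose E (act \<gamma>) (act \<delta>)"
    using B D by (simp add: BijGroup_def)
  also have "\<dots> = B (fst (word_val n (u @ v))) (snd (word_val n (u @ v)))"
  proof (rule extensionalityI[of _ E])
    show "compose E (act \<gamma>) (act \<delta>) \<in> extensional E" by simp
    show "B (fst (word_val n (u @ v))) (snd (word_val n (u @ v))) \<in> extensional E" by (rule ext)
    fix e assume e: "e \<in> E"
    then show "compose E (act \<gamma>) (act \<delta>) e = B (fst (word_val n (u @ v))) (snd (word_val n (u @ v))) e"
      by (simp only: compose_eq[OF e] uv act_word_class B_mult[OF e] word_val_append heis_mult_def fst_conv snd_conv)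
  qed
  also have "\<dots> = act (\<gamma> \<otimes>\<^bsub>Gamma n p\<^esub> \<delta>)"
    by (simp only: uv word_class_mult act_word_class words_append)
  finally show "act (\<gamma> \<otimes>\<^bsub>Gamma n p\<^esub> \<delta>) = act \<gamma> \<otimes>\<^bsub>BijGroup E\<^esub> act \<delta>" by (rule HOL.sym)
qed

lemma act_properties:
  "acts_by_bundle_automorphisms (Gamma n p) (2 * n) r act"
  "effective (Gamma n p) E act"
  "invariant_section (Gamma n p) (2 * n) r act sect"
proof -
  show "acts_by_bundle_automorphisms (Gamma n p) (2 * n) r act"
    unfolding acts_by_bundle_automorphisms_def using act_group_action act_B B_automorphism by metis
  show "effective (Gamma n p) E act"
    unfolding effective_def
  proof (intro ballI impI)
    fix \<gamma> assume \<gamma>: "\<gamma> \<in> carrier (Gamma n p)" "\<forall>e\<in>E. act \<gamma> e = e"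
    obtain g where g: "\<gamma> = Gamma_NF n p g" "act \<gamma> = B (fst g) (snd g)" using act_B[OF \<gamma>(1)] by blast
    have "B (fst g) (snd g) e = e" if "e \<in> E" for e using \<gamma>(2) that by (simp add: g(2))
    from B_trivial[OF this] show "\<gamma> = \<one>\<^bsub>Gamma n p\<^esub>"
      unfolding g(1) by (intro Gamma_NF_trivial)
  qed
  show "invariant_section (Gamma n p) (2 * n) r act sect"
    unfolding invariant_section_def
  proof (intro ballI)
    fix \<gamma> \<theta> assume "\<gamma> \<in> carrier (Gamma n p)" and \<theta>: "\<theta> \<in> torus (2 * n)"
    then obtain g where g: "act \<gamma> = B (fst g) (snd g)" using act_B by blast
    show "det_map r (act \<gamma>) (\<theta>, sect \<theta>) = (base_map r (act \<gamma>) \<theta>, sect (base_map r (act \<gamma>) \<theta>))"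
      unfolding g by (rule sect_invariant[OF \<theta>])
  qed
qed

end

theorem theorem1p2:
  fixes n :: nat
  assumes "n \<ge> 1"
  shows "\<exists>\<tau> M :: nat. \<tau> \<ge> 1 \<and> M \<ge> 1 \<and>
    (\<forall>p :: nat. prime p \<and> p > M \<and> [p = 1] (mod (n + 1)) \<longrightarrow>
      (\<exists>\<phi>. acts_by_bundle_automorphisms (Gamma n p) (2 * n) \<tau> \<phi> \<and>
           effective (Gamma n p) (total_space (2 * n) \<tau>) \<phi> \<and>
           (\<exists>s. det_section (2 * n) \<tau> s \<and>
                nowhere_vanishing (2 * n) \<tau> s \<and>
                invariant_section (Gamma n p) (2 * n) \<tau> \<phi> s)))"
proof -
  obtain r where r: "\<forall>p. prime p \<and> [p = 1] (mod (n + 1)) \<longrightarrow>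
    (\<exists>ks :: (nat \<Rightarrow> int) list. \<exists>\<kappa> :: nat \<Rightarrow> int. length ks = r \<and>
       gauge (map (\<lambda>k l. int p * k l) ks) (replicate r 0) \<and>
       (\<forall>s<r. \<forall>l<n. [(ks ! s) l = \<kappa> s] (mod int p)) \<and>
       (\<exists>s<r. \<kappa> s = 1) \<and> (\<forall>l<n. (\<Sum>s<r. (ks ! s) l) = 0))"
    by (rule exE[OF trivial_sum_exists[OF assms]])
  have act: "r \<ge> 1 \<and> (\<exists>\<phi>. acts_by_bundle_automorphisms (Gamma n p) (2 * n) r \<phi> \<and>
           effective (Gamma n p) (total_space (2 * n) r) \<phi> \<and>
           (\<exists>s. det_section (2 * n) r s \<and>
                nowhere_vanishing (2 * n) r s \<and>
                invariant_section (Gamma n p) (2 * n) r \<phi> s))"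
    if p: "prime p" "[p = 1] (mod (n + 1))" for p
  proof -
    note E = mp[OF spec[OF r, of p] conjI[OF p]]
    obtain ks :: "(nat \<Rightarrow> int) list" and \<kappa> :: "nat \<Rightarrow> int" where ks: "length ks = r"
      "gauge (map (\<lambda>k l. int p * k l) ks) (replicate r 0)"
      "\<forall>s<r. \<forall>l<n. [(ks ! s) l = \<kappa> s] (mod int p)" "\<exists>s<r. \<kappa> s = 1" "\<forall>l<n. (\<Sum>s<r. (ks ! s) l) = 0"
      using E by blast
    let ?ks = "map (\<lambda>k l. int p * k l) ks" and ?z = "replicate r (0 :: nat \<Rightarrow> int)"
    obtain F G where FG: "qper_mat ?ks ?z F" "qper_mat ?z ?ks G"
      "\<And>x. F x * G x = 1\<^sub>m r" "\<And>x. G x * F x = 1\<^sub>m r"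
      using ks(2) ks(1) unfolding gauge_def by auto
    have w: "?ks ! s - ?z ! t = (\<lambda>l. int p * (ks ! s) l)" "?z ! t - ?ks ! s = (\<lambda>l. - (int p * (ks ! s) l))"
      if "s < r" "t < r" for s t
      using that ks(1) by (simp_all add: fun_eq_iff)
    interpret heis_bundle n p r "\<lambda>s l. (ks ! s) l" \<kappa> F G
    proof
      show "F x \<in> carrier_mat r r" "G x \<in> carrier_mat r r" for x
        using qper_matD(1)[OF FG(1), of x] qper_matD(1)[OF FG(2), of x] ks(1) by simp_all
      show "qper (\<lambda>l. int p * (ks ! s) l) (\<lambda>x. F x $$ (s, t))" "qper (\<lambda>l. - (int p * (ks ! s) l)) (\<lambda>x. G x $$ (t, s))"
        if "s < r" "t < r" for s t
        using qper_matD(4)[OF FG(1), of s t] qper_matD(4)[OF FG(2), of t s] ks(1) that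
        unfolding w[OF that] by simp_all
    qed (use assms p(1) FG(3,4) ks in simp_all)
    have "r \<ge> 1" using ks(4) by auto
    with act_properties sect_det_section sect_nowhere_vanishing show ?thesis by blast
  qed
  show ?thesis
  proof (cases "\<exists>p. prime p \<and> [p = 1] (mod (n + 1))")
    case True
    then have "r \<ge> 1" using act by blast
    \<comment> \<open>Every prime exceeds 1 and \<open>r\<close> serves all admissible primes, so M
      = 1 can be taken.\<close>
    with act show ?thesis by (intro exI[of _ r] exI[of _ 1]) auto
  \<comment> \<open>Without an admissible prime the assertion is vacuous, but the positivity of
    \<open>r\<close> is not known; the rank 1 is taken instead.\<close>
  qed (intro exI[of _ 1], auto)
qed

end
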